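(* Let $T$ be the tetrahedron whose four faces are congruent isosceles triangles with two sides of length $\sqrt{3}$ and one side of length $2$ (equivalently, one of three congruent tetrahedra into which a triangular prism is cut), scaled to unit volume. Then $T$ admits an orientation-preserving face-to-face tiling of $\mathbb{R}^3$, and $T$ has least surface area among all unit-volume tetrahedra admitting an orientation-preserving face-to-face tiling of $\mathbb{R}^3$.
   Context: A face-to-face tiling of $\mathbb{R}^3$ by a polyhedron is a covering of $\mathbb{R}^3$ by congruent copies of it with pairwise disjoint interiors, such that any two tiles meet only along entire faces, entire edges, at vertices, or not at all. Such a tiling is orientation-preserving if any two tiles are equivalent under an orientation-preserving isometry of $\mathbb{R}^3$. *)

theory Defs
  imports "HOL-Analysis.Analysis"
begin

definition isometry3 :: "(real^3 \<Rightarrow> real^3) \<Rightarrow> bool" where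
  "isometry3 f \<longleftrightarrow> (\<forall>x y. dist (f x) (f y) = dist x y)"

definition rigid_motion3 :: "(real^3 \<Rightarrow> real^3) \<Rightarrow> bool" where
  "rigid_motion3 g \<longleftrightarrow>
     (\<exists>f b. orthogonal_transformation f \<and> det (matrix f) = 1 \<and> g = (\<lambda>x. f x + b))"

definition face_to_face_tiling :: "(real^3) set \<Rightarrow> (real^3) set set \<Rightarrow> bool" where
  "face_to_face_tiling P \<T> \<longleftrightarrow>
     (\<forall>Q\<in>\<T>. \<exists>f. isometry3 f \<and> Q = f ` P) \<and>
     \<Union>\<T> = UNIV \<and>
     (\<forall>Q\<in>\<T>. \<forall>R\<in>\<T>. Q \<noteq> R \<longrightarrow> interior Q \<inter> interior R = {}) \<and>
     (\<forall>Q\<in>\<T>. \<forall>R\<in>\<T>. Q \<noteq> R \<longrightarrow>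
        Q \<inter> R = {} \<or> (Q \<inter> R face_of Q \<and> Q \<inter> R face_of R))"

definition orientation_preserving_tiling :: "(real^3) set set \<Rightarrow> bool" where
  "orientation_preserving_tiling \<T> \<longleftrightarrow>
     (\<forall>Q\<in>\<T>. \<forall>R\<in>\<T>. \<exists>g. rigid_motion3 g \<and> g ` Q = R)"

definition admits_op_ftf_tiling :: "(real^3) set \<Rightarrow> bool" where
  "admits_op_ftf_tiling P \<longleftrightarrow>
     (\<exists>\<T>. face_to_face_tiling P \<T> \<and> orientation_preserving_tiling \<T>)"

definition tri_area :: "real^3 \<Rightarrow> real^3 \<Rightarrow> real^3 \<Rightarrow> real" where
  "tri_area a b c = norm (cross3 (b - a) (c - a)) / 2"

definition tetra_surface_area :: "real^3 \<Rightarrow> real^3 \<Rightarrow> real^3 \<Rightarrow> real^3 \<Rightarrow> real" where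
  "tetra_surface_area a b c d =
     tri_area a b c + tri_area a b d + tri_area a c d + tri_area b c d"

end

theory Submission
  imports Defs
begin

text \<open>Write \<open>S\<close> and \<open>V\<close> for surface area and volume. The tetrahedron \<open>T\<close> has \<open>S\<^sup>3 = 288 \<surd>2 V\<^sup>2\<close>; it is an
  alcove of the affine Weyl group of type \<open>A\<^sub>3\<close>, and the alcoves form the required tiling.

  For the lower bound, walk around an edge of a tile of some other tiling. Consecutive tiles share a
  face, all tiles are properly congruent, and the dihedral angles add up to a full turn. Crossing a
  single face already shows that the tile has a plane of symmetry, unless its edges form two
  equilateral paths of three edges; in the latter case the angles around an edge cannot add up. If the
  tile is symmetric and two faces at an edge cannot be exchanged, then the two kinds of faces alternate
  around this edge, so that their number is even and the angle is either right or at most \<open>\<pi>/3\<close>.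
  Going through the possible coincidences of edge lengths, these restrictions on the angles force
  \<open>S\<^sup>3 \<ge> 288 \<surd>2 V\<^sup>2\<close>. The only other case is that of five equal edges.\<close>

section \<open>Mirror-symmetric tetrahedra: the isoperimetric inequalities\<close>

text \<open>Why one crossing says so much: two tiles matched by the identity on a common face would
  be mirror images in its plane. A proper motion between them therefore uses a symmetry of the face,
  or brings another face there, or shows that the tile equals its own mirror image. Only lengths are
  remembered in this argument and in the walks. A tile at the edge is an even permutation of the
  vertices of one fixed tile, so the combinatorial claims are finite checks over twelve permutations
  of equalities between six lengths. Local finiteness and the closing of the walk are not part of
  the definition of a tiling and have to be derived. On the metric side no single estimate covers
  all shapes. The comparison by AM-GM is sharp at the Sommerville tetrahedron but needs control of
  the cosine at CD; estimates of the lateral area over one face cover shapes far from it. The angle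
  restrictions serve to bring each case within reach of such an estimate.\<close>

lemma sqrt3_sqrt2_bound: "45 * sqrt 3 \<ge> (55 * sqrt 2 :: real)"
  by (rule power2_le_imp_le) (auto simp: power_mult_distrib)

text \<open>A tetrahedron \<open>ABCD\<close> with \<open>AC = AD\<close> and \<open>BC = BD\<close>, scaled so that \<open>CD = 2\<close>, is described by
  the distances \<open>\<alpha>\<close>, \<open>\<beta>\<close> of \<open>A\<close>, \<open>B\<close> from the midpoint of \<open>CD\<close> and the cosine \<open>C\<close> of the dihedral angle
  at \<open>CD\<close>. The faces \<open>ACD\<close>, \<open>BCD\<close> have areas \<open>\<alpha>\<close>, \<open>\<beta>\<close>, the other two faces together have area \<open>W\<close>,
  and the volume is \<open>\<alpha>\<beta>\<surd>(1 - C\<^sup>2)/3\<close>.\<close>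

abbreviation shape_bound :: "real \<Rightarrow> real \<Rightarrow> real \<Rightarrow> real \<Rightarrow> bool" where
  "shape_bound \<alpha> \<beta> C W \<equiv> (\<alpha> + \<beta> + W)^3 \<ge> 32 * sqrt 2 * (\<alpha> * \<beta>)\<^sup>2 * (1 - C\<^sup>2)"

text \<open>In \<open>W2\<close> the first three terms are the square of AB by the law of cosines,
  and the last is the squared double area of the triangle formed by A, B and the midpoint of CD. As
  half of CD is 1, the sum is the square of AB times the squared distance of C from the line
  AB.\<close>

locale mirror_shape =
  fixes \<alpha> \<beta> C W :: real
  assumes \<alpha>: "\<alpha> > 0" and \<beta>: "\<beta> > 0" and C: "-1 < C" "C < 1" and W: "W > 0"
    and W2: "W\<^sup>2 = \<alpha>\<^sup>2 + \<beta>\<^sup>2 - 2 * \<alpha> * \<beta> * C + (\<alpha> * \<beta>)\<^sup>2 * (1 - C\<^sup>2)"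
begin

lemma swap: "mirror_shape \<beta> \<alpha> C W"
  using \<alpha> \<beta> C W W2 by unfold_locales (auto simp: algebra_simps)

lemma C2: "C\<^sup>2 < 1"
  using C by (simp add: abs_square_less_1)

text \<open>AM-GM is used twice, for \<alpha> against \<beta> and for their sum \<open>s\<close>
  against \<open>W\<close>; both are equalities at \<alpha> = \<beta> = sqrt 2, C = 0. What remains
  is an inequality in \<open>y\<close> and \<open>C\<close> alone.\<close>

lemma area_bound_amgm:
  assumes y: "y = \<alpha> * \<beta> * (1 + C)" and *: "(2 + y)^3 \<ge> 16 * y\<^sup>2 * (1 - C) * (1 + C)\<^sup>2"
  shows "shape_bound \<alpha> \<beta> C W"
proof -
  define p where "p = \<alpha> * \<beta>"
  define s where "s = \<alpha> + \<beta>"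
  have p: "p > 0" using \<alpha> \<beta> by (simp add: p_def)
  have s: "s > 0" using \<alpha> \<beta> by (simp add: s_def)
  have s2: "s\<^sup>2 \<ge> 4 * p"
    using zero_le_power2[of "\<alpha> - \<beta>"] by (simp add: s_def p_def power2_eq_square algebra_simps)
  have "W\<^sup>2 = s\<^sup>2 - 2 * p * (1 + C) + p\<^sup>2 * (1 - C\<^sup>2)"
    unfolding W2 s_def p_def by (simp add: power2_eq_square algebra_simps)
  also have "\<dots> \<ge> 4 * p - 2 * p * (1 + C) + p\<^sup>2 * (1 - C\<^sup>2)" using s2 by simp
  also have "4 * p - 2 * p * (1 + C) + p\<^sup>2 * (1 - C\<^sup>2) = p * (1 - C) * (2 + y)"
    unfolding y p_def[symmetric] by (simp add: power2_eq_square algebra_simps)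
  finally have W2': "W\<^sup>2 \<ge> p * (1 - C) * (2 + y)" .
  have y0: "y > 0" unfolding y using \<alpha> \<beta> C by simp
  have nn: "0 \<le> p * (1 - C) * (2 + y)" using p C y0 by simp
  have "(s + W)\<^sup>2 \<ge> 4 * (s * W)"
    using zero_le_power2[of "s - W"] by (simp add: power2_eq_square algebra_simps)
  then have "((s + W)\<^sup>2)\<^sup>2 \<ge> (4 * (s * W))\<^sup>2"
    using s W by (intro power_mono) auto
  then have "((s + W)\<^sup>2)\<^sup>2 \<ge> 16 * (s\<^sup>2 * W\<^sup>2)" by (simp add: power_mult_distrib)
  moreover have "s\<^sup>2 * W\<^sup>2 \<ge> (4 * p) * (p * (1 - C) * (2 + y))"
    by (rule mult_mono) (use s2 W2' nn p in auto)
  ultimately have "((s + W)\<^sup>2)\<^sup>2 \<ge> 16 * ((4 * p) * (p * (1 - C) * (2 + y)))" by simp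
  \<comment> \<open>Twelfth powers remove the root hidden in \<open>W\<close> and bring in the cube
    of \<open>2 + y\<close>, to which the hypothesis applies.\<close>
  then have "(((s + W)\<^sup>2)\<^sup>2)^3 \<ge> (16 * ((4 * p) * (p * (1 - C) * (2 + y))))^3"
    using nn p by (intro power_mono) auto
  also have "(16 * ((4 * p) * (p * (1 - C) * (2 + y))))^3 = 262144 * p^6 * (1 - C)^3 * (2 + y)^3"
    by algebra
  also have "\<dots> \<ge> 262144 * p^6 * (1 - C)^3 * (16 * y\<^sup>2 * (1 - C) * (1 + C)\<^sup>2)"
    using * p C by (intro mult_left_mono) auto
  also have "262144 * p^6 * (1 - C)^3 * (16 * y\<^sup>2 * (1 - C) * (1 + C)\<^sup>2) = 4194304 * (p\<^sup>2 * (1 - C\<^sup>2))^4"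
    unfolding y p_def[symmetric] by algebra
  also have "\<dots> = (32 * sqrt 2 * (p\<^sup>2 * (1 - C\<^sup>2)))^4"
  proof -
    have "(sqrt 2)^4 = (((sqrt 2)\<^sup>2)\<^sup>2 :: real)" by (simp only: power_mult[symmetric]) simp
    then have "(sqrt 2)^4 = (4::real)" by (simp only: real_sqrt_pow2) simp
    then show ?thesis by (simp add: power_mult_distrib)
  qed
  finally have "(32 * sqrt 2 * (p\<^sup>2 * (1 - C\<^sup>2)))^4 \<le> ((s + W)^3)^4"
    by (simp flip: power_mult)
  then have "32 * sqrt 2 * (p\<^sup>2 * (1 - C\<^sup>2)) \<le> (s + W)^3"
    using s W by (subst (asm) power_mono_iff) (use C2 in auto)
  then show ?thesis by (simp add: s_def p_def mult.assoc)
qed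

lemma area_bound_obtuse:
  assumes "C \<le> -1/4"
  shows "shape_bound \<alpha> \<beta> C W"
proof (rule area_bound_amgm[OF refl])
  define y where "y = \<alpha> * \<beta> * (1 + C)"
  have y0: "y > 0" unfolding y_def using \<alpha> \<beta> C by simp
  \<comment> \<open>16 * 27/32 = 27/2 is the minimum of (2 + y)^3 / y^2, attained at y = 4.\<close>
  have e: "27/32 - (1 - C) * (1 + C)\<^sup>2 = 9/64 + (-1/4 - C) * (19/16 + C/4 + (-C - C\<^sup>2))"
    by (simp add: power2_eq_square field_simps)
  have "C * (1 + C) \<le> 0" using C assms by (intro mult_nonpos_nonneg) auto
  then have "-C - C\<^sup>2 \<ge> 0" by (simp add: power2_eq_square algebra_simps)
  then have "(-1/4 - C) * (19/16 + C/4 + (-C - C\<^sup>2)) \<ge> 0"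
    using C assms by (intro mult_nonneg_nonneg) auto
  then have "(1 - C) * (1 + C)\<^sup>2 \<le> 27/32" using e by linarith
  then have "16 * y\<^sup>2 * ((1 - C) * (1 + C)\<^sup>2) \<le> 16 * y\<^sup>2 * (27/32)" by (intro mult_left_mono) auto
  also have "\<dots> \<le> (2 + y)^3"
  proof -
    have "(2 + y)^3 - 16 * y\<^sup>2 * (27/32) = (y - 4)\<^sup>2 * (y + 1/2)"
      by (simp add: power2_eq_square power3_eq_cube algebra_simps)
    also have "\<dots> \<ge> 0" using y0 by simp
    finally show ?thesis by simp
  qed
  finally show "16 * (\<alpha> * \<beta> * (1 + C))\<^sup>2 * (1 - C) * (1 + C)\<^sup>2 \<le> (2 + \<alpha> * \<beta> * (1 + C))^3"
    by (simp add: y_def mult.assoc)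
qed

text \<open>With \<open>ACD\<close> as base, \<open>\<beta> + W\<close> is the lateral area and \<open>2 (1 + \<surd>(1 + \<alpha>\<^sup>2))\<close> the perimeter of the base.\<close>

lemma lateral_area_bound:
  "(\<beta> + W)\<^sup>2 \<ge> \<alpha>\<^sup>2 + (1 + sqrt (1 + \<alpha>\<^sup>2))\<^sup>2 * (\<beta>\<^sup>2 * (1 - C\<^sup>2))"
proof -
  define r where "r = sqrt (1 + \<alpha>\<^sup>2)"
  define s where "s = sqrt (1 - C\<^sup>2)"
  have r2: "r\<^sup>2 = 1 + \<alpha>\<^sup>2" by (simp add: r_def)
  have s2: "s\<^sup>2 = 1 - C\<^sup>2" using C2 by (simp add: s_def)
  have n1: "norm (Complex (\<beta> * C) (\<beta> * s)) = \<beta>"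
  proof -
    have "(\<beta> * C)\<^sup>2 + (\<beta> * s)\<^sup>2 = \<beta>\<^sup>2" by (simp add: power_mult_distrib s2 algebra_simps)
    then show ?thesis using \<beta> by (simp add: norm_complex_def)
  qed
  have n2: "norm (Complex (\<alpha> - \<beta> * C) (r * \<beta> * s)) = W"
  proof -
    have "(\<alpha> - \<beta> * C)\<^sup>2 + (r * \<beta> * s)\<^sup>2 = W\<^sup>2"
      unfolding W2 power_mult_distrib s2 r2 by (simp add: power2_eq_square algebra_simps)
    then show ?thesis using W by (simp add: norm_complex_def)
  qed
  \<comment> \<open>The triangle inequality for two plane vectors. The first coordinates are the
    areas of the lateral faces projected to the base, adding up to \<alpha>; the second ones are
    height times half the base edges.\<close>
  have "norm (Complex \<alpha> ((1 + r) * \<beta> * s)) \<le> \<beta> + W"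
    using norm_triangle_ineq[of "Complex (\<beta> * C) (\<beta> * s)" "Complex (\<alpha> - \<beta> * C) (r * \<beta> * s)"]
    unfolding n1 n2 by (simp add: complex_add algebra_simps)
  then have "(norm (Complex \<alpha> ((1 + r) * \<beta> * s)))\<^sup>2 \<le> (\<beta> + W)\<^sup>2"
    by (intro power_mono) auto
  then show ?thesis
    by (simp add: cmod_power2 power_mult_distrib s2 r_def[symmetric] mult.assoc)
qed

text \<open>\<open>R\<close> is the squared half perimeter of the base and \<open>h\<close> the
  squared height, so the lateral area \<open>L\<close> satisfies L^2 - \<alpha>^2 >= R h. With
  \<open>k\<close> as isoperimetric constant of the base, a quadratic condition on L / \<alpha> is
  left.\<close>

lemma area_bound_base:
  assumes k: "(1 + sqrt (1 + \<alpha>\<^sup>2))\<^sup>2 \<ge> k * \<alpha>" "k > 0"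
    and x: "k * (\<alpha> + \<beta> + W)\<^sup>2 \<ge> 32 * sqrt 2 * \<alpha> * (\<beta> + W - \<alpha>)"
  shows "shape_bound \<alpha> \<beta> C W"
proof -
  define L where "L = \<beta> + W"
  define R where "R = (1 + sqrt (1 + \<alpha>\<^sup>2))\<^sup>2"
  define h where "h = \<beta>\<^sup>2 * (1 - C\<^sup>2)"
  have h: "h > 0" using \<beta> C2 by (simp add: h_def)
  have L: "L\<^sup>2 \<ge> \<alpha>\<^sup>2 + R * h" using lateral_area_bound by (simp add: L_def R_def h_def)
  have R: "R > 0" using k \<alpha> mult_pos_pos[of k \<alpha>] unfolding R_def by linarith
  have "L\<^sup>2 > \<alpha>\<^sup>2" using L R h by (smt (verit) mult_pos_pos)
  then have La: "L > \<alpha>" using \<beta> W \<alpha> by (simp add: L_def power2_less_imp_less)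
  have "(\<alpha> + L)^3 * (L - \<alpha>) = (\<alpha> + L)\<^sup>2 * (L\<^sup>2 - \<alpha>\<^sup>2)" by algebra
  also have "\<dots> \<ge> (\<alpha> + L)\<^sup>2 * (R * h)" using L by (intro mult_left_mono) auto
  also have "(\<alpha> + L)\<^sup>2 * (R * h) \<ge> (\<alpha> + L)\<^sup>2 * (k * \<alpha> * h)"
    using k h by (intro mult_left_mono mult_right_mono) (auto simp: R_def)
  also have "(\<alpha> + L)\<^sup>2 * (k * \<alpha> * h) = (k * (\<alpha> + L)\<^sup>2) * (\<alpha> * h)" by simp
  also have "\<dots> \<ge> (32 * sqrt 2 * \<alpha> * (L - \<alpha>)) * (\<alpha> * h)"
    using x \<alpha> h by (intro mult_right_mono) (auto simp: L_def add.assoc)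
  finally have "(32 * sqrt 2 * \<alpha>\<^sup>2 * h) * (L - \<alpha>) \<le> (\<alpha> + L)^3 * (L - \<alpha>)"
    by (simp add: power2_eq_square mult_ac)
  then have "32 * sqrt 2 * \<alpha>\<^sup>2 * h \<le> (\<alpha> + L)^3" using La by simp
  then show ?thesis by (simp add: L_def h_def power_mult_distrib add.assoc mult_ac)
qed

text \<open>Equality holds for the equilateral triangle, r = 2 and \<alpha> = sqrt 3; hence the
  double root in the factorisation.\<close>

lemma triangle_isoperimetric: "(1 + sqrt (1 + \<alpha>\<^sup>2))\<^sup>2 \<ge> 3 * sqrt 3 * \<alpha>"
proof -
  define r where "r = sqrt (1 + \<alpha>\<^sup>2)"
  have r2: "r\<^sup>2 = 1 + \<alpha>\<^sup>2" by (simp add: r_def)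
  have r1: "r \<ge> 1" by (simp add: r_def)
  have a2: "\<alpha>\<^sup>2 = (r - 1) * (r + 1)" using r2 by (simp add: power2_eq_square algebra_simps)
  have "(3 * sqrt 3 * \<alpha>)\<^sup>2 = 27 * ((r - 1) * (r + 1))"
    by (simp add: power_mult_distrib a2)
  also have "\<dots> \<le> ((1 + r)\<^sup>2)\<^sup>2"
  proof -
    have "((1 + r)\<^sup>2)\<^sup>2 - 27 * ((r - 1) * (r + 1)) = (r + 1) * ((r - 2)\<^sup>2 * (r + 7))"
      by (simp add: power2_eq_square algebra_simps)
    also have "\<dots> \<ge> 0" using r1 by (intro mult_nonneg_nonneg) auto
    finally show ?thesis by simp
  qed
  finally show ?thesis
    unfolding r_def[symmetric] by (rule power2_le_imp_le) auto
qed

text \<open>The quotient of (\<alpha> + L)^2 by \<alpha> (L - \<alpha>) decreases until L = 3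
  \<alpha>. For L up to 2 \<alpha> it is at least 9, which is enough for the isoperimetric constant
  of arbitrary triangles.\<close>

lemma area_bound_low:
  assumes L: "\<beta> + W \<le> 2 * \<alpha>"
  shows "shape_bound \<alpha> \<beta> C W"
proof (rule area_bound_base[OF triangle_isoperimetric])
  define L where "L = \<beta> + W"
  have L0: "L > 0" using \<beta> W by (simp add: L_def)
  have "(\<alpha> + L)\<^sup>2 - 9 * \<alpha> * (L - \<alpha>) = (2 * \<alpha> - L) * (5 * \<alpha> - L)" by algebra
  also have "\<dots> \<ge> 0" using L L0 \<alpha> by (intro mult_nonneg_nonneg) (auto simp: L_def)
  finally have *: "(\<alpha> + L)\<^sup>2 \<ge> 9 * \<alpha> * (L - \<alpha>)" by simp
  have "32 * sqrt 2 * \<alpha> * (L - \<alpha>) \<le> 3 * sqrt 3 * (\<alpha> + L)\<^sup>2"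
  proof (cases "L \<ge> \<alpha>")
    case True
    \<comment> \<open>The quotient of sqrt 3 by sqrt 2 is at least 11/9, so 27 * sqrt 3 is at least
      33 * sqrt 2.\<close>
    have "32 * sqrt 2 * (\<alpha> * (L - \<alpha>)) \<le> (27 * sqrt 3) * (\<alpha> * (L - \<alpha>))"
      using True \<alpha> sqrt3_sqrt2_bound real_sqrt_ge_zero[of 2] real_sqrt_ge_zero[of 3]
      by (intro mult_right_mono mult_nonneg_nonneg) linarith+
    also have "\<dots> = 3 * sqrt 3 * (9 * \<alpha> * (L - \<alpha>))" by simp
    also have "\<dots> \<le> 3 * sqrt 3 * (\<alpha> + L)\<^sup>2" using * by (intro mult_left_mono) auto
    finally show ?thesis by (simp add: mult.assoc)
  next
    case False
    then have "32 * sqrt 2 * \<alpha> * (L - \<alpha>) \<le> 0" using \<alpha> by (intro mult_nonneg_nonpos) auto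
    also have "\<dots> \<le> 3 * sqrt 3 * (\<alpha> + L)\<^sup>2" by simp
    finally show ?thesis .
  qed
  then show "32 * sqrt 2 * \<alpha> * (\<beta> + W - \<alpha>) \<le> 3 * sqrt 3 * (\<alpha> + \<beta> + W)\<^sup>2"
    by (simp add: L_def add.assoc)
qed simp

text \<open>The quotient of (\<alpha> + L)^2 by \<alpha> (L - \<alpha>) is never below 8, its value
  at L = 3 \<alpha>. So 4 * sqrt 2 = 32 * sqrt 2 / 8 is the constant that leaves no condition on
  \<open>L\<close>.\<close>

lemma area_bound_slim:
  assumes "(1 + sqrt (1 + \<alpha>\<^sup>2))\<^sup>2 \<ge> 4 * sqrt 2 * \<alpha>"
  shows "shape_bound \<alpha> \<beta> C W"
proof (rule area_bound_base[OF assms])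
  define L where "L = \<beta> + W"
  have "(\<alpha> + L)\<^sup>2 - 8 * \<alpha> * (L - \<alpha>) = (L - 3 * \<alpha>)\<^sup>2" by algebra
  then have "(\<alpha> + L)\<^sup>2 \<ge> 8 * \<alpha> * (L - \<alpha>)" using zero_le_power2[of "L - 3 * \<alpha>"] by linarith
  then have "4 * sqrt 2 * (\<alpha> + L)\<^sup>2 \<ge> 4 * sqrt 2 * (8 * \<alpha> * (L - \<alpha>))" by (intro mult_left_mono) auto
  then show "32 * sqrt 2 * \<alpha> * (\<beta> + W - \<alpha>) \<le> 4 * sqrt 2 * (\<alpha> + \<beta> + W)\<^sup>2"
    by (simp add: L_def add.assoc mult.assoc)
qed simp

text \<open>At \<alpha>^2 = 8 the hypothesis of \<open>area_bound_slim\<close> is an equality: the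
  half perimeter is 4, and 16 = 4 * sqrt 2 * sqrt 8.\<close>

lemma area_bound_long:
  assumes "\<alpha>\<^sup>2 \<ge> 8"
  shows "shape_bound \<alpha> \<beta> C W"
proof (rule area_bound_slim)
  define r where "r = sqrt (1 + \<alpha>\<^sup>2)"
  have r2: "r\<^sup>2 = 1 + \<alpha>\<^sup>2" by (simp add: r_def)
  have r3: "r \<ge> 3" unfolding r_def by (rule real_le_rsqrt) (use assms in simp)
  have a2: "\<alpha>\<^sup>2 = (r - 1) * (r + 1)" using r2 by (simp add: power2_eq_square algebra_simps)
  have "(4 * sqrt 2 * \<alpha>)\<^sup>2 = 32 * ((r - 1) * (r + 1))" by (simp add: power_mult_distrib a2)
  also have "\<dots> \<le> ((1 + r)\<^sup>2)\<^sup>2"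
  proof -
    have "((1 + r)\<^sup>2)\<^sup>2 - 32 * ((r - 1) * (r + 1)) = (r + 1) * ((r - 3) * (r * (r + 6) - 11))"
      by (simp add: power2_eq_square algebra_simps)
    also have "\<dots> \<ge> 0"
    proof -
      have "r * (r + 6) \<ge> 3 * 9" using r3 by (intro mult_mono) auto
      then show ?thesis using r3 by (intro mult_nonneg_nonneg) auto
    qed
    finally show ?thesis by simp
  qed
  finally show "4 * sqrt 2 * \<alpha> \<le> (1 + sqrt (1 + \<alpha>\<^sup>2))\<^sup>2"
    unfolding r_def[symmetric] by (rule power2_le_imp_le) auto
qed

lemma area_bound_unit:
  assumes "\<alpha> = 1"
  shows "shape_bound \<alpha> \<beta> C W"
proof (rule area_bound_slim)
  have "2 * sqrt 2 \<le> (3::real)" by (rule power2_le_imp_le) (auto simp: power_mult_distrib)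
  then show "4 * sqrt 2 * \<alpha> \<le> (1 + sqrt (1 + \<alpha>\<^sup>2))\<^sup>2"
    by (simp add: assms power2_eq_square algebra_simps)
qed

text \<open>The lemma is sharp: equality holds for the Sommerville tetrahedron (\<open>\<alpha> = \<beta> = \<surd>2\<close>, \<open>C = 0\<close>).\<close>

lemma area_bound_60_60:
  assumes r: "2 * (\<alpha> - \<beta> * C) \<ge> W" and t: "2 * (\<beta> - \<alpha> * C) \<ge> W"
  shows "shape_bound \<alpha> \<beta> C W"
proof (cases "C \<le> -1/4")
  case False
  define p where "p = \<alpha> * \<beta>"
  define y where "y = p * (1 + C)"
  have p: "p > 0" using \<alpha> \<beta> by (simp add: p_def)
  have s2: "(\<alpha> + \<beta>)\<^sup>2 \<ge> 4 * p"
    using zero_le_power2[of "\<alpha> - \<beta>"] by (simp add: p_def power2_eq_square algebra_simps)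
  \<comment> \<open>The product of the two angle conditions is symmetric in \<alpha> and \<beta>.
    Replacing the square of \<alpha> + \<beta> by 4 p needs 1 + 4 C > 0, which is why obtuse angles
    are split off, and yields y <= 2 - 4 C.\<close>
  have "W\<^sup>2 \<le> (2 * (\<alpha> - \<beta> * C)) * (2 * (\<beta> - \<alpha> * C))"
    unfolding power2_eq_square using r t W by (intro mult_mono) auto
  then have "(1 + 4 * C) * (\<alpha> + \<beta>)\<^sup>2 \<le> p * (1 + C) * (4 * (1 + C) + 2 - p * (1 - C))"
    unfolding W2 p_def by (simp add: power2_eq_square algebra_simps)
  moreover have "(1 + 4 * C) * (4 * p) \<le> (1 + 4 * C) * (\<alpha> + \<beta>)\<^sup>2"
    using s2 False by (intro mult_left_mono) auto
  ultimately have "p * ((1 - C) * y) \<le> p * ((1 - C) * (2 - 4 * C))"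
    unfolding y_def by (simp add: power2_eq_square algebra_simps)
  then have y: "y \<le> 2 - 4 * C" using p C by simp
  have y0: "y > 0" using p C by (simp add: y_def)
  \<comment> \<open>As a function of C, (1 - C) (1 + C)^2 increases up to C = 1/3, where it is
    32/27. The bound C <= (2 - y) / 4 improves on this maximum only if y > 2/3.\<close>
  have *: "16 * y\<^sup>2 * ((1 - C) * (1 + C)\<^sup>2) \<le> (2 + y)^3"
  proof (cases "y \<le> 2/3")
    case True
    have "32/27 - (1 - C) * (1 + C)\<^sup>2 = (C - 1/3)\<^sup>2 * (C + 5/3)"
      by (simp add: power2_eq_square algebra_simps)
    also have "\<dots> \<ge> 0" using C by simp
    finally have "(1 - C) * (1 + C)\<^sup>2 \<le> 32/27" by simp
    then have K: "16 * y\<^sup>2 * ((1 - C) * (1 + C)\<^sup>2) \<le> 16 * y\<^sup>2 * (32/27)"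
      by (intro mult_left_mono) auto
    show ?thesis
    proof (cases "y \<le> 1/3")
      case True
      have "16 * y\<^sup>2 * (32/27) \<le> 16 * (1/3)\<^sup>2 * (32/27)" using True y0
        by (intro mult_mono power_mono) auto
      moreover have "2^3 \<le> (2 + y)^3" using y0 by (intro power_mono) auto
      ultimately show ?thesis using K by (simp add: power2_eq_square)
    next
      case False
      then have "(2 + 1/3)^3 \<le> (2 + y)^3" by (intro power_mono) auto
      moreover have "16 * y\<^sup>2 * (32/27) \<le> 16 * (2/3)\<^sup>2 * (32/27)" using True y0
        by (intro mult_mono power_mono) auto
      ultimately show ?thesis using K by (simp add: power3_eq_cube power2_eq_square)
    qed
  next
    case False
    define d where "d = (2 - y) / 4"
    have Cd: "C \<le> d" using y by (simp add: d_def)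
    have d: "d \<le> 1/3" using False by (simp add: d_def)
    have "(1 - d) * (1 + d)\<^sup>2 - (1 - C) * (1 + C)\<^sup>2 = (d - C) * (1 - C - d - (C\<^sup>2 + C * d + d\<^sup>2))"
      by (simp add: power2_eq_square algebra_simps)
    moreover have "1 - C - d - (C\<^sup>2 + C * d + d\<^sup>2) \<ge> 0"
    proof (cases "C \<ge> 0")
      case True
      then have "C\<^sup>2 \<le> (1/3)\<^sup>2" "d\<^sup>2 \<le> (1/3)\<^sup>2" "C * d \<le> 1/3 * (1/3)" using Cd d
        by (intro power_mono mult_mono; simp)+
      then show ?thesis using Cd d by (simp add: power2_eq_square)
    next
      case C0: False
      have c2: "C\<^sup>2 \<le> 1/16" using C0 False \<open>\<not> C \<le> -1/4\<close> abs_le_square_iff[of C "1/4"]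
        by (simp add: power2_eq_square)
      have "\<bar>d\<bar> \<le> \<bar>1/3\<bar>" using d Cd \<open>\<not> C \<le> -1/4\<close> by linarith
      then have "d\<^sup>2 \<le> 1/9" unfolding abs_le_square_iff by (simp add: power2_eq_square)
      moreover have "C * d \<le> 1/16 + 1/9" using zero_le_power2[of "C - d"] zero_le_power2[of C] zero_le_power2[of d] calculation c2
        by (simp add: power2_eq_square algebra_simps)
      ultimately show ?thesis using C0 d c2 by linarith
    qed
    ultimately have "(1 - C) * (1 + C)\<^sup>2 \<le> (1 - d) * (1 + d)\<^sup>2"
      using Cd by (smt (verit) mult_nonneg_nonneg)
    then have "16 * y\<^sup>2 * ((1 - C) * (1 + C)\<^sup>2) \<le> 16 * y\<^sup>2 * ((1 - d) * (1 + d)\<^sup>2)"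
      by (intro mult_left_mono) auto
    also have "\<dots> \<le> (2 + y)^3"
    proof -
      have "(2 + y)^3 - 16 * y\<^sup>2 * ((1 - d) * (1 + d)\<^sup>2) = (2 + y) * ((y - 2)\<^sup>2 * (2 * (2 + y) + y * (6 - y))) / 4"
        unfolding d_def by (simp add: field_simps power2_eq_square power3_eq_cube)
      also have "\<dots> \<ge> 0"
        using y0 y \<open>\<not> C \<le> -1/4\<close> by (intro divide_nonneg_pos mult_nonneg_nonneg add_nonneg_nonneg) auto
      finally show ?thesis by simp
    qed
    finally show ?thesis .
  qed
  show ?thesis
    by (rule area_bound_amgm[OF refl]) (use * in \<open>simp add: y_def p_def mult.assoc\<close>)
qed (rule area_bound_obtuse)

text \<open>Large \<alpha> fall under \<open>area_bound_long\<close>. Otherwise the lateral area is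
  at most 2 \<alpha>: for C >= 1/2 by the sharp angle, for smaller C directly from
  \<open>W2\<close>.\<close>

lemma area_bound_60_90:
  assumes t: "\<beta> = \<alpha> * C" and r: "2 * (\<alpha> - \<beta> * C) \<ge> W"
  shows "shape_bound \<alpha> \<beta> C W"
proof (cases "\<alpha>\<^sup>2 \<ge> 8")
  case False
  have C0: "C > 0" using t \<alpha> \<beta> by (simp add: zero_less_mult_iff)
  have Wr: "W \<le> 2 * \<alpha> * (1 - C\<^sup>2)" using r by (simp add: t power2_eq_square algebra_simps)
  have "\<beta> + W \<le> 2 * \<alpha>"
  proof (cases "C \<ge> 1/2")
    case True
    have "\<beta> + W \<le> 2 * \<alpha> + \<alpha> * (C * (1 - 2 * C))"
      using Wr by (simp add: t power2_eq_square algebra_simps)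
    also have "\<alpha> * (C * (1 - 2 * C)) \<le> 0" using True \<alpha> by (intro mult_nonneg_nonpos) auto
    finally show ?thesis by simp
  next
    case C2: False
    have "W\<^sup>2 = \<alpha>\<^sup>2 * ((1 - C\<^sup>2) * (1 + \<alpha>\<^sup>2 * C\<^sup>2))" unfolding W2 t by algebra
    also have "\<dots> \<le> \<alpha>\<^sup>2 * (2 - C)\<^sup>2"
    proof (rule mult_left_mono)
      have "\<alpha>\<^sup>2 * C\<^sup>2 \<le> 8 * (1/2)\<^sup>2" using False C2 C0 by (intro mult_mono power_mono) auto
      then have "(1 - C\<^sup>2) * (1 + \<alpha>\<^sup>2 * C\<^sup>2) \<le> (1 - C\<^sup>2) * 3"
        using mirror_shape.C2[OF mirror_shape_axioms] by (intro mult_left_mono) (auto simp: power2_eq_square)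
      also have "\<dots> = (2 - C)\<^sup>2 - (1 - 2 * C)\<^sup>2" by algebra
      also have "\<dots> \<le> (2 - C)\<^sup>2" by simp
      finally show "(1 - C\<^sup>2) * (1 + \<alpha>\<^sup>2 * C\<^sup>2) \<le> (2 - C)\<^sup>2" .
    qed simp
    also have "\<dots> = (\<alpha> * (2 - C))\<^sup>2" by algebra
    finally have "W \<le> \<alpha> * (2 - C)"
      by (rule power2_le_imp_le) (use \<alpha> C in auto)
    then show ?thesis by (simp add: t algebra_simps)
  qed
  then show ?thesis by (rule area_bound_low)
qed (rule area_bound_long)

text \<open>For \<alpha> = sqrt 3 the face ACD is equilateral. The sharp angle gives W >= 2 \<tau>
  s, where \<open>s\<close> is the sine of the angle at CD. Since the squared volume carries the
  factor s^2, this reduces the claim to s = 1.\<close>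

lemma area_bound_equilateral_60:
  assumes a3: "\<alpha> = sqrt 3" and t: "2 * (\<beta> - \<alpha> * C) \<ge> W"
  shows "shape_bound \<alpha> \<beta> C W"
proof -
  define s where "s = sqrt (1 - C\<^sup>2)"
  have s2: "s\<^sup>2 = 1 - C\<^sup>2" using C2 by (simp add: s_def)
  have s: "s > 0" "s \<le> 1" using C2 by (auto simp: s_def)
  define \<tau> where "\<tau> = sqrt (1 + \<beta>\<^sup>2)"
  have \<tau>2: "\<tau>\<^sup>2 = 1 + \<beta>\<^sup>2" by (simp add: \<tau>_def)
  have \<tau>: "\<tau> > 0" by (simp add: \<tau>_def add_pos_nonneg)
  have "W\<^sup>2 = (\<beta> - \<alpha> * C)\<^sup>2 + \<tau>\<^sup>2 * \<alpha>\<^sup>2 * s\<^sup>2"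
    unfolding W2 s2 \<tau>2 by (simp add: power2_eq_square algebra_simps)
  moreover have "W\<^sup>2 \<le> (2 * (\<beta> - \<alpha> * C))\<^sup>2" using t W by (intro power_mono) auto
  then have "W\<^sup>2 \<le> 4 * (\<beta> - \<alpha> * C)\<^sup>2" unfolding power_mult_distrib[of 2] by simp
  ultimately have "3 * W\<^sup>2 \<ge> 4 * (\<tau>\<^sup>2 * \<alpha>\<^sup>2 * s\<^sup>2)" by linarith
  then have "(2 * (\<tau> * s))\<^sup>2 \<le> W\<^sup>2"
    by (simp add: a3 power_mult_distrib)
  then have W_ge: "2 * \<tau> * s \<le> W" using W power2_le_imp_le[of "2 * (\<tau> * s)" W] by simp
  define k where "k = sqrt 3 + \<beta>"
  define m where "m = 2 * \<tau>"
  have k: "k > 0" using \<beta> by (simp add: k_def add_pos_pos)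
  have m: "m > 0" using \<tau> by (simp add: m_def)
  have "\<tau> \<le> k" unfolding \<tau>_def
  proof (rule real_le_lsqrt)
    show "1 + \<beta>\<^sup>2 \<le> k\<^sup>2" using \<beta> by (simp add: k_def power2_sum)
  qed (use k in auto)
  then have mk: "m \<le> 2 * k" by (simp add: m_def)
  have "(k + m * s)^3 - s\<^sup>2 * (k + m)^3 = (1 - s) * (k^3 * (1 + s) + 3 * k\<^sup>2 * m * s - m^3 * s\<^sup>2)"
    by algebra
  also have "\<dots> \<ge> 0"
  proof (rule mult_nonneg_nonneg)
    have "m\<^sup>2 \<le> (2 * k)\<^sup>2" using mk m by (intro power_mono) auto
    then have "m\<^sup>2 * (m * s\<^sup>2) \<le> 4 * k\<^sup>2 * (m * s\<^sup>2)" using m by (intro mult_right_mono) (auto simp: power_mult_distrib)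
    also have "\<dots> \<le> 4 * k\<^sup>2 * (m * s)" using s m by (intro mult_left_mono) (auto simp: power2_eq_square)
    finally have 1: "m^3 * s\<^sup>2 \<le> 4 * k\<^sup>2 * m * s" by (simp add: power3_eq_cube power2_eq_square mult_ac)
    have "k\<^sup>2 * s * m \<le> k\<^sup>2 * s * (2 * k)" using mk s by (intro mult_left_mono) auto
    then have 2: "k\<^sup>2 * m * s \<le> 2 * k^3 * s" by (simp add: power3_eq_cube power2_eq_square mult_ac)
    have "k^3 * s \<le> k^3 * 1" using s k by (intro mult_left_mono) auto
    then show "0 \<le> k^3 * (1 + s) + 3 * k\<^sup>2 * m * s - m^3 * s\<^sup>2"
      using 1 2 by (simp add: algebra_simps)
  qed (use s in simp)
  finally have A: "s\<^sup>2 * (k + m)^3 \<le> (k + m * s)^3" by simp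
  \<comment> \<open>The tangent to sqrt (1 + \<beta>^2) at \<beta> = 15/8, from the Pythagorean
    triple 8, 15, 17. This point is close to the critical \<beta> of the AM-GM step below, so little
    is lost.\<close>
  have tan: "\<tau> \<ge> (8 + 15 * \<beta>) / 17"
  proof (rule power2_le_imp_le)
    have "289 * (1 + \<beta>\<^sup>2) - (8 + 15 * \<beta>)\<^sup>2 = (15 - 8 * \<beta>)\<^sup>2" by algebra
    then have "289 * (1 + \<beta>\<^sup>2) \<ge> (8 + 15 * \<beta>)\<^sup>2" by (metis diff_ge_0_iff_ge zero_le_power2)
    then show "((8 + 15 * \<beta>) / 17)\<^sup>2 \<le> \<tau>\<^sup>2" by (simp add: \<tau>2 power_divide)
  qed (use \<tau> in simp)
  have "sqrt 3 \<ge> (173/100::real)" by (rule real_le_rsqrt) (simp add: power2_eq_square)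
  \<comment> \<open>\<open>u\<close> is a rational number just below sqrt 3 + 16/17, and
    \<open>x\<close> collects \<beta> + 30/17 \<beta>. The cube of u + x is then compared with 27/4
    u x^2, with equality at x = 2 u.\<close>
  define u where "u = (2671/1000::real)"
  define x where "x = 47/17 * \<beta>"
  have "u + x \<le> k + m" using tan \<open>sqrt 3 \<ge> 173/100\<close> unfolding u_def x_def k_def m_def by (simp add: field_simps)
  then have "(u + x)^3 \<le> (k + m)^3" using \<beta> by (intro power_mono) (auto simp: u_def x_def)
  moreover have "(u + x)^3 - 27/4 * u * x\<^sup>2 = (x - 2 * u)\<^sup>2 * (x + u/4)"
    by (simp add: power2_eq_square power3_eq_cube algebra_simps)
  moreover have "(x - 2 * u)\<^sup>2 * (x + u/4) \<ge> 0" using \<beta> by (simp add: u_def x_def)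
  moreover have "96 * sqrt 2 * \<beta>\<^sup>2 \<le> 27/4 * u * x\<^sup>2"
  proof -
    have "sqrt 2 \<le> (142/100::real)" by (rule real_le_lsqrt) (auto simp: power2_eq_square)
    then have "96 * sqrt 2 * \<beta>\<^sup>2 \<le> 96 * (142/100) * \<beta>\<^sup>2" by (intro mult_right_mono) auto
    also have "\<dots> \<le> 27/4 * u * (47/17)\<^sup>2 * \<beta>\<^sup>2"
      by (intro mult_right_mono) (auto simp: u_def power2_eq_square)
    finally show ?thesis unfolding x_def power_mult_distrib by (simp only: mult.assoc)
  qed
  ultimately have B: "96 * sqrt 2 * \<beta>\<^sup>2 \<le> (k + m)^3" by linarith
  have "32 * sqrt 2 * (\<alpha> * \<beta>)\<^sup>2 * (1 - C\<^sup>2) = s\<^sup>2 * (96 * sqrt 2 * \<beta>\<^sup>2)"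
    by (simp add: a3 s2 power_mult_distrib)
  also have "\<dots> \<le> s\<^sup>2 * (k + m)^3" using B by (intro mult_left_mono) auto
  also have "\<dots> \<le> (k + m * s)^3" by (rule A)
  also have "\<dots> \<le> (\<alpha> + \<beta> + W)^3" using W_ge k m s by (intro power_mono) (auto simp: k_def m_def a3)
  finally show ?thesis .
qed

lemma area_bound_equilateral_90:
  assumes a3: "\<alpha> = sqrt 3" and t: "\<beta> = \<alpha> * C"
  shows "shape_bound \<alpha> \<beta> C W"
proof (rule area_bound_low)
  have C0: "C > 0" using t \<alpha> \<beta> by (simp add: zero_less_mult_iff)
  have "W\<^sup>2 = \<alpha>\<^sup>2 * ((1 - C\<^sup>2) * (1 + \<alpha>\<^sup>2 * C\<^sup>2))" unfolding W2 t by algebra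
  also have "\<dots> = \<alpha>\<^sup>2 * ((1 - C\<^sup>2) * (1 + 3 * C\<^sup>2))" by (simp add: a3)
  also have "\<dots> \<le> \<alpha>\<^sup>2 * (2 - C)\<^sup>2"
  proof (rule mult_left_mono)
    \<comment> \<open>A sum of squares certificate for 3 C^4 - C^2 - 4 C + 3; the constant left over
      is positive.\<close>
    have "(2 - C)\<^sup>2 - (1 - C\<^sup>2) * (1 + 3 * C\<^sup>2) = 3 * (C\<^sup>2 - 16/25)\<^sup>2 + 71/25 * (C - 50/71)\<^sup>2 + (3 - 3 * (16/25)\<^sup>2 - 100/71)"
      by (simp add: power2_eq_square algebra_simps)
    also have "\<dots> \<ge> 0" by (intro add_nonneg_nonneg) (auto simp: power2_eq_square)
    finally show "(1 - C\<^sup>2) * (1 + 3 * C\<^sup>2) \<le> (2 - C)\<^sup>2" by simp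
  qed simp
  also have "\<dots> = (\<alpha> * (2 - C))\<^sup>2" by algebra
  finally have "W \<le> \<alpha> * (2 - C)"
    by (rule power2_le_imp_le) (use \<alpha> C in auto)
  then show "\<beta> + W \<le> 2 * \<alpha>" by (simp add: t algebra_simps)
qed

end

section \<open>Volume, orientation and dihedral angles\<close>

text \<open>Six times the signed volume; its sign carries the orientation of an ordered tetrahedron
  through the proof.\<close>

definition orient3 :: "real^3 \<Rightarrow> real^3 \<Rightarrow> real^3 \<Rightarrow> real^3 \<Rightarrow> real" where
  "orient3 p q x y = (q - p) \<bullet> cross3 (x - p) (y - p)"

definition cos_dihedral :: "real^3 \<Rightarrow> real^3 \<Rightarrow> real^3 \<Rightarrow> real^3 \<Rightarrow> real" where
  "cos_dihedral p q x y = cross3 (q - p) (x - p) \<bullet> cross3 (q - p) (y - p) /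
     (norm (cross3 (q - p) (x - p)) * norm (cross3 (q - p) (y - p)))"

definition dihedral :: "real^3 \<Rightarrow> real^3 \<Rightarrow> real^3 \<Rightarrow> real^3 \<Rightarrow> real" where
  "dihedral p q x y = arccos (cos_dihedral p q x y)"

text \<open>The Gram determinant, which expresses the squared volume by inner products and thus by
  edge lengths.\<close>

lemma triple_square:
  fixes x y z :: "real^3"
  shows "(x \<bullet> cross3 y z)\<^sup>2 = (x\<bullet>x) * ((y\<bullet>y) * (z\<bullet>z) - (y\<bullet>z)\<^sup>2)
     - (x\<bullet>y) * ((x\<bullet>y) * (z\<bullet>z) - (y\<bullet>z) * (x\<bullet>z)) + (x\<bullet>z) * ((x\<bullet>y) * (y\<bullet>z) - (y\<bullet>y) * (x\<bullet>z))"
  unfolding cross3_def inner_vec_def sum_3 vector_3 inner_real_def by algebra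

lemma norm_cross_square:
  fixes x y :: "real^3"
  shows "(norm (cross3 x y))\<^sup>2 = (x\<bullet>x) * (y\<bullet>y) - (x\<bullet>y)\<^sup>2"
  unfolding power2_norm_eq_inner dot_cross by (simp add: inner_commute power2_eq_square)

lemma orient3_perm:
  "orient3 q p x y = - orient3 p q x y" "orient3 p x q y = - orient3 p q x y"
  "orient3 p q y x = - orient3 p q x y"
  unfolding orient3_def cross3_def inner_vec_def sum_3 vector_3 inner_real_def vector_minus_component
  by algebra+

lemma orient3_refl [simp]: "orient3 p p x y = 0" "orient3 p q p y = 0" "orient3 p q x p = 0"
  "orient3 p q q y = 0" "orient3 p q x q = 0" "orient3 p q x x = 0"
  unfolding orient3_def by (simp_all add: dot_cross_self)

text \<open>An affine image of the standard simplex, of volume 1/6, under a map whose determinant is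
  the triple product.\<close>

lemma measure_tetrahedron:
  fixes a b c d :: "real^3"
  shows "measure lebesgue (convex hull {a, b, c, d}) = \<bar>orient3 a b c d\<bar> / 6"
proof -
  define f :: "real^3 \<Rightarrow> real^3" where "f = (\<lambda>x. (x$1) *\<^sub>R (b - a) + (x$2) *\<^sub>R (c - a) + (x$3) *\<^sub>R (d - a))"
  have lin: "linear f" by (rule linearI) (auto simp: f_def algebra_simps)
  define S :: "(real^3) set" where "S = convex hull (insert 0 Basis)"
  have Basis3: "(Basis :: (real^3) set) = {axis 1 1, axis 2 1, axis 3 1}"
    by (auto simp: Basis_vec_def) (metis exhaust_3)
  have f_img: "f ` insert 0 Basis = {0, b - a, c - a, d - a}"
    unfolding Basis3 by (simp add: f_def axis_def)
  have "(\<lambda>x. a + x) ` f ` S = convex hull ((\<lambda>x. a + x) ` {0, b - a, c - a, d - a})"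
    unfolding S_def convex_hull_linear_image[OF lin] f_img convex_hull_translation ..
  then have img: "convex hull {a, b, c, d} = (\<lambda>x. a + x) ` f ` S" by simp
  have compS: "compact S" unfolding S_def by (intro compact_convex_hull finite_imp_compact) auto
  have mS: "measure lebesgue S = 1/6"
  proof -
    have "measure lebesgue S = measure lborel S"
      using compS by (intro measure_completion) (simp add: borel_compact)
    then show ?thesis unfolding S_def content_std_simplex by (simp add: fact_numeral)
  qed
  have "measure lebesgue (convex hull {a, b, c, d}) = measure lebesgue (f ` S)"
    unfolding img by (rule measure_translation)
  also have "\<dots> = \<bar>det (matrix f)\<bar> * measure lebesgue S"
    by (rule measure_linear_image[OF lin]) (use compS in \<open>simp add: lmeasurable_compact\<close>)
  also have "det (matrix f) = orient3 a b c d"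
    unfolding orient3_def dot_cross_det det_3 matrix_def f_def
    by (simp add: axis_def vector_3 algebra_simps)
  finally show ?thesis by (simp add: mS)
qed

lemma orient3_neq0_independent:
  assumes "orient3 a b c d \<noteq> 0"
  shows "\<not> affine_dependent {a, b, c, d}" "card {a, b, c, d} = 4"
    "a \<noteq> b" "a \<noteq> c" "a \<noteq> d" "b \<noteq> c" "b \<noteq> d" "c \<noteq> d"
proof -
  show ne: "a \<noteq> b" "a \<noteq> c" "a \<noteq> d" "b \<noteq> c" "b \<noteq> d" "c \<noteq> d" using assms by auto
  then show "card {a, b, c, d} = 4" by simp
  define u v w where "u = b - a" and "v = c - a" and "w = d - a"
  have o: "u \<bullet> cross3 v w \<noteq> 0" using assms by (simp add: orient3_def u_def v_def w_def)
  have d: "u \<noteq> v" "u \<noteq> w" "v \<noteq> w" using ne by (auto simp: u_def v_def w_def)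
  have "independent {u, v, w}"
  proof
    assume "dependent {u, v, w}"
    then obtain k where k: "\<exists>x\<in>{u,v,w}. k x \<noteq> 0" "(\<Sum>x\<in>{u,v,w}. k x *\<^sub>R x) = 0"
      by (auto simp: real_vector.dependent_finite)
    have s: "k u *\<^sub>R u + k v *\<^sub>R v + k w *\<^sub>R w = 0" using k(2) d by (simp add: add.assoc)
    have "(k u *\<^sub>R u + k v *\<^sub>R v + k w *\<^sub>R w) \<bullet> cross3 v w = k u * (u \<bullet> cross3 v w)"
      by (simp add: inner_add_left dot_cross_self)
    then have 1: "k u = 0" using s o by simp
    have "v \<bullet> cross3 w u = u \<bullet> cross3 v w" "w \<bullet> cross3 u v = u \<bullet> cross3 v w"
      by (metis cross_triple inner_commute)+
    note tr = this
    have "(k u *\<^sub>R u + k v *\<^sub>R v + k w *\<^sub>R w) \<bullet> cross3 w u = k v * (u \<bullet> cross3 v w)"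
      by (simp add: inner_add_left dot_cross_self tr)
    then have 2: "k v = 0" using s o by simp
    have "(k u *\<^sub>R u + k v *\<^sub>R v + k w *\<^sub>R w) \<bullet> cross3 u v = k w * (u \<bullet> cross3 v w)"
      by (simp add: inner_add_left dot_cross_self tr)
    then have 3: "k w = 0" using s o by simp
    show False using k(1) 1 2 3 by auto
  qed
  moreover have "(\<lambda>x. - a + x) ` {b, c, d} = {u, v, w}" by (auto simp: u_def v_def w_def)
  ultimately show "\<not> affine_dependent {a, b, c, d}"
    using affine_dependent_iff_dependent[of a "{b, c, d}"] ne by auto
qed

text \<open>Seen from the midpoint \<open>M\<close> of CD, the vectors \<open>a\<close> and
  \<open>b\<close> are orthogonal to \<open>e\<close>, half of CD. So the squares of the three
  vectors and \<open>a \<bullet> b\<close> determine all lengths, areas and angles.\<close>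

lemma mirror_tetrahedron:
  fixes A B C D :: "real^3"
  assumes o: "orient3 A B C D \<noteq> 0" and r: "dist A C = dist A D" and t: "dist B C = dist B D"
  obtains c \<alpha> \<beta> \<gamma> W where "mirror_shape \<alpha> \<beta> \<gamma> W" "c > 0"
    "tetra_surface_area A B C D = c\<^sup>2 * (\<alpha> + \<beta> + W)"
    "(orient3 A B C D)\<^sup>2 = 4 * c^6 * ((\<alpha> * \<beta>)\<^sup>2 * (1 - \<gamma>\<^sup>2))"
    "(dist A C)\<^sup>2 = c\<^sup>2 * (1 + \<alpha>\<^sup>2)" "(dist B C)\<^sup>2 = c\<^sup>2 * (1 + \<beta>\<^sup>2)"
    "(dist A B)\<^sup>2 = c\<^sup>2 * (\<alpha>\<^sup>2 + \<beta>\<^sup>2 - 2 * \<alpha> * \<beta> * \<gamma>)" "dist C D = 2 * c"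
    "cos_dihedral C D A B = \<gamma>"
    "cos_dihedral A C B D = (\<alpha> - \<beta> * \<gamma>) / W" "cos_dihedral B C A D = (\<beta> - \<alpha> * \<gamma>) / W"
    "cos_dihedral A B C D = ((\<alpha> * \<beta>)\<^sup>2 * (1 - \<gamma>\<^sup>2) - (\<alpha>\<^sup>2 + \<beta>\<^sup>2 - 2 * \<alpha> * \<beta> * \<gamma>)) / W\<^sup>2"
proof -
  define M where "M = (1/2) *\<^sub>R (C + D)"
  define a b e where "a = A - M" and "b = B - M" and "e = C - M"
  have pts: "A = M + a" "B = M + b" "C = M + e" "D = M - e"
    by (simp_all add: a_def b_def e_def M_def algebra_simps flip: scaleR_add_left)
  have ae: "a \<bullet> e = 0"
  proof -
    have "(norm (a - e))\<^sup>2 = (norm (a + e))\<^sup>2" using r unfolding dist_norm pts by (simp add: algebra_simps)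
    then show ?thesis by (simp add: power2_norm_eq_inner inner_diff inner_add inner_commute)
  qed
  have be: "b \<bullet> e = 0"
  proof -
    have "(norm (b - e))\<^sup>2 = (norm (b + e))\<^sup>2" using t unfolding dist_norm pts by (simp add: algebra_simps)
    then show ?thesis by (simp add: power2_norm_eq_inner inner_diff inner_add inner_commute)
  qed
  have ea: "e \<bullet> a = 0" and eb: "e \<bullet> b = 0" using ae be by (simp_all add: inner_commute)
  have ba: "b \<bullet> a = a \<bullet> b" by (simp add: inner_commute)
  note ips = ae be ea eb ba
  have diffs: "B - A = b - a" "C - A = e - a" "D - A = - e - a" "C - B = e - b" "D - B = - e - b"
    "D - C = - (2 *\<^sub>R e)" "A - C = a - e" "B - C = b - e" "A - B = a - b"
    by (simp_all add: pts scaleR_2)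
  have o2: "(orient3 A B C D)\<^sup>2 = 4 * (e\<bullet>e) * ((a\<bullet>a) * (b\<bullet>b) - (a\<bullet>b)\<^sup>2)"
    unfolding orient3_def diffs triple_square
    by (simp add: inner_diff inner_add ips power2_eq_square algebra_simps)
  then have pos: "e\<bullet>e > 0" "(a\<bullet>a) * (b\<bullet>b) - (a\<bullet>b)\<^sup>2 > 0"
  proof -
    have "4 * (e\<bullet>e) * ((a\<bullet>a) * (b\<bullet>b) - (a\<bullet>b)\<^sup>2) > 0" using o o2 by (metis zero_less_power2)
    moreover have "e\<bullet>e \<ge> 0" by simp
    moreover have "(a\<bullet>a) * (b\<bullet>b) - (a\<bullet>b)\<^sup>2 \<ge> 0" using Cauchy_Schwarz_ineq[of a b] by simp
    ultimately show "e\<bullet>e > 0" "(a\<bullet>a) * (b\<bullet>b) - (a\<bullet>b)\<^sup>2 > 0" by (auto simp: zero_less_mult_iff)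
  qed
  then have ab0: "a \<noteq> 0" "b \<noteq> 0" by auto
  define c where "c = norm e"
  have c: "c > 0" using pos by (auto simp: c_def)
  define \<alpha> \<beta> \<gamma> where "\<alpha> = norm a / c" and "\<beta> = norm b / c" and "\<gamma> = (a \<bullet> b) / (norm a * norm b)"
  have \<alpha>: "\<alpha> > 0" "\<beta> > 0" using ab0 c by (auto simp: \<alpha>_def \<beta>_def)
  have ee: "e\<bullet>e = c\<^sup>2" by (simp add: c_def power2_norm_eq_inner)
  have aa: "a\<bullet>a = c\<^sup>2 * \<alpha>\<^sup>2" using c by (simp add: \<alpha>_def power_divide power2_norm_eq_inner)
  have bb: "b\<bullet>b = c\<^sup>2 * \<beta>\<^sup>2" using c by (simp add: \<beta>_def power_divide power2_norm_eq_inner)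
  have ab: "a\<bullet>b = c\<^sup>2 * \<alpha> * \<beta> * \<gamma>"
    using c ab0 by (simp add: \<alpha>_def \<beta>_def \<gamma>_def field_simps power2_eq_square)
  have "c^4 * (\<alpha> * \<beta>)\<^sup>2 * (1 - \<gamma>\<^sup>2) > 0"
    using pos(2) unfolding aa bb ab by (simp add: algebra_simps power2_eq_square power4_eq_xxxx)
  moreover have "c^4 * (\<alpha> * \<beta>)\<^sup>2 > 0" using c \<alpha> by simp
  ultimately have "0 < 1 - \<gamma>\<^sup>2" by (rule zero_less_mult_pos)
  then have \<gamma>2: "\<gamma>\<^sup>2 < 1" by simp
  then have \<gamma>: "-1 < \<gamma>" "\<gamma> < 1" by (auto simp: abs_square_less_1)
  define p2 where "p2 = \<alpha>\<^sup>2 + \<beta>\<^sup>2 - 2 * \<alpha> * \<beta> * \<gamma>"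
  define W where "W = sqrt (p2 + (\<alpha> * \<beta>)\<^sup>2 * (1 - \<gamma>\<^sup>2))"
  have p2: "p2 = (\<alpha> - \<beta> * \<gamma>)\<^sup>2 + \<beta>\<^sup>2 * (1 - \<gamma>\<^sup>2)" unfolding p2_def by algebra
  have Wpos: "p2 + (\<alpha> * \<beta>)\<^sup>2 * (1 - \<gamma>\<^sup>2) > 0"
    unfolding p2 using \<alpha> \<gamma>2 by (intro add_nonneg_pos add_nonneg_nonneg mult_pos_pos mult_nonneg_nonneg) auto
  have W: "W > 0" using Wpos by (simp add: W_def)
  have W2: "W\<^sup>2 = p2 + (\<alpha> * \<beta>)\<^sup>2 * (1 - \<gamma>\<^sup>2)" using Wpos by (simp add: W_def)
  note sub = inner_diff inner_add ips aa bb ab ee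
  have n_eq: "norm (cross3 v w) = k" if "(v\<bullet>v) * (w\<bullet>w) - (v\<bullet>w)\<^sup>2 = k\<^sup>2" "k \<ge> 0" for v w k
    using that norm_cross_square[of v w] by (simp add: power2_eq_iff_nonneg)
  have cW: "(c\<^sup>2 * W)\<^sup>2 = c^4 * (\<alpha>\<^sup>2 + \<beta>\<^sup>2 - 2 * \<alpha> * \<beta> * \<gamma> + (\<alpha> * \<beta>)\<^sup>2 * (1 - \<gamma>\<^sup>2))"
    unfolding power_mult_distrib[of "c\<^sup>2"] W2 p2_def by (simp flip: power_mult)
  have nACD: "norm (cross3 (e - a) (- e - a)) = 2 * (c\<^sup>2 * \<alpha>)"
    by (rule n_eq) (use \<alpha> in \<open>auto simp: sub power2_eq_square algebra_simps\<close>)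
  have nBCD: "norm (cross3 (e - b) (- e - b)) = 2 * (c\<^sup>2 * \<beta>)"
    by (rule n_eq) (use \<alpha> in \<open>auto simp: sub power2_eq_square algebra_simps\<close>)
  have nABC: "norm (cross3 (b - a) (e - a)) = c\<^sup>2 * W"
    by (rule n_eq, unfold cW) (use W in \<open>auto simp: sub power2_eq_square power4_eq_xxxx algebra_simps\<close>)
  have nABD: "norm (cross3 (b - a) (- e - a)) = c\<^sup>2 * W"
    by (rule n_eq, unfold cW) (use W in \<open>auto simp: sub power2_eq_square power4_eq_xxxx algebra_simps\<close>)
  have nACB: "norm (cross3 (e - a) (b - a)) = c\<^sup>2 * W"
    using nABC cross_skew[of "e - a" "b - a"] by simp
  have nBCA: "norm (cross3 (e - b) (a - b)) = c\<^sup>2 * W"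
    by (rule n_eq, unfold cW) (use W in \<open>auto simp: sub power2_eq_square power4_eq_xxxx algebra_simps\<close>)
  have nCDA: "norm (cross3 (- (2 *\<^sub>R e)) (a - e)) = 2 * (c\<^sup>2 * \<alpha>)"
    by (rule n_eq) (use \<alpha> in \<open>auto simp: sub power2_eq_square algebra_simps\<close>)
  have nCDB: "norm (cross3 (- (2 *\<^sub>R e)) (b - e)) = 2 * (c\<^sup>2 * \<beta>)"
    by (rule n_eq) (use \<alpha> in \<open>auto simp: sub power2_eq_square algebra_simps\<close>)
  show thesis
  proof (rule that[of \<alpha> \<beta> \<gamma> W c])
    show "mirror_shape \<alpha> \<beta> \<gamma> W" by unfold_locales (use \<alpha> \<gamma> W W2 in \<open>auto simp: p2_def\<close>)
    show "c > 0" by fact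
    show "tetra_surface_area A B C D = c\<^sup>2 * (\<alpha> + \<beta> + W)"
      unfolding tetra_surface_area_def tri_area_def diffs nACD nBCD nABC nABD by (simp add: algebra_simps)
    show "(orient3 A B C D)\<^sup>2 = 4 * c^6 * ((\<alpha> * \<beta>)\<^sup>2 * (1 - \<gamma>\<^sup>2))"
      unfolding o2 aa bb ab ee by algebra
    show "(dist A C)\<^sup>2 = c\<^sup>2 * (1 + \<alpha>\<^sup>2)" "(dist B C)\<^sup>2 = c\<^sup>2 * (1 + \<beta>\<^sup>2)"
      "(dist A B)\<^sup>2 = c\<^sup>2 * (\<alpha>\<^sup>2 + \<beta>\<^sup>2 - 2 * \<alpha> * \<beta> * \<gamma>)"
      unfolding dist_norm diffs power2_norm_eq_inner by (simp_all add: sub algebra_simps)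
    have "C - D = 2 *\<^sub>R e" by (simp add: pts scaleR_2)
    then show "dist C D = 2 * c" by (simp add: dist_norm c_def)
    show "cos_dihedral C D A B = \<gamma>"
      unfolding cos_dihedral_def diffs nCDA nCDB dot_cross
      using c \<alpha> by (simp add: sub field_simps power2_eq_square)
    show "cos_dihedral A C B D = (\<alpha> - \<beta> * \<gamma>) / W"
      unfolding cos_dihedral_def diffs nACB nACD dot_cross
      using c \<alpha> W by (simp add: sub field_simps power2_eq_square)
    show "cos_dihedral B C A D = (\<beta> - \<alpha> * \<gamma>) / W"
      unfolding cos_dihedral_def diffs nBCA nBCD dot_cross
      using c \<alpha> W by (simp add: sub field_simps power2_eq_square)
    show "cos_dihedral A B C D = ((\<alpha> * \<beta>)\<^sup>2 * (1 - \<gamma>\<^sup>2) - (\<alpha>\<^sup>2 + \<beta>\<^sup>2 - 2 * \<alpha> * \<beta> * \<gamma>)) / W\<^sup>2"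
      unfolding cos_dihedral_def diffs nABC nABD dot_cross
      using c \<alpha> W by (simp add: sub field_simps power2_eq_square)
  qed
qed

section \<open>Tiles around an edge\<close>

lemma rigid_motion3_facts:
  assumes "rigid_motion3 g"
  shows rigid_motion3_dist: "dist (g x) (g y) = dist x y"
    and rigid_motion3_orient3: "orient3 (g p) (g q) (g x) (g y) = orient3 p q x y"
    and rigid_motion3_convex_hull: "g ` (convex hull S) = convex hull (g ` S)"
    and rigid_motion3_ball: "g ` ball x r = ball (g x) r"
proof -
  obtain f b where f: "orthogonal_transformation f" "det (matrix f) = 1" and g: "g = (\<lambda>x. f x + b)"
    using assms by (auto simp: rigid_motion3_def)
  have lin: "linear f" by (simp add: f orthogonal_transformation_linear)
  have fd: "f x - f y = f (x - y)" for x y by (simp add: lin linear_diff)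
  show "dist (g x) (g y) = dist x y"
    by (simp add: g dist_norm fd orthogonal_transformation_norm[OF f(1)])
  have cr: "cross3 (f x) (f y) = f (cross3 x y)" for x y
    using cross_orthogonal_transformation[OF f(1)] f(2) by simp
  show "orient3 (g p) (g q) (g x) (g y) = orient3 p q x y"
    using f(1) by (simp add: orient3_def g fd cr orthogonal_transformation_def)
  have g': "g = (\<lambda>x. b + x) \<circ> f" by (auto simp: g add.commute)
  show "g ` (convex hull S) = convex hull (g ` S)"
    unfolding g' image_comp[symmetric] convex_hull_linear_image[OF lin] convex_hull_translation ..
  show "g ` ball x r = ball (g x) r"
    unfolding g' image_comp[symmetric] image_orthogonal_transformation_ball[OF f(1)]
    by (simp only: ball_translation[symmetric] o_apply)
qed

lemma interior_tetrahedron: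
  assumes "orient3 p q x y \<noteq> 0" and "i > 0" "j > 0" "k > 0" "l > 0" "i + j + k + l = 1"
  shows "i *\<^sub>R p + j *\<^sub>R q + k *\<^sub>R x + l *\<^sub>R y \<in> interior (convex hull {p, q, x, y})"
proof -
  note ind = orient3_neq0_independent[OF assms(1)]
  define u where "u = (\<lambda>v. if v = p then i else if v = q then j else if v = x then k else l)"
  have "(\<forall>v\<in>{p,q,x,y}. 0 < u v) \<and> sum u {p,q,x,y} = 1 \<and>
    (\<Sum>v\<in>{p,q,x,y}. u v *\<^sub>R v) = i *\<^sub>R p + j *\<^sub>R q + k *\<^sub>R x + l *\<^sub>R y"
    using ind assms by (auto simp: u_def)
  then show ?thesis
    unfolding interior_convex_hull_explicit_minimal[OF ind(1)] using ind(2) by auto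
qed

text \<open>An actual tile serves as the prototile, so that all tiles are its images under proper
  motions.\<close>

locale op_tetra_tiling =
  fixes A B C D :: "real^3" and \<T> :: "(real^3) set set"
  assumes nondegenerate: "orient3 A B C D \<noteq> 0"
    and base_tile: "convex hull {A, B, C, D} \<in> \<T>"
    and tiles: "Q \<in> \<T> \<Longrightarrow> \<exists>g. rigid_motion3 g \<and> Q = g ` (convex hull {A, B, C, D})"
    and cover: "\<Union>\<T> = UNIV"
    and disjoint: "Q \<in> \<T> \<Longrightarrow> R \<in> \<T> \<Longrightarrow> Q \<noteq> R \<Longrightarrow> interior Q \<inter> interior R = {}"
    and face: "Q \<in> \<T> \<Longrightarrow> R \<in> \<T> \<Longrightarrow> Q \<noteq> R \<Longrightarrow> Q \<inter> R = {} \<or> (Q \<inter> R face_of Q \<and> Q \<inter> R face_of R)"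
begin

text \<open>The matching with A, B, C, D is left open, because a neighbouring tile may show another
  vertex of the prototile in the same place. What is kept is that the motion is proper.\<close>

definition labelled :: "real^3 \<Rightarrow> real^3 \<Rightarrow> real^3 \<Rightarrow> real^3 \<Rightarrow> bool" where
  "labelled p q x y \<longleftrightarrow> convex hull {p, q, x, y} \<in> \<T> \<and>
     (\<exists>g p' q' x' y'. rigid_motion3 g \<and> {p', q', x', y'} = {A, B, C, D} \<and>
        p = g p' \<and> q = g q' \<and> x = g x' \<and> y = g y')"

lemma vertices_perm_orient3:
  assumes "{p, q, x, y} = {A, B, C, D}"
  shows "\<bar>orient3 p q x y\<bar> = \<bar>orient3 A B C D\<bar>"
proof -
  have "\<bar>orient3 p q x y\<bar> / 6 = \<bar>orient3 A B C D\<bar> / 6"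
    unfolding measure_tetrahedron[symmetric] assms ..
  then show ?thesis by simp
qed

text \<open>Every tile contains a ball of one fixed radius around the image of \<open>z0\<close>.
  Disjoint interiors keep these centres apart, and a bounded uniformly discrete set is
  finite.\<close>

lemma finite_tiles_near: "finite {R \<in> \<T>. R \<inter> cball z r \<noteq> {}}"
proof -
  let ?V = "convex hull {A, B, C, D}"
  define z0 where "z0 = (1/4) *\<^sub>R A + (1/4) *\<^sub>R B + (1/4) *\<^sub>R C + (1/4) *\<^sub>R D"
  have "z0 \<in> interior ?V" unfolding z0_def using nondegenerate by (intro interior_tetrahedron) auto
  then obtain \<rho> where \<rho>: "\<rho> > 0" "ball z0 \<rho> \<subseteq> ?V" by (auto simp: mem_interior)
  have bV: "bounded ?V" by (simp add: finite_imp_bounded bounded_convex_hull)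
  obtain G where G: "rigid_motion3 (G R)" "R = G R ` ?V" if "R \<in> \<T>" for R using tiles by metis
  define ctr where "ctr R = G R z0" for R
  have z0V: "z0 \<in> ?V" using \<rho> by auto
  have ctr_ball: "ball (ctr R) \<rho> \<subseteq> interior R" if "R \<in> \<T>" for R
  proof -
    have "ball (ctr R) \<rho> = G R ` ball z0 \<rho>" unfolding ctr_def using rigid_motion3_ball[OF G(1)[OF that]] by simp
    also have "\<dots> \<subseteq> R" using \<rho>(2) by (subst (2) G(2)[OF that]) auto
    finally show ?thesis by (simp add: interior_maximal)
  qed
  have sep: "dist (ctr R) (ctr S) \<ge> \<rho>" if "R \<in> \<T>" "S \<in> \<T>" "R \<noteq> S" for R S
  proof (rule ccontr)
    assume "\<not> ?thesis"
    then have "ctr R \<in> interior S" using ctr_ball[OF that(2)] by (auto simp: dist_commute)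
    moreover have "ctr R \<in> interior R" using ctr_ball[OF that(1)] \<rho>(1) by auto
    ultimately show False using disjoint[OF that] by auto
  qed
  let ?N = "{R \<in> \<T>. R \<inter> cball z r \<noteq> {}}"
  have inj: "inj_on ctr ?N"
    by (rule inj_onI) (use sep \<rho>(1) in fastforce)
  have "uniform_discrete (ctr ` ?N)" unfolding uniform_discrete_def
  proof (intro exI[of _ \<rho>] conjI ballI impI)
    fix u v assume "u \<in> ctr ` ?N" "v \<in> ctr ` ?N" "dist u v < \<rho>"
    then obtain R S where "R \<in> \<T>" "S \<in> \<T>" "u = ctr R" "v = ctr S" by auto
    then show "u = v" using sep[of R S] \<open>dist u v < \<rho>\<close> by fastforce
  qed (use \<rho> in auto)
  moreover have "bounded (ctr ` ?N)"
    unfolding bounded_def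
  proof (intro exI[of _ z] exI[of _ "r + diameter ?V"] ballI)
    fix c assume "c \<in> ctr ` ?N"
    then obtain R w where c: "c = ctr R" and R: "R \<in> \<T>" and w: "w \<in> R" "w \<in> cball z r" by blast
    obtain w0 where w0: "w0 \<in> ?V" "w = G R w0" using w(1) G(2)[OF R] by auto
    have "dist w (ctr R) = dist w0 z0" unfolding ctr_def w0 using rigid_motion3_dist[OF G(1)[OF R]] by simp
    also have "\<dots> \<le> diameter ?V" using diameter_bounded_bound[OF bV w0(1) z0V] .
    finally show "dist z c \<le> r + diameter ?V"
      using w(2) dist_triangle[of z "ctr R" w] by (simp add: c)
  qed
  ultimately have "finite (ctr ` ?N)" using uniform_discrete_finite_iff by blast
  then show ?thesis using inj finite_imageD by blast
qed

lemma tile_through_vertices: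
  assumes R: "R \<in> \<T>" and ext: "p extreme_point_of R" "q extreme_point_of R" "y extreme_point_of R"
    and ne: "p \<noteq> q" "p \<noteq> y" "q \<noteq> y"
  obtains z where "labelled p q y z" "R = convex hull {p, q, y, z}"
proof -
  obtain g where g: "rigid_motion3 g" "R = g ` (convex hull {A, B, C, D})" using tiles[OF R] by auto
  have Rh: "R = convex hull (g ` {A, B, C, D})" using g rigid_motion3_convex_hull by simp
  have "p \<in> g ` {A, B, C, D}" "q \<in> g ` {A, B, C, D}" "y \<in> g ` {A, B, C, D}"
    using ext extreme_point_of_convex_hull unfolding Rh by blast+
  then obtain p' q' y' where v: "p = g p'" "q = g q'" "y = g y'"
    "{p', q', y'} \<subseteq> {A, B, C, D}" by blast
  have ne': "p' \<noteq> q'" "p' \<noteq> y'" "q' \<noteq> y'" using v ne by auto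
  have "card ({A, B, C, D} - {p', q', y'}) = 1"
    using v(4) ne' orient3_neq0_independent(2)[OF nondegenerate] by (subst card_Diff_subset) auto
  then obtain z' where z': "{A, B, C, D} - {p', q', y'} = {z'}" using card_1_singletonE by blast
  have eq: "{p', q', y', z'} = {A, B, C, D}" using z' v(4) by blast
  have hull: "R = convex hull {p, q, y, g z'}"
    unfolding Rh eq[symmetric] by (simp add: v)
  then have "labelled p q y (g z')"
    unfolding labelled_def using R v g(1) eq by blast
  then show thesis using that hull by blast
qed

text \<open>The tile behind the face pqy is caught by approaching the centroid \<open>m\<close> of
  this face from outside. Because the tiling is face-to-face, a tile that contains \<open>m\<close>
  contains the whole face.\<close>

lemma neighbour:
  assumes lab: "labelled p q x y" and pos: "orient3 p q x y > 0"
  shows "\<exists>z. labelled p q y z \<and> orient3 p q y z > 0"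
proof -
  define n where "n = cross3 (q - p) (y - p)"
  define m where "m = (1/3) *\<^sub>R (p + q + y)"
  define Q where "Q = convex hull {p, q, x, y}"
  note ind = orient3_neq0_independent[OF less_imp_neq[OF pos, symmetric]]
  have Q: "Q \<in> \<T>" using lab by (simp add: labelled_def Q_def)
  have or_n: "orient3 p q y z = n \<bullet> (z - p)" for z
    unfolding orient3_def n_def using cross_triple[of "q - p" "y - p" "z - p"]
    by (metis inner_commute)
  have nx: "n \<bullet> (x - p) < 0" using pos orient3_perm(3)[of p q y x] by (simp flip: or_n)
  have np: "n \<bullet> (p - p) = 0" "n \<bullet> (q - p) = 0" "n \<bullet> (y - p) = 0"
    by (simp_all flip: or_n)
  have n0: "n \<noteq> 0" using nx by auto
  have mn: "n \<bullet> (m - p) = 0"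
  proof -
    have "m - p = (1/3) *\<^sub>R (q - p) + (1/3) *\<^sub>R (y - p)"
      by (simp add: m_def algebra_simps flip: scaleR_add_left)
    then show ?thesis using np by (simp add: inner_add_right)
  qed
  have halfspace: "convex {v. n \<bullet> (v - p) \<le> 0}"
    using convex_halfspace_le[of n "n \<bullet> p"] by (simp add: inner_diff_right)
  have Qside: "n \<bullet> (v - p) \<le> 0" if "v \<in> Q" for v
    using that hull_minimal[of "{p, q, x, y}" _ convex, OF _ halfspace] np nx by (auto simp: Q_def)
  define v where "v k = m + inverse (real (Suc k)) *\<^sub>R n" for k
  have vpos: "n \<bullet> (v k - p) > 0" for k
  proof -
    have "n \<bullet> (v k - p) = n \<bullet> (m - p) + inverse (real (Suc k)) * (n \<bullet> n)"
      by (simp add: v_def inner_diff_right inner_add_right)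
    then show ?thesis using mn n0 by simp
  qed
  have vlim: "v \<longlonglongrightarrow> m"
  proof -
    have "v \<longlonglongrightarrow> m + 0 *\<^sub>R n" unfolding v_def
      by (intro tendsto_intros LIMSEQ_inverse_real_of_nat)
    then show ?thesis by simp
  qed
  have "\<forall>k. \<exists>R. R \<in> \<T> \<and> v k \<in> R" using cover by blast
  then obtain R where R: "\<And>k. R k \<in> \<T>" "\<And>k. v k \<in> R k" by metis
  have vb: "v k \<in> cball m (norm n)" for k
  proof -
    have "norm (inverse (real (Suc k)) *\<^sub>R n) \<le> 1 * norm n"
      unfolding norm_scaleR by (intro mult_right_mono) (auto simp: field_simps)
    then show ?thesis by (simp add: v_def dist_norm)
  qed
  \<comment> \<open>Only finitely many tiles come near \<open>m\<close>, so a single tile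
    \<open>S\<close> contains infinitely many of the points \<open>v k\<close>, and being closed it
    contains their limit.\<close>
  have "finite (range R)"
    by (rule finite_subset[OF _ finite_tiles_near[of m "norm n"]]) (use R vb in blast)
  then obtain S where inf: "infinite (R -` {S})"
    using inf_img_fin_dom[of R UNIV] by auto
  then have SR: "\<exists>k\<ge>N. R k = S" for N
    using infinite_nat_iff_unbounded_le[of "R -` {S}"] by auto
  have S: "S \<in> \<T>" using SR R(1) by metis
  have closedT: "closed U" if U: "U \<in> \<T>" for U
  proof -
    obtain g where g: "rigid_motion3 g" "U = convex hull (g ` {A, B, C, D})"
      using tiles[OF U] rigid_motion3_convex_hull by metis
    then show ?thesis by (simp add: compact_imp_closed compact_convex_hull finite_imp_compact)
  qed
  have mS: "m \<in> S"
  proof (rule ccontr)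
    assume "m \<notin> S"
    then have "eventually (\<lambda>k. v k \<in> - S) sequentially"
      using vlim closedT[OF S] by (intro topological_tendstoD) auto
    then obtain N where "v k \<notin> S" if "k \<ge> N" for k by (auto simp: eventually_sequentially)
    then show False using SR[of N] R(2) by metis
  qed
  obtain k0 where k0: "R k0 = S" using SR by blast
  have QS: "Q \<noteq> S" using Qside[of "v k0"] vpos[of k0] R(2)[of k0] k0 by auto
  have pqy: "p \<in> Q" "q \<in> Q" "x \<in> Q" "y \<in> Q" by (auto simp: Q_def hull_inc)
  have mQ: "m \<in> Q"
  proof -
    have "m \<in> convex hull {p, q, y}"
      unfolding convex_hull_3 m_def by (intro CollectI exI[of _ "1/3"]) (auto simp: algebra_simps)
    then show ?thesis unfolding Q_def using hull_mono[of "{p, q, y}" "{p, q, x, y}" convex] by auto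
  qed
  have F: "Q \<inter> S face_of Q" "Q \<inter> S face_of S" using face[OF Q S QS] mS mQ by auto
  have mid: "(1/2) *\<^sub>R (q + y) \<in> Q"
  proof -
    have "(1/2) *\<^sub>R (q + y) = (1/2) *\<^sub>R q + (1/2) *\<^sub>R y" by (simp add: scaleR_add_right)
    moreover have "convex Q" by (simp add: Q_def)
    ultimately show ?thesis using pqy convexD[of Q q y "1/2" "1/2"] by simp
  qed
  \<comment> \<open>The defining property of faces is applied twice: from \<open>m\<close> to
    \<open>p\<close> and the midpoint of qy, then from this midpoint to \<open>q\<close> and
    \<open>y\<close>.\<close>
  have m_seg: "m \<in> open_segment p ((1/2) *\<^sub>R (q + y))"
    unfolding in_segment
  proof (intro conjI exI[of _ "2/3"])
    show "p \<noteq> (1/2) *\<^sub>R (q + y)"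
    proof
      assume "p = (1/2) *\<^sub>R (q + y)"
      then have "2 *\<^sub>R p = 2 *\<^sub>R ((1/2) *\<^sub>R (q + y))" by (rule arg_cong)
      then have yp: "y - p = - (q - p)" by (simp add: scaleR_2 algebra_simps)
      show False using n0 unfolding n_def yp by (simp only: cross_minus_right cross_refl minus_zero)
    qed
    show "m = (1 - 2/3) *\<^sub>R p + (2/3) *\<^sub>R ((1/2) *\<^sub>R (q + y))"
      by (simp add: m_def scaleR_add_right)
  qed auto
  have mem: "a \<in> Q \<inter> S \<and> b \<in> Q \<inter> S" if "a \<in> Q" "b \<in> Q" "w \<in> Q \<inter> S" "w \<in> open_segment a b" for a b w
    using F(1) that by (auto simp: face_of_def)
  have 1: "p \<in> Q \<inter> S" "(1/2) *\<^sub>R (q + y) \<in> Q \<inter> S" using mem[OF pqy(1) mid _ m_seg] mQ mS by auto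
  have "(1/2) *\<^sub>R (q + y) \<in> open_segment q y"
    unfolding in_segment using ind by (intro conjI exI[of _ "1/2"]) (auto simp: scaleR_add_right)
  then have 2: "q \<in> Q \<inter> S" "y \<in> Q \<inter> S" using mem[OF pqy(2,4) 1(2)] by auto
  have extQ: "p extreme_point_of Q" "q extreme_point_of Q" "y extreme_point_of Q"
    unfolding Q_def extreme_point_of_convex_hull_affine_independent[OF ind(1)] by auto
  have ext: "p extreme_point_of S" "q extreme_point_of S" "y extreme_point_of S"
    using extreme_point_of_face[OF F(1)] extreme_point_of_face[OF F(2)] extQ 1 2 by auto
  obtain z where z: "labelled p q y z" "S = convex hull {p, q, y, z}"
    using tile_through_vertices[OF S ext] ind by auto
  have "orient3 p q y z > 0"
  proof (rule ccontr)
    assume "\<not> ?thesis"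
    then have "n \<bullet> (z - p) \<le> 0" by (simp add: or_n)
    then have "S \<subseteq> {v. n \<bullet> (v - p) \<le> 0}"
      unfolding z(2) using np by (intro hull_minimal halfspace) auto
    then show False using vpos[of k0] R(2)[of k0] k0 by auto
  qed
  then show ?thesis using z by auto
qed

end

section \<open>Dihedral angles as arguments of complex numbers\<close>

lemma inner_dist:
  fixes p x y :: "'a::real_inner"
  shows "(x - p) \<bullet> (y - p) = ((dist p x)\<^sup>2 + (dist p y)\<^sup>2 - (dist x y)\<^sup>2) / 2"
  using dot_norm_neg[of "x - p" "y - p"] by (simp add: dist_norm norm_minus_commute)

lemma cos_dihedral_inner:
  fixes p q x y :: "real^3"
  defines "a \<equiv> q - p" and "b \<equiv> x - p" and "c \<equiv> y - p"
  shows "cos_dihedral p q x y = ((a\<bullet>a) * (b\<bullet>c) - (a\<bullet>b) * (a\<bullet>c)) /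
    (sqrt ((a\<bullet>a) * (b\<bullet>b) - (a\<bullet>b)\<^sup>2) * sqrt ((a\<bullet>a) * (c\<bullet>c) - (a\<bullet>c)\<^sup>2))"
proof -
  have "norm (cross3 v w) = sqrt ((v\<bullet>v) * (w\<bullet>w) - (v\<bullet>w)\<^sup>2)" for v w :: "real^3"
    unfolding norm_cross_square[symmetric] by simp
  then show ?thesis
    unfolding cos_dihedral_def a_def b_def c_def by (simp add: dot_cross inner_commute)
qed

lemma dihedral_cong:
  assumes "dist p q = dist p' q'" "dist p x = dist p' x'" "dist p y = dist p' y'"
    "dist q x = dist q' x'" "dist q y = dist q' y'" "dist x y = dist x' y'"
  shows "dihedral p q x y = dihedral p' q' x' y'"
  unfolding dihedral_def cos_dihedral_inner inner_dist using assms by simp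

text \<open>\<open>z\<close> projects along the edge pq onto the orthogonal plane, read as the
  complex plane with the image of \<open>x0\<close> on the positive real axis. Angles around the
  edge become differences of arguments.\<close>

lemma edge_projection:
  fixes p q x0 :: "real^3"
  assumes "cross3 (q - p) (x0 - p) \<noteq> 0"
  obtains z :: "real^3 \<Rightarrow> complex" where
    "Re (z x0) > 0" "Im (z x0) = 0"
    "\<And>v w. Re (cnj (z v) * z w) = (cross3 (q - p) (v - p) \<bullet> cross3 (q - p) (w - p)) / (dist p q)\<^sup>2"
    "\<And>v w. Im (cnj (z v) * z w) = orient3 p q v w / dist p q"
    "surj z"
proof -
  define d where "d = dist p q"
  have pq: "p \<noteq> q" using assms by auto
  have d: "d > 0" using pq by (simp add: d_def)
  define u where "u = (1/d) *\<^sub>R (q - p)"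
  have qp: "q - p = d *\<^sub>R u" using d by (simp add: u_def)
  have uu: "u \<bullet> u = 1"
    using d by (simp add: u_def d_def dist_norm norm_minus_commute power2_norm_eq_inner[symmetric] power2_eq_square)
  define b where "b = (x0 - p) - (u \<bullet> (x0 - p)) *\<^sub>R u"
  have ub: "u \<bullet> b = 0" using uu by (simp add: b_def inner_diff_right)
  have b0: "b \<noteq> 0"
  proof
    assume "b = 0"
    then have "x0 - p = (u \<bullet> (x0 - p)) *\<^sub>R u" by (simp add: b_def)
    then have "cross3 (q - p) (x0 - p) = 0" by (metis qp cross_mult_left cross_mult_right cross_refl scaleR_zero_right)
    then show False using assms by simp
  qed
  define e1 where "e1 = (1 / norm b) *\<^sub>R b"
  define e2 where "e2 = cross3 u e1"
  have e11: "e1 \<bullet> e1 = 1" using b0 by (simp add: e1_def power2_norm_eq_inner[symmetric] power2_eq_square)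
  have ue1: "u \<bullet> e1 = 0" "e1 \<bullet> u = 0" using ub by (simp_all add: e1_def inner_commute)
  have e22: "e2 \<bullet> e2 = 1" unfolding e2_def dot_cross by (simp add: uu e11 ue1)
  have e12: "e1 \<bullet> e2 = 0" "e2 \<bullet> e1 = 0" by (simp_all add: e2_def dot_cross_self)
  have e1xe2: "cross3 e1 e2 = u" unfolding e2_def Lagrange by (simp add: e11 ue1)
  define z where "z v = Complex (e1 \<bullet> (v - p)) (e2 \<bullet> (v - p))" for v
  have x0': "x0 - p = norm b *\<^sub>R e1 + (u \<bullet> (x0 - p)) *\<^sub>R u"
    using b0 by (simp add: e1_def b_def)
  show thesis
  proof (rule that[of z])
    have "e1 \<bullet> (x0 - p) = norm b" by (subst x0') (simp add: inner_add_right e11 ue1)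
    then show "Re (z x0) > 0" using b0 by (simp add: z_def)
    have "e2 \<bullet> (x0 - p) = 0" by (subst x0') (simp add: inner_add_right e12 e2_def dot_cross_self)
    then show "Im (z x0) = 0" by (simp add: z_def)
    show "Re (cnj (z v) * z w) = (cross3 (q - p) (v - p) \<bullet> cross3 (q - p) (w - p)) / (dist p q)\<^sup>2" for v w
    proof -
      have e1c: "cross3 e1 (cross3 u y) = (e1 \<bullet> y) *\<^sub>R u" for y
        unfolding Lagrange by (simp add: ue1)
      have e1d: "e1 \<bullet> cross3 u y = - (e2 \<bullet> y)" for y
        unfolding e2_def by (metis cross_triple cross_skew inner_commute inner_minus_left)
      then have e1d': "cross3 u y \<bullet> e1 = - (e2 \<bullet> y)" for y by (simp only: inner_commute)
      have "cross3 e1 (cross3 u (v - p)) \<bullet> cross3 e1 (cross3 u (w - p)) =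
        cross3 u (v - p) \<bullet> cross3 u (w - p) - (e2 \<bullet> (w - p)) * (e2 \<bullet> (v - p))"
        unfolding dot_cross[of e1] by (simp add: e11 e1d e1d')
      then have "(e1 \<bullet> (v - p)) * (e1 \<bullet> (w - p)) + (e2 \<bullet> (v - p)) * (e2 \<bullet> (w - p)) =
        cross3 u (v - p) \<bullet> cross3 u (w - p)"
        unfolding e1c by (simp add: uu algebra_simps)
      then show ?thesis using d
        unfolding qp cross_mult_left by (simp add: z_def d_def[symmetric] power2_eq_square)
    qed
    show "Im (cnj (z v) * z w) = orient3 p q v w / dist p q" for v w
    proof -
      have "(e1 \<bullet> (v - p)) * (e2 \<bullet> (w - p)) - (e1 \<bullet> (w - p)) * (e2 \<bullet> (v - p)) = u \<bullet> cross3 (v - p) (w - p)"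
        unfolding e1xe2[symmetric] dot_cross by simp
      then show ?thesis using d
        unfolding orient3_def qp by (simp add: z_def d_def[symmetric] mult.commute)
    qed
    show "surj z"
    proof (rule surjI)
      fix c
      show "z (p + Re c *\<^sub>R e1 + Im c *\<^sub>R e2) = c"
        by (simp add: z_def inner_add_right e11 e12 e22 add.assoc)
    qed
  qed
qed

text \<open>Cramer's rule in dimension three, in the form without division.\<close>

lemma triple_cramer:
  fixes a b c d :: "real^3"
  shows "(a \<bullet> cross3 b c) *\<^sub>R d =
    (d \<bullet> cross3 b c) *\<^sub>R a + (a \<bullet> cross3 d c) *\<^sub>R b + (a \<bullet> cross3 b d) *\<^sub>R c"
  unfolding vec_eq_iff forall_3 cross3_def inner_vec_def sum_3 vector_3 inner_real_def
    vector_add_component vector_scaleR_component real_scaleR_def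
  by (intro conjI; algebra)

text \<open>The two sign conditions on \<open>w\<close> place it in the open wedge of the
  tetrahedron at pq, so its coordinates along x - p and y - p are positive. Near the midpoint of pq
  the coefficients of p and q stay close to 1/2.\<close>

lemma interior_near_edge:
  assumes o: "orient3 p q x y > 0" "orient3 p q x w > 0" "orient3 p q w y > 0"
  shows "\<exists>\<epsilon>0>0. \<forall>\<epsilon>. 0 < \<epsilon> \<and> \<epsilon> < \<epsilon>0 \<longrightarrow>
    (1/2) *\<^sub>R (p + q) + \<epsilon> *\<^sub>R (w - p) \<in> interior (convex hull {p, q, x, y})"
proof -
  define k where "k = orient3 p q x y"
  define \<xi> \<mu> \<nu> where "\<xi> = orient3 p q w y / k" and "\<mu> = orient3 p q x w / k" and "\<nu> = orient3 p w x y / k"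
  have k: "k > 0" using o by (simp add: k_def)
  have pos: "\<xi> > 0" "\<mu> > 0" using o k by (simp_all add: \<xi>_def \<mu>_def)
  have "k *\<^sub>R (w - p) = orient3 p w x y *\<^sub>R (q - p) + orient3 p q w y *\<^sub>R (x - p) + orient3 p q x w *\<^sub>R (y - p)"
    unfolding k_def orient3_def by (rule triple_cramer)
  then have "(1/k) *\<^sub>R (k *\<^sub>R (w - p)) = \<nu> *\<^sub>R (q - p) + \<xi> *\<^sub>R (x - p) + \<mu> *\<^sub>R (y - p)"
    by (simp add: \<xi>_def \<mu>_def \<nu>_def scaleR_add_right)
  then have w: "w - p = \<nu> *\<^sub>R (q - p) + \<xi> *\<^sub>R (x - p) + \<mu> *\<^sub>R (y - p)" using k by simp
  define \<epsilon>0 where "\<epsilon>0 = 1 / (2 * (1 + \<bar>\<xi> + \<mu> + \<nu>\<bar> + \<bar>\<nu>\<bar>))"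
  have den: "1 + \<bar>\<xi> + \<mu> + \<nu>\<bar> + \<bar>\<nu>\<bar> > 0" by simp
  have "(1/2) *\<^sub>R (p + q) + \<epsilon> *\<^sub>R (w - p) \<in> interior (convex hull {p, q, x, y})"
    if \<epsilon>: "0 < \<epsilon>" "\<epsilon> < \<epsilon>0" for \<epsilon>
  proof -
    have "\<epsilon> * (1 + \<bar>\<xi> + \<mu> + \<nu>\<bar> + \<bar>\<nu>\<bar>) < 1/2" using \<epsilon> den by (simp add: \<epsilon>0_def field_simps)
    then have e: "\<epsilon> + \<epsilon> * \<bar>\<xi> + \<mu> + \<nu>\<bar> + \<epsilon> * \<bar>\<nu>\<bar> < 1/2" by (simp add: distrib_left)
    have a: "\<epsilon> * (\<xi> + \<mu> + \<nu>) \<le> \<epsilon> * \<bar>\<xi> + \<mu> + \<nu>\<bar>" "\<epsilon> * (- \<nu>) \<le> \<epsilon> * \<bar>\<nu>\<bar>"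
      using \<epsilon>(1) by (intro mult_left_mono; simp)+
    have b: "0 \<le> \<epsilon> * \<bar>\<xi> + \<mu> + \<nu>\<bar>" "0 \<le> \<epsilon> * \<bar>\<nu>\<bar>"
      using \<epsilon>(1) by (intro mult_nonneg_nonneg; simp)+
    have "(1/2 - \<epsilon> * (\<xi> + \<mu> + \<nu>)) *\<^sub>R p + (1/2 + \<epsilon> * \<nu>) *\<^sub>R q + (\<epsilon> * \<xi>) *\<^sub>R x + (\<epsilon> * \<mu>) *\<^sub>R y
        \<in> interior (convex hull {p, q, x, y})"
    proof (rule interior_tetrahedron)
      show "0 < 1/2 - \<epsilon> * (\<xi> + \<mu> + \<nu>)" using a b e \<epsilon>(1) by linarith
      show "0 < 1/2 + \<epsilon> * \<nu>" using a(2) b e \<epsilon>(1) unfolding mult_minus_right by linarith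
    qed (use o pos \<epsilon> in \<open>auto simp: algebra_simps\<close>)
    also have "(1/2 - \<epsilon> * (\<xi> + \<mu> + \<nu>)) *\<^sub>R p + (1/2 + \<epsilon> * \<nu>) *\<^sub>R q + (\<epsilon> * \<xi>) *\<^sub>R x + (\<epsilon> * \<mu>) *\<^sub>R y
      = (1/2) *\<^sub>R (p + q) + \<epsilon> *\<^sub>R (w - p)"
      unfolding w by (simp add: algebra_simps)
    finally show ?thesis .
  qed
  then show ?thesis using den by (intro exI[of _ \<epsilon>0]) (auto simp: \<epsilon>0_def)
qed

lemma complex_eq_cis_arccos:
  assumes "c \<noteq> 0" "Im c > 0"
  shows "c = complex_of_real (cmod c) * cis (arccos (Re c / cmod c))"
    "0 < arccos (Re c / cmod c)" "arccos (Re c / cmod c) < pi"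
proof -
  define t where "t = Re c / cmod c"
  have r: "cmod c > 0" using assms by simp
  have "(Re c)\<^sup>2 < (cmod c)\<^sup>2" using assms by (simp add: cmod_power2)
  then have "t\<^sup>2 < 1" using r by (simp add: t_def power_divide)
  then have t: "-1 < t" "t < 1" by (auto simp: abs_square_less_1)
  have "sin (arccos t) = sqrt (1 - t\<^sup>2)" using t by (simp add: sin_arccos)
  also have "1 - t\<^sup>2 = (Im c / cmod c)\<^sup>2"
  proof -
    have "t\<^sup>2 + (Im c / cmod c)\<^sup>2 = 1"
      unfolding t_def power_divide add_divide_distrib[symmetric] cmod_power2[symmetric] using r by simp
    then show ?thesis by simp
  qed
  also have "sqrt \<dots> = Im c / cmod c" using assms r by simp
  finally have s: "sin (arccos t) = Im c / cmod c" .
  show "c = complex_of_real (cmod c) * cis (arccos (Re c / cmod c))"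
    unfolding t_def[symmetric] using t r s by (simp add: complex_eq_iff t_def)
  show "0 < arccos (Re c / cmod c)" "arccos (Re c / cmod c) < pi"
    unfolding t_def[symmetric] using t arccos_lt_bounded[of t] by auto
qed

section \<open>The closed walk around an edge\<close>

context op_tetra_tiling
begin

lemma labelled_preimage:
  assumes "labelled p q x y"
  obtains p' q' x' y' where "{p', q', x', y'} = {A, B, C, D}" "orient3 p' q' x' y' = orient3 p q x y"
    "dist p' q' = dist p q" "dist p' x' = dist p x" "dist p' y' = dist p y"
    "dist q' x' = dist q x" "dist q' y' = dist q y" "dist x' y' = dist x y"
    "dihedral p' q' x' y' = dihedral p q x y"
proof -
  obtain g p' q' x' y' where g: "rigid_motion3 g" "{p', q', x', y'} = {A, B, C, D}"
    "p = g p'" "q = g q'" "x = g x'" "y = g y'" using assms unfolding labelled_def by blast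
  have d: "dist p' q' = dist p q" "dist p' x' = dist p x" "dist p' y' = dist p y"
    "dist q' x' = dist q x" "dist q' y' = dist q y" "dist x' y' = dist x y"
    unfolding g(3-6) by (simp_all add: rigid_motion3_dist[OF g(1)])
  show thesis
    by (rule that[OF g(2) _ d dihedral_cong[OF d(1,2,3,4,5,6)]])
      (simp add: g(3-6) rigid_motion3_orient3[OF g(1)])
qed

text \<open>\<open>w\<close> is a direction common to both wedges, so the interiors meet and the
  tiles coincide. The equal orientations then tell \<open>x\<close> from \<open>y\<close>.\<close>

lemma labelled_tile_eq:
  assumes lab: "labelled p q x y" "labelled p q x' y'"
    and o: "orient3 p q x y > 0" "orient3 p q x' y' > 0"
    and w: "orient3 p q x w > 0" "orient3 p q w y > 0" "orient3 p q x' w > 0" "orient3 p q w y' > 0"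
  shows "x' = x"
proof -
  note ind = orient3_neq0_independent[OF less_imp_neq[OF o(1), symmetric]]
  note ind' = orient3_neq0_independent[OF less_imp_neq[OF o(2), symmetric]]
  let ?Q = "convex hull {p, q, x, y}" and ?R = "convex hull {p, q, x', y'}"
  obtain \<epsilon>1 where 1: "\<epsilon>1 > 0" "\<And>\<epsilon>. 0 < \<epsilon> \<and> \<epsilon> < \<epsilon>1 \<Longrightarrow> (1/2) *\<^sub>R (p + q) + \<epsilon> *\<^sub>R (w - p) \<in> interior ?Q"
    using interior_near_edge[OF o(1) w(1,2)] by blast
  obtain \<epsilon>2 where 2: "\<epsilon>2 > 0" "\<And>\<epsilon>. 0 < \<epsilon> \<and> \<epsilon> < \<epsilon>2 \<Longrightarrow> (1/2) *\<^sub>R (p + q) + \<epsilon> *\<^sub>R (w - p) \<in> interior ?R"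
    using interior_near_edge[OF o(2) w(3,4)] by blast
  define \<epsilon> where "\<epsilon> = min \<epsilon>1 \<epsilon>2 / 2"
  have "0 < \<epsilon> \<and> \<epsilon> < \<epsilon>1" "0 < \<epsilon> \<and> \<epsilon> < \<epsilon>2"
    using 1(1) 2(1) by (auto simp: \<epsilon>_def min_def)
  then have "interior ?Q \<inter> interior ?R \<noteq> {}" using 1(2) 2(2) by blast
  then have QR: "?Q = ?R" using disjoint[of ?Q ?R] lab unfolding labelled_def by blast
  have "{p, q, x, y} = {p, q, x', y'}"
    using extreme_point_of_convex_hull_affine_independent[OF ind(1)]
      extreme_point_of_convex_hull_affine_independent[OF ind'(1)] unfolding QR by blast
  then have "x' \<in> {x, y}" "y' \<in> {x, y}" using ind' by auto
  then show ?thesis using ind' o orient3_perm(3)[of p q x y] by auto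
qed

text \<open>A tile is recorded by lengths only: \<open>u i\<close> and \<open>v i\<close> are the
  distances from the two ends of the edge to the free vertex of the face through which tile
  \<open>i\<close> is entered.\<close>

abbreviation turn_step where
  "turn_step P Q u v \<theta> i \<equiv> \<exists>p q x y. {p, q, x, y} = {A, B, C, D} \<and> orient3 p q x y > 0 \<and> dist p q = dist P Q \<and>
     dist p x = u i \<and> dist q x = v i \<and> dist p y = u (Suc i) \<and> dist q y = v (Suc i) \<and> \<theta> i = dihedral p q x y"

text \<open>When the angles from iterating \<open>neighbour\<close> pass 2\<pi>, the tile reached
  overlaps the first one and hence equals it. The angle turned before it is then a positive multiple
  of 2\<pi> and at most 2\<pi>.\<close>

theorem edge_walk_pos:
  assumes V: "{P, Q, X, Y} = {A, B, C, D}" and o: "orient3 P Q X Y > 0"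
  obtains n :: nat and u v \<theta> :: "nat \<Rightarrow> real" where "n \<ge> 1"
    "\<And>i. turn_step P Q u v \<theta> i"
    "u 0 = dist P X" "v 0 = dist Q X" "u 1 = dist P Y" "v 1 = dist Q Y" "\<theta> 0 = dihedral P Q X Y"
    "u n = u 0" "v n = v 0" "(\<Sum>i<n. \<theta> i) = 2 * pi"
proof -
  have labV: "labelled P Q X Y"
  proof -
    have "rigid_motion3 (\<lambda>x. x)"
      unfolding rigid_motion3_def
      by (intro exI[of _ "\<lambda>x. x"] exI[of _ 0]) (auto simp: orthogonal_transformation_id[unfolded id_def] matrix_id[unfolded id_def] )
    then show ?thesis unfolding labelled_def using V base_tile by metis
  qed
  let ?good = "\<lambda>s. labelled P Q (fst s) (snd s) \<and> orient3 P Q (fst s) (snd s) > 0"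
  have "\<exists>f :: nat \<Rightarrow> (real^3) \<times> (real^3). \<forall>n. (?good (f n) \<and> (n = 0 \<longrightarrow> f n = (X, Y))) \<and> fst (f (Suc n)) = snd (f n)"
  proof (rule dependent_nat_choice)
    show "\<exists>s. ?good s \<and> ((0::nat) = 0 \<longrightarrow> s = (X, Y))" using labV o by auto
  next
    fix s :: "(real^3) \<times> (real^3)" and n :: nat
    assume "?good s \<and> (n = 0 \<longrightarrow> s = (X, Y))"
    then obtain z where "labelled P Q (snd s) z" "orient3 P Q (snd s) z > 0" using neighbour by blast
    then show "\<exists>s'. (?good s' \<and> (Suc n = 0 \<longrightarrow> s' = (X, Y))) \<and> fst s' = snd s"
      by (intro exI[of _ "(snd s, z)"]) auto
  qed
  then obtain f :: "nat \<Rightarrow> (real^3) \<times> (real^3)" where f: "\<And>n. ?good (f n)" "f 0 = (X, Y)"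
    "\<And>n. fst (f (Suc n)) = snd (f n)" by blast
  define x where "x i = fst (f i)" for i
  have lab: "labelled P Q (x i) (x (Suc i))" and ori: "orient3 P Q (x i) (x (Suc i)) > 0" for i
    using f(1)[of i] f(3)[of i] by (simp_all add: x_def)
  have x01: "x 0 = X" "x 1 = Y" using f(2) f(3)[of 0] by (simp_all add: x_def)
  define \<theta> where "\<theta> i = dihedral P Q (x i) (x (Suc i))" for i
  have PQ: "P \<noteq> Q" and d0: "dist P Q > 0" using o by auto
  have "cross3 (Q - P) (X - P) \<noteq> 0"
  proof
    assume "cross3 (Q - P) (X - P) = 0"
    then have "cross3 (Q - P) (X - P) \<bullet> (Y - P) = 0" by simp
    then show False using o cross_triple[of "Q - P" "X - P" "Y - P"] unfolding orient3_def
      by (simp add: inner_commute)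
  qed
  then obtain z where z: "Re (z X) > 0" "Im (z X) = 0"
    "\<And>v w. Re (cnj (z v) * z w) = (cross3 (Q - P) (v - P) \<bullet> cross3 (Q - P) (w - P)) / (dist P Q)\<^sup>2"
    "\<And>v w. Im (cnj (z v) * z w) = orient3 P Q v w / dist P Q"
    "surj z" using edge_projection by metis
  have cmodz: "cmod (z v) = norm (cross3 (Q - P) (v - P)) / dist P Q" for v
  proof -
    have "(cmod (z v))\<^sup>2 = Re (cnj (z v) * z v)" unfolding cmod_power2 by (simp add: power2_eq_square)
    also have "\<dots> = (norm (cross3 (Q - P) (v - P)) / dist P Q)\<^sup>2"
      unfolding z(3) by (simp add: power_divide power2_norm_eq_inner)
    finally show ?thesis by (simp add: power2_eq_iff_nonneg)
  qed
  have step: "z w = (cmod (z w) / cmod (z v)) *\<^sub>R (z v * cis (dihedral P Q v w))"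
      "0 < dihedral P Q v w" "dihedral P Q v w < pi" "z v \<noteq> 0" if vw: "orient3 P Q v w > 0" for v w
  proof -
    define c where "c = cnj (z v) * z w"
    have Imc: "Im c > 0" unfolding c_def z(4) using vw d0 by simp
    then have c0: "c \<noteq> 0" by auto
    then show zv: "z v \<noteq> 0" by (auto simp: c_def)
    have dih: "dihedral P Q v w = arccos (Re c / cmod c)"
    proof -
      have "Re c / cmod c = cos_dihedral P Q v w"
        unfolding c_def z(3) norm_mult complex_mod_cnj cmodz cos_dihedral_def
        using d0 by (simp add: field_simps power2_eq_square)
      then show ?thesis by (simp add: dihedral_def)
    qed
    note cis = complex_eq_cis_arccos[OF c0 Imc, folded dih]
    show "0 < dihedral P Q v w" "dihedral P Q v w < pi" using cis(2,3) by auto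
    have "z v * c = complex_of_real ((cmod (z v))\<^sup>2) * z w"
      unfolding c_def complex_norm_square by (simp add: mult_ac)
    then have "complex_of_real ((cmod (z v))\<^sup>2) * z w = z v * (complex_of_real (cmod c) * cis (dihedral P Q v w))"
      using cis(1) by simp
    also have "cmod c = cmod (z v) * cmod (z w)" by (simp add: c_def norm_mult)
    finally have "complex_of_real (cmod (z v)) * (complex_of_real (cmod (z v)) * z w) =
      complex_of_real (cmod (z v)) * (complex_of_real (cmod (z w)) * (z v * cis (dihedral P Q v w)))"
      by (simp add: power2_eq_square mult_ac)
    then have "complex_of_real (cmod (z v)) * z w = complex_of_real (cmod (z w)) * (z v * cis (dihedral P Q v w))"
      using zv by simp
    then have "z w = complex_of_real (cmod (z w)) * (z v * cis (dihedral P Q v w)) / complex_of_real (cmod (z v))"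
      using zv by (simp add: field_simps)
    then show "z w = (cmod (z w) / cmod (z v)) *\<^sub>R (z v * cis (dihedral P Q v w))"
      by (simp add: scaleR_conv_of_real)
  qed
  have th: "0 < \<theta> i" "\<theta> i < pi" and zx0: "z (x i) \<noteq> 0" for i
    using step[OF ori[of i]] by (auto simp: \<theta>_def)
  define \<Phi> where "\<Phi> k = (\<Sum>i<k. \<theta> i)" for k
  have \<Phi>: "\<Phi> 0 = 0" "\<Phi> (Suc k) = \<Phi> k + \<theta> k" for k by (simp_all add: \<Phi>_def)
  have zx: "z (x k) = complex_of_real (cmod (z (x k))) * cis (\<Phi> k)" for k
  proof (induction k)
    case 0
    then show ?case using z(1,2) by (simp add: x01 \<Phi> complex_eq_iff cmod_def)
  next
    case (Suc k)
    have "z (x (Suc k)) = (cmod (z (x (Suc k))) / cmod (z (x k))) *\<^sub>R (z (x k) * cis (\<theta> k))"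
      using step(1)[OF ori[of k]] by (simp add: \<theta>_def)
    also have "z (x k) * cis (\<theta> k) = complex_of_real (cmod (z (x k))) * cis (\<Phi> (Suc k))"
      by (subst Suc.IH) (simp add: \<Phi> cis_mult[symmetric] mult.assoc)
    finally show ?case using zx0[of k] by (simp add: scaleR_conv_of_real)
  qed
  \<comment> \<open>All angles are dihedral angles of the prototile, so finitely many values occur
    and they are bounded below by a positive \<open>\<delta>\<close>.\<close>
  define F where "F = (\<lambda>(a, b, c, d). dihedral a b c d) ` ({A,B,C,D} \<times> {A,B,C,D} \<times> {A,B,C,D} \<times> {A,B,C,D})"
  have finF: "finite F" unfolding F_def by (intro finite_imageI finite_cartesian_product) auto
  have thF: "\<theta> i \<in> F" for i
  proof -
    obtain p' q' x' y' where "{p', q', x', y'} = {A, B, C, D}" "dihedral p' q' x' y' = \<theta> i"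
      using labelled_preimage[OF lab[of i]] unfolding \<theta>_def by metis
    then have "p' \<in> {A,B,C,D}" "q' \<in> {A,B,C,D}" "x' \<in> {A,B,C,D}" "y' \<in> {A,B,C,D}"
      "\<theta> i = (\<lambda>(a, b, c, d). dihedral a b c d) (p', q', x', y')" by auto
    then show ?thesis unfolding F_def by blast
  qed
  define \<delta> where "\<delta> = Min {t \<in> F. t > 0}"
  have ne: "\<theta> 0 \<in> {t \<in> F. t > 0}" using thF th by auto
  have \<delta>: "\<delta> > 0" "\<delta> \<le> \<theta> i" for i
  proof -
    have "\<delta> \<in> {t \<in> F. t > 0}" unfolding \<delta>_def using finF ne by (intro Min_in) auto
    then show "\<delta> > 0" by simp
    show "\<delta> \<le> \<theta> i" unfolding \<delta>_def using finF thF th by (intro Min_le) auto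
  qed
  have "real k * \<delta> \<le> \<Phi> k" for k
    unfolding \<Phi>_def using sum_mono[of "{..<k}" "\<lambda>_. \<delta>" \<theta>] \<delta>(2) by simp
  moreover obtain k where "2 * pi < real k * \<delta>" using \<delta>(1) reals_Archimedean3 by blast
  ultimately have ex: "\<exists>k. 2 * pi < \<Phi> k" by (meson less_le_trans)
  define m where "m = (LEAST k. 2 * pi < \<Phi> k)"
  have m: "2 * pi < \<Phi> m" unfolding m_def using ex by (rule LeastI_ex)
  have "m \<noteq> 0" using m pi_gt_zero by (intro notI) (simp add: \<Phi>)
  then obtain n where mn: "m = Suc n" using not0_implies_Suc by blast
  have nle: "\<Phi> n \<le> 2 * pi" using not_less_Least[of n "\<lambda>k. 2 * pi < \<Phi> k"] by (simp add: m_def[symmetric] mn)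
  have n1: "n \<ge> 1"
  proof (rule ccontr)
    assume "\<not> ?thesis"
    then have "n = 0" by simp
    then show False using m mn th(2)[of 0] pi_gt_zero by (simp add: \<Phi>)
  qed
  \<comment> \<open>A direction shortly after the start. Being below \<open>\<theta> 0\<close> puts
    it into the wedge of tile 0, being below the overshoot beyond 2\<pi> into that of tile
    \<open>n\<close>.\<close>
  define \<zeta> where "\<zeta> = min (\<theta> 0) (\<Phi> m - 2 * pi) / 2"
  have \<zeta>: "\<zeta> > 0" "\<zeta> < \<theta> 0" "\<zeta> < \<Phi> m - 2 * pi" "\<zeta> < pi"
    using m th(1)[of 0] th(2)[of 0] by (auto simp: \<zeta>_def min_def)
  obtain w where w: "z w = cis \<zeta>" using z(5) by (metis surjD)
  have left: "orient3 P Q (x i) w > 0" if "sin (\<zeta> - \<Phi> i) > 0" for i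
  proof -
    have "Im (cnj (z (x i)) * z w) = cmod (z (x i)) * sin (\<zeta> - \<Phi> i)"
      by (subst zx) (simp add: w sin_diff algebra_simps)
    then have "orient3 P Q (x i) w / dist P Q > 0" unfolding z(4)[symmetric] using that zx0[of i] by simp
    then show ?thesis using d0 by (simp add: zero_less_divide_iff)
  qed
  have right: "orient3 P Q w (x i) > 0" if "sin (\<Phi> i - \<zeta>) > 0" for i
  proof -
    have "Im (cnj (z w) * z (x i)) = cmod (z (x i)) * sin (\<Phi> i - \<zeta>)"
      by (subst zx) (simp add: w sin_diff algebra_simps)
    then have "orient3 P Q w (x i) / dist P Q > 0" unfolding z(4)[symmetric] using that zx0[of i] by simp
    then show ?thesis using d0 by (simp add: zero_less_divide_iff)
  qed
  have xn: "x n = x 0"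
  proof (rule labelled_tile_eq[OF lab[of 0] lab[of n] ori ori])
    show "orient3 P Q (x 0) w > 0" by (rule left) (use \<zeta> in \<open>auto simp: \<Phi> intro: sin_gt_zero\<close>)
    show "orient3 P Q w (x (Suc 0)) > 0"
      by (rule right) (use \<zeta> th(2)[of 0] in \<open>auto simp: \<Phi> intro!: sin_gt_zero\<close>)
    have "sin (\<zeta> - \<Phi> n + 2 * pi) > 0"
      using \<zeta> nle th(2)[of n] by (intro sin_gt_zero) (auto simp: mn \<Phi>)
    then show "orient3 P Q (x n) w > 0" by (intro left) simp
    have "sin (\<Phi> (Suc n) - \<zeta> - 2 * pi) > 0"
      using \<zeta> nle th(2)[of n] by (intro sin_gt_zero) (auto simp: mn \<Phi>)
    then show "orient3 P Q w (x (Suc n)) > 0" by (intro right) (simp add: sin_diff)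
  qed
  have "\<Phi> n = 2 * pi"
  proof -
    have "complex_of_real (cmod (z (x 0))) = complex_of_real (cmod (z (x 0))) * cis (\<Phi> n)"
      using zx[of n] zx[of 0] by (simp add: xn \<Phi>)
    then have "cis (\<Phi> n) = 1" using zx0[of 0] by simp
    then have "cos (\<Phi> n) = 1" by (metis cis.sel(1) one_complex.sel(1))
    then obtain j :: int where j: "\<Phi> n = of_int j * 2 * pi" by (auto simp: cos_one_2pi_int)
    have "\<Phi> n > 0" unfolding \<Phi>_def using n1 th(1) by (intro sum_pos) (auto simp: lessThan_empty_iff)
    then have "j > 0" using j pi_gt_zero by (simp add: zero_less_mult_iff)
    moreover have "j \<le> 1" using nle j pi_gt_zero by simp
    ultimately have "j = 1" by simp
    then show ?thesis using j by simp
  qed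
  show thesis
  proof (rule that[of n "\<lambda>i. dist P (x i)" "\<lambda>i. dist Q (x i)" \<theta>])
    fix i
    obtain p' q' x' y' where 1: "{p', q', x', y'} = {A, B, C, D}" "orient3 p' q' x' y' = orient3 P Q (x i) (x (Suc i))"
    "dist p' q' = dist P Q" "dist p' x' = dist P (x i)" "dist p' y' = dist P (x (Suc i))"
    "dist q' x' = dist Q (x i)" "dist q' y' = dist Q (x (Suc i))"
    "dihedral p' q' x' y' = dihedral P Q (x i) (x (Suc i))" using labelled_preimage[OF lab[of i]] .
    show "\<exists>p q x' y. {p, q, x', y} = {A, B, C, D} \<and> orient3 p q x' y > 0 \<and> dist p q = dist P Q \<and>
      dist p x' = dist P (x i) \<and> dist q x' = dist Q (x i) \<and> dist p y = dist P (x (Suc i)) \<and>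
      dist q y = dist Q (x (Suc i)) \<and> \<theta> i = dihedral p q x' y"
      by (rule exI[of _ p'], rule exI[of _ q'], rule exI[of _ x'], rule exI[of _ y'])
        (use 1 ori[of i] in \<open>auto simp: \<theta>_def\<close>)
  qed (use n1 x01 xn \<open>\<Phi> n = 2 * pi\<close> in \<open>auto simp: \<Phi>_def \<theta>_def\<close>)
qed

end

section \<open>Combinatorics of the tiles around an edge\<close>

definition even_perms :: "'a \<Rightarrow> 'a \<Rightarrow> 'a \<Rightarrow> 'a \<Rightarrow> ('a \<times> 'a \<times> 'a \<times> 'a) set" where
  "even_perms P Q X Y = {(P, Q, X, Y), (P, X, Y, Q), (P, Y, Q, X), (Q, P, Y, X), (Q, X, P, Y), (Q, Y, X, P),
     (X, P, Q, Y), (X, Q, Y, P), (X, Y, P, Q), (Y, P, X, Q), (Y, Q, P, X), (Y, X, Q, P)}"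

text \<open>Here the preservation of orientation enters: along a walk \<open>orient3\<close> keeps
  its sign, so the labels of the tiles differ by even permutations only.\<close>

abbreviation edge_step where
  "edge_step P Q X Y u v \<theta> i \<equiv> \<exists>(p, q, x, y) \<in> even_perms P Q X Y. dist p q = dist P Q \<and>
     dist p x = u i \<and> dist q x = v i \<and> dist p y = u (Suc i) \<and> dist q y = v (Suc i) \<and> \<theta> i = dihedral p q x y"

lemma orient3_odd_perm:
  "orient3 P Q Y X = - orient3 P Q X Y" "orient3 P X Q Y = - orient3 P Q X Y"
  "orient3 P Y X Q = - orient3 P Q X Y" "orient3 Q P X Y = - orient3 P Q X Y"
  "orient3 Q X Y P = - orient3 P Q X Y" "orient3 Q Y P X = - orient3 P Q X Y"
  "orient3 X P Y Q = - orient3 P Q X Y" "orient3 X Q P Y = - orient3 P Q X Y"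
  "orient3 X Y Q P = - orient3 P Q X Y" "orient3 Y P Q X = - orient3 P Q X Y"
  "orient3 Y Q X P = - orient3 P Q X Y" "orient3 Y X P Q = - orient3 P Q X Y"
  by (metis orient3_perm minus_minus)+

lemma even_perm_of_orient3:
  assumes V: "{p, q, x, y} = {P, Q, X, Y}" and o: "orient3 p q x y * orient3 P Q X Y > 0"
  shows "(p, q, x, y) \<in> even_perms P Q X Y"
proof -
  have o': "\<not> - (orient3 P Q X Y * orient3 P Q X Y) > 0" by (simp add: not_less)
  have ne: "orient3 p q x y \<noteq> 0" using o by auto
  note d = orient3_neq0_independent(3-8)[OF ne]
  have "p \<in> {P, Q, X, Y}" "q \<in> {P, Q, X, Y}" "x \<in> {P, Q, X, Y}" "y \<in> {P, Q, X, Y}" using V by auto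
  then have "(p, q, x, y) \<in> even_perms P Q X Y \<or> orient3 p q x y = - orient3 P Q X Y"
    using d unfolding even_perms_def insert_iff empty_iff
    by (elim disjE) (simp_all add: orient3_odd_perm[where P = P and Q = Q and X = X and Y = Y])
  then show ?thesis using o o' by auto
qed

text \<open>The angle at an edge of length \<open>a\<close>; \<open>b\<close>, \<open>c\<close>
  start at one end of it, \<open>d\<close>, \<open>e\<close> at the other, and \<open>f\<close> is
  opposite. As a function of lengths it lets equal angles be recognised by rewriting, up to the two
  symmetries in \<open>dihF_swap\<close>.\<close>

definition dihF :: "real \<Rightarrow> real \<Rightarrow> real \<Rightarrow> real \<Rightarrow> real \<Rightarrow> real \<Rightarrow> real" where
  "dihF a b c d e f = (let ab = (a\<^sup>2 + b\<^sup>2 - d\<^sup>2) / 2; ac = (a\<^sup>2 + c\<^sup>2 - e\<^sup>2) / 2;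
      bc = (b\<^sup>2 + c\<^sup>2 - f\<^sup>2) / 2
    in arccos ((a\<^sup>2 * bc - ab * ac) / (sqrt (a\<^sup>2 * b\<^sup>2 - ab\<^sup>2) * sqrt (a\<^sup>2 * c\<^sup>2 - ac\<^sup>2))))"

lemma dihedral_dihF:
  "dihedral p q x y = dihF (dist p q) (dist p x) (dist p y) (dist q x) (dist q y) (dist x y)"
  unfolding dihedral_def cos_dihedral_inner inner_dist dihF_def Let_def by simp

lemma dihF_swap:
  "dihF a c b e d f = dihF a b c d e f" "dihF a d e b c f = dihF a b c d e f"
proof -
  show "dihF a c b e d f = dihF a b c d e f"
    unfolding dihF_def Let_def by (simp add: mult.commute add.commute)
  define ab where "ab = (a\<^sup>2 + b\<^sup>2 - d\<^sup>2) / 2"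
  define ac where "ac = (a\<^sup>2 + c\<^sup>2 - e\<^sup>2) / 2"
  have d: "d\<^sup>2 = a\<^sup>2 + b\<^sup>2 - 2 * ab" and e: "e\<^sup>2 = a\<^sup>2 + c\<^sup>2 - 2 * ac" unfolding ab_def ac_def by (simp_all add: field_simps)
  have 1: "(a\<^sup>2 + d\<^sup>2 - b\<^sup>2) / 2 = a\<^sup>2 - ab" "(a\<^sup>2 + e\<^sup>2 - c\<^sup>2) / 2 = a\<^sup>2 - ac" by (simp_all add: d e)
  have 2: "a\<^sup>2 * d\<^sup>2 - (a\<^sup>2 - ab)\<^sup>2 = a\<^sup>2 * b\<^sup>2 - ab\<^sup>2" "a\<^sup>2 * e\<^sup>2 - (a\<^sup>2 - ac)\<^sup>2 = a\<^sup>2 * c\<^sup>2 - ac\<^sup>2"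
    unfolding d e by algebra+
  have 3: "a\<^sup>2 * ((d\<^sup>2 + e\<^sup>2 - f\<^sup>2) / 2) - (a\<^sup>2 - ab) * (a\<^sup>2 - ac) = a\<^sup>2 * ((b\<^sup>2 + c\<^sup>2 - f\<^sup>2) / 2) - ab * ac"
    unfolding d e by (simp add: field_simps power2_eq_square)
  show "dihF a d e b c f = dihF a b c d e f"
    unfolding dihF_def Let_def 1 2 3 ab_def[symmetric] ac_def[symmetric] ..
qed

lemma dihedral_bounds:
  assumes "orient3 p q x y \<noteq> 0"
  shows "0 < dihedral p q x y" "dihedral p q x y < pi" "cos (dihedral p q x y) = cos_dihedral p q x y"
    "-1 < cos_dihedral p q x y" "cos_dihedral p q x y < 1"
proof -
  let ?a = "cross3 (q - p) (x - p)" and ?b = "cross3 (q - p) (y - p)"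
  have "cross3 ?a ?b = orient3 p q x y *\<^sub>R (q - p)"
    unfolding cross_cross_det orient3_def dot_cross_det by (simp add: det_3)
  moreover have "q \<noteq> p" using assms by auto
  ultimately have "cross3 ?a ?b \<noteq> 0" using assms by simp
  then have "(norm (cross3 ?a ?b))\<^sup>2 > 0" by simp
  then have *: "(?a \<bullet> ?b)\<^sup>2 < (norm ?a * norm ?b)\<^sup>2" using norm_cross_dot[of ?a ?b] by linarith
  then have "norm ?a * norm ?b \<noteq> 0" by (metis not_less zero_le_power2 zero_power2)
  then have "(cos_dihedral p q x y)\<^sup>2 < 1" using * unfolding cos_dihedral_def power_divide by simp
  then show c: "-1 < cos_dihedral p q x y" "cos_dihedral p q x y < 1" by (auto simp: abs_square_less_1)
  then show "0 < dihedral p q x y" "dihedral p q x y < pi" "cos (dihedral p q x y) = cos_dihedral p q x y"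
    unfolding dihedral_def using arccos_lt_bounded[OF c] by auto
qed

definition mirror_at :: "real^3 \<Rightarrow> real^3 \<Rightarrow> real^3 \<Rightarrow> real^3 \<Rightarrow> bool" where
  "mirror_at P Q X Y \<longleftrightarrow> dist P X = dist P Y \<and> dist Q X = dist Q Y"

text \<open>The six edges split into the paths X, P, Q, Y and P, Y, X, Q, each with edges of one
  length. Exchanging P with Q and X with Y preserves both.\<close>

definition two_paths :: "real^3 \<Rightarrow> real^3 \<Rightarrow> real^3 \<Rightarrow> real^3 \<Rightarrow> bool" where
  "two_paths P Q X Y \<longleftrightarrow> dist P X = dist P Q \<and> dist Q Y = dist P Q \<and> dist Q X = dist P Y \<and> dist X Y = dist P Y"

text \<open>A choice of two equal sides in each of the four faces gives 81 systems of equations.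
  From each of them a symmetry plane or a pair of paths can be read off.\<close>

lemma isosceles_faces_cases:
  assumes "dist P Q = dist P X \<or> dist P Q = dist Q X \<or> dist P X = dist Q X"
    "dist P Q = dist P Y \<or> dist P Q = dist Q Y \<or> dist P Y = dist Q Y"
    "dist P X = dist P Y \<or> dist P X = dist X Y \<or> dist P Y = dist X Y"
    "dist Q X = dist Q Y \<or> dist Q X = dist X Y \<or> dist Q Y = dist X Y"
  shows "mirror_at P Q X Y \<or> mirror_at P X Q Y \<or> mirror_at P Y Q X \<or>
    mirror_at Q X P Y \<or> mirror_at Q Y P X \<or> mirror_at X Y P Q \<or>
    two_paths P Q X Y \<or> two_paths P Q Y X \<or> two_paths P X Q Y \<or> two_paths P X Y Q \<or>
    two_paths P Y Q X \<or> two_paths P Y X Q \<or> two_paths Q X P Y \<or> two_paths Q X Y P \<or>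
    two_paths Q Y P X \<or> two_paths Q Y X P \<or> two_paths X Y P Q \<or> two_paths X Y Q P"
proof -
  have c: "dist Q P = dist P Q" "dist X P = dist P X" "dist Y P = dist P Y"
    "dist X Q = dist Q X" "dist Y Q = dist Q Y" "dist Y X = dist X Y" by (simp_all add: dist_commute)
  show ?thesis
    using assms unfolding mirror_at_def two_paths_def c by (elim disjE) simp_all
qed

section \<open>What crossing a face reveals about the tile\<close>

context op_tetra_tiling
begin

lemma vertices_orient3:
  assumes "{P, Q, X, Y} = {A, B, C, D}"
  shows "orient3 P Q X Y \<noteq> 0"
  using vertices_perm_orient3[OF assms] nondegenerate by auto

theorem edge_walk:
  assumes V: "{P, Q, X, Y} = {A, B, C, D}"
  obtains n :: nat and u v \<theta> :: "nat \<Rightarrow> real" where "n \<ge> 1"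
    "\<And>i. edge_step P Q X Y u v \<theta> i"
    "u 0 = dist P X" "v 0 = dist Q X" "u 1 = dist P Y" "v 1 = dist Q Y" "\<theta> 0 = dihedral P Q X Y"
    "u n = u 0" "v n = v 0" "(\<Sum>i<n. \<theta> i) = 2 * pi"
proof (cases "orient3 P Q X Y > 0")
  case True
  obtain n u v \<theta> where w: "n \<ge> (1::nat)"
    "\<And>i. turn_step P Q u v \<theta> i"
    "u 0 = dist P X" "v 0 = dist Q X" "u 1 = dist P Y" "v 1 = dist Q Y" "\<theta> 0 = dihedral P Q X Y"
    "u n = u 0" "v n = v 0" "(\<Sum>i<n. \<theta> i) = 2 * pi"
    by (rule edge_walk_pos[OF V True]) (rule that)
  have e: "edge_step P Q X Y u v \<theta> i" for i
  proof -
    obtain p q x y where p: "{p, q, x, y} = {A, B, C, D}" "orient3 p q x y > 0" "dist p q = dist P Q \<and>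
      dist p x = u i \<and> dist q x = v i \<and> dist p y = u (Suc i) \<and> dist q y = v (Suc i) \<and> \<theta> i = dihedral p q x y"
      using w(2)[of i] by blast
    have "(p, q, x, y) \<in> even_perms P Q X Y"
      by (rule even_perm_of_orient3) (use p V True in auto)
    then show ?thesis using p(3) by blast
  qed
  show thesis by (rule that[OF w(1) e w(3-10)])
next
  case False
  \<comment> \<open>Exchanging the ends of the edge makes the orientation positive; \<open>u\<close>
    and \<open>v\<close> trade places in return.\<close>
  have V': "{Q, P, X, Y} = {A, B, C, D}" using V by auto
  have neg: "orient3 P Q X Y < 0" using False vertices_orient3[OF V] by auto
  then have pos: "orient3 Q P X Y > 0" using orient3_perm(1)[of Q P X Y] by simp
  obtain n u v \<theta> where w: "n \<ge> (1::nat)"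
    "\<And>i. turn_step Q P u v \<theta> i"
    "u 0 = dist Q X" "v 0 = dist P X" "u 1 = dist Q Y" "v 1 = dist P Y" "\<theta> 0 = dihedral Q P X Y"
    "u n = u 0" "v n = v 0" "(\<Sum>i<n. \<theta> i) = 2 * pi"
    by (rule edge_walk_pos[OF V' pos]) (rule that)
  have sw: "dihedral q p x y = dihedral p q x y" for p q x y
    unfolding dihedral_dihF dist_commute[of q p] by (rule dihF_swap(2))
  have e: "edge_step P Q X Y v u \<theta> i" for i
  proof -
    obtain p q x y where p: "{p, q, x, y} = {A, B, C, D}" "orient3 p q x y > 0" "dist p q = dist Q P"
      "dist p x = u i" "dist q x = v i" "dist p y = u (Suc i)" "dist q y = v (Suc i)" "\<theta> i = dihedral p q x y"
      using w(2)[of i] by blast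
    have "orient3 q p x y < 0" using p(2) orient3_perm(1)[of q p x y] by simp
    then have "(q, p, x, y) \<in> even_perms P Q X Y"
      by (intro even_perm_of_orient3) (use p V neg in \<open>auto intro: mult_neg_neg\<close>)
    then show ?thesis using p sw[of q p x y] by (intro bexI[of _ "(q, p, x, y)"]) (auto simp: dist_commute)
  qed
  show thesis by (rule that[of n v u \<theta>, OF w(1) e]) (use w sw in auto)
qed

text \<open>In the tile behind the face PQY, the vertex Y takes the place that X had before. If the
  same labels reappear, then X and Y have equal distances from P and Q; every other even permutation
  makes two sides of PQY equal or yields another symmetry plane.\<close>

lemma face_isosceles_or_mirror:
  assumes V: "{P, Q, X, Y} = {A, B, C, D}"
  shows "dist P Q = dist P Y \<or> dist P Q = dist Q Y \<or> dist P Y = dist Q Y \<or>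
    mirror_at P Q X Y \<or> mirror_at P X Q Y \<or> mirror_at P Y Q X \<or>
    mirror_at Q X P Y \<or> mirror_at Q Y P X \<or> mirror_at X Y P Q"
proof -
  obtain n u v \<theta> where w: "n \<ge> (1::nat)" "\<And>i. edge_step P Q X Y u v \<theta> i"
    "u 1 = dist P Y" "v 1 = dist Q Y" by (rule edge_walk[OF V]) (rule that)
  obtain p q x y where p: "(p, q, x, y) \<in> even_perms P Q X Y" "dist p q = dist P Q" "dist p x = dist P Y" "dist q x = dist Q Y"
    using w(2)[of 1] w(3,4) by auto
  have c: "dist Q P = dist P Q" "dist X P = dist P X" "dist Y P = dist P Y"
    "dist X Q = dist Q X" "dist Y Q = dist Q Y" "dist Y X = dist X Y" by (simp_all add: dist_commute)
  show ?thesis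
    using p unfolding even_perms_def mirror_at_def insert_iff empty_iff Pair_inject
    by (elim disjE conjE FalseE) (simp_all add: c)
qed

lemma mirror_or_two_paths:
  obtains P Q X Y where "{P, Q, X, Y} = {A, B, C, D}" "mirror_at P Q X Y"
  | P Q X Y where "{P, Q, X, Y} = {A, B, C, D}" "two_paths P Q X Y" "dist P Q > dist P Y"
proof (cases "\<exists>P Q X Y. {P, Q, X, Y} = {A, B, C, D} \<and> mirror_at P Q X Y")
  case True
  then show thesis using that(1) by blast
next
  case False
  then have nm: "\<not> mirror_at P Q X Y" if "{P, Q, X, Y} = {A, B, C, D}" for P Q X Y using that by blast
  have iso: "dist P Q = dist P Y \<or> dist P Q = dist Q Y \<or> dist P Y = dist Q Y"
    if V: "{P, Q, X, Y} = {A, B, C, D}" for P Q X Y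
  proof -
    have t: "{P, X, Q, Y} = {A, B, C, D}" "{P, Y, Q, X} = {A, B, C, D}" "{Q, X, P, Y} = {A, B, C, D}"
      "{Q, Y, P, X} = {A, B, C, D}" "{X, Y, P, Q} = {A, B, C, D}" unfolding V[symmetric] by blast+
    show ?thesis using face_isosceles_or_mirror[OF V]
        nm[OF V] nm[OF t(1)] nm[OF t(2)] nm[OF t(3)] nm[OF t(4)] nm[OF t(5)] by simp
  qed
  have s: "{A, B, D, C} = {A, B, C, D}" "{A, C, B, D} = {A, B, C, D}" "{A, C, D, B} = {A, B, C, D}"
    "{A, D, B, C} = {A, B, C, D}" "{A, D, C, B} = {A, B, C, D}" "{B, C, A, D} = {A, B, C, D}"
    "{B, C, D, A} = {A, B, C, D}" "{B, D, A, C} = {A, B, C, D}" "{B, D, C, A} = {A, B, C, D}"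
    "{C, D, A, B} = {A, B, C, D}" "{C, D, B, A} = {A, B, C, D}" by blast+
  note f = iso[OF s(1)] iso[OF refl[of "{A, B, C, D}"]] iso[OF s(2)] iso[OF s(6)]
  have "\<exists>P Q X Y. {P, Q, X, Y} = {A, B, C, D} \<and> two_paths P Q X Y"
    using isosceles_faces_cases[OF f] nm[OF refl[of "{A, B, C, D}"]] nm[OF s(2)] nm[OF s(4)] nm[OF s(6)] nm[OF s(8)] nm[OF s(10)]
      s refl[of "{A, B, C, D}"] by metis
  then obtain P Q X Y where V: "{P, Q, X, Y} = {A, B, C, D}" and tp: "two_paths P Q X Y" by blast
  consider "dist P Q > dist P Y" | "dist P Q < dist P Y" | "dist P Q = dist P Y" by linarith
  then show thesis
  proof cases
    case 1 then show thesis using that(2) V tp by blast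
  next
    case 2
    have "{Y, X, P, Q} = {A, B, C, D}" unfolding V[symmetric] by blast
    moreover have "two_paths Y X P Q" "dist Y X > dist Y Q"
      using tp 2 unfolding two_paths_def by (simp_all add: dist_commute)
    ultimately show thesis using that(2) by blast
  next
    case 3
    then have "mirror_at P Q X Y" using tp by (simp add: mirror_at_def two_paths_def)
    then show thesis using nm V by blast
  qed
qed

end

text \<open>In the squared lengths x > y both expressions are rational functions that factor. The
  sign of the first is settled because t > 0 means 2 x < 3 y; the second contains a factor of the
  squared volume and cannot vanish.\<close>

lemma cos_two_paths:
  assumes tp: "two_paths P Q X Y" and o: "orient3 P Q X Y \<noteq> 0" and gt: "dist P Q > dist P Y"
  defines "s \<equiv> cos_dihedral P Q X Y" and "t \<equiv> cos_dihedral P X Q Y"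
  shows "t > 0 \<Longrightarrow> s + (2 * t\<^sup>2 - 1) < 0" "s \<noteq> 2 * t\<^sup>2 - 1"
proof -
  define x where "x = (dist P Q)\<^sup>2"
  define y where "y = (dist P Y)\<^sup>2"
  have b0: "dist P Y > 0" using o by auto
  have y: "y > 0" using b0 by (simp add: y_def)
  have xy: "x > y" unfolding x_def y_def using gt b0 by (intro power_strict_mono) auto
  have d: "(dist P X)\<^sup>2 = x" "(dist Q Y)\<^sup>2 = x" "(dist Q X)\<^sup>2 = y" "(dist X Y)\<^sup>2 = y"
    "(dist X Q)\<^sup>2 = y" "(dist P Q)\<^sup>2 = x" "(dist P Y)\<^sup>2 = y"
    using tp unfolding two_paths_def x_def y_def by (simp_all add: dist_commute)
  have ip: "(Q - P) \<bullet> (Q - P) = x" "(X - P) \<bullet> (X - P) = x" "(Y - P) \<bullet> (Y - P) = y"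
    "(Q - P) \<bullet> (X - P) = x - y/2" "(X - P) \<bullet> (Q - P) = x - y/2" "(Q - P) \<bullet> (Y - P) = y/2"
    "(X - P) \<bullet> (Y - P) = x/2"
    unfolding inner_dist d by (simp_all add: field_simps)
  have "(orient3 P Q X Y)\<^sup>2 = (x + y) * (3 * x * y - x\<^sup>2 - y\<^sup>2) / 4"
    unfolding orient3_def triple_square ip by (simp add: field_simps power2_eq_square)
  moreover have "(orient3 P Q X Y)\<^sup>2 > 0" using o by simp
  ultimately have "(x + y) * (3 * x * y - x\<^sup>2 - y\<^sup>2) > 0" by linarith
  then have nd: "3 * x * y - x\<^sup>2 - y\<^sup>2 > 0" using xy y by (simp add: zero_less_mult_iff)
  define N where "N = x * y - y\<^sup>2 / 4"
  define M where "M = x * y - x\<^sup>2 / 4"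
  have "y * y < x * y" using xy y by simp
  then have N: "N > 0" using y by (simp add: N_def power2_eq_square)
  have "x * y > 0" using xy y by simp
  then have M: "M > 0" using nd zero_le_power2[of y] unfolding M_def by linarith
  have s: "s = (x\<^sup>2 / 2 - x * y / 2 + y\<^sup>2 / 4) / N"
  proof -
    have "x * x - (x - y/2)\<^sup>2 = N" "x * y - (y/2)\<^sup>2 = N" "x * (x/2) - (x - y/2) * (y/2) = x\<^sup>2 / 2 - x * y / 2 + y\<^sup>2 / 4"
      by (simp_all add: N_def power2_eq_square field_simps)
    then show ?thesis unfolding s_def cos_dihedral_inner ip using N by simp
  qed
  have t: "t = (3 * x * y / 4 - x\<^sup>2 / 2) / (sqrt N * sqrt M)"
  proof -
    have "x * x - (x - y/2)\<^sup>2 = N" "x * y - (x/2)\<^sup>2 = M" "x * (y/2) - (x - y/2) * (x/2) = 3 * x * y / 4 - x\<^sup>2 / 2"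
      by (simp_all add: N_def M_def power2_eq_square field_simps)
    then show ?thesis unfolding t_def cos_dihedral_inner ip by simp
  qed
  have t2: "t\<^sup>2 = (3 * x * y / 4 - x\<^sup>2 / 2)\<^sup>2 / (N * M)"
    unfolding t power_divide power_mult_distrib using N M by simp
  have e: "s + (2 * t\<^sup>2 - 1) = (x / 8) * (x - 2 * y) * (3 * x - 2 * y) * (x + y) / (N * M)"
  proof -
    have "s + (2 * t\<^sup>2 - 1) = ((x\<^sup>2 / 2 - x * y / 2 + y\<^sup>2 / 4) * M + 2 * (3 * x * y / 4 - x\<^sup>2 / 2)\<^sup>2 - N * M) / (N * M)"
      unfolding s t2 using N M by (simp add: field_simps)
    also have "(x\<^sup>2 / 2 - x * y / 2 + y\<^sup>2 / 4) * M + 2 * (3 * x * y / 4 - x\<^sup>2 / 2)\<^sup>2 - N * M =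
      (x / 8) * (x - 2 * y) * (3 * x - 2 * y) * (x + y)"
      unfolding N_def M_def by (simp add: field_simps power2_eq_square)
    finally show ?thesis .
  qed
  show "s + (2 * t\<^sup>2 - 1) < 0" if "t > 0"
  proof -
    have "sqrt N * sqrt M > 0" using N M by simp
    then have "3 * x * y / 4 - x\<^sup>2 / 2 > 0" using that unfolding t by (simp only: zero_less_divide_iff) linarith
    then have "x * (3 * y - 2 * x) > 0" by (simp add: power2_eq_square algebra_simps)
    then have "3 * y > 2 * x" using xy y by (simp add: zero_less_mult_iff)
    then have "(x / 8) * (x - 2 * y) * (3 * x - 2 * y) * (x + y) < 0"
      using xy y by (intro mult_neg_pos mult_pos_neg) auto
    then show ?thesis unfolding e using N M by (simp add: divide_neg_pos)
  qed
  show "s \<noteq> 2 * t\<^sup>2 - 1"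
  proof
    assume eq: "s = 2 * t\<^sup>2 - 1"
    have "s - (2 * t\<^sup>2 - 1) = ((x\<^sup>2 / 2 - x * y / 2 + y\<^sup>2 / 4) * M - 2 * (3 * x * y / 4 - x\<^sup>2 / 2)\<^sup>2 + N * M) / (N * M)"
      unfolding s t2 using N M by (simp add: field_simps)
    also have "(x\<^sup>2 / 2 - x * y / 2 + y\<^sup>2 / 4) * M - 2 * (3 * x * y / 4 - x\<^sup>2 / 2)\<^sup>2 + N * M =
      5/8 * x\<^sup>2 * (3 * x * y - x\<^sup>2 - y\<^sup>2)"
      unfolding N_def M_def by (simp add: field_simps power2_eq_square)
    finally have "5/8 * x\<^sup>2 * (3 * x * y - x\<^sup>2 - y\<^sup>2) / (N * M) = 0" using eq by simp
    then show False using N M nd xy y by simp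
  qed
qed

text \<open>The square of \<open>orient3\<close> is 36 times the squared volume, so 288 * sqrt 2
  becomes 8 * sqrt 2. Both sides scale with the sixth power of length.\<close>

definition isoper_bound :: "real^3 \<Rightarrow> real^3 \<Rightarrow> real^3 \<Rightarrow> real^3 \<Rightarrow> bool" where
  "isoper_bound A B C D \<longleftrightarrow> (tetra_surface_area A B C D)^3 \<ge> 8 * sqrt 2 * (orient3 A B C D)\<^sup>2"

lemma tri_area_swap: "tri_area b a c = tri_area a b c" "tri_area a c b = tri_area a b c"
proof -
  have "cross3 (a - b) (c - b) = - cross3 (b - a) (c - a)"
    unfolding cross3_def vec_eq_iff forall_3 vector_3 uminus_vec_def by (simp add: algebra_simps)
  then show "tri_area b a c = tri_area a b c" by (simp add: tri_area_def)
  show "tri_area a c b = tri_area a b c" unfolding tri_area_def by (subst cross_skew) simp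
qed

lemma isoper_bound_perm:
  "isoper_bound B A C D \<longleftrightarrow> isoper_bound A B C D"
  "isoper_bound A C B D \<longleftrightarrow> isoper_bound A B C D"
  "isoper_bound A B D C \<longleftrightarrow> isoper_bound A B C D"
proof -
  show "isoper_bound B A C D \<longleftrightarrow> isoper_bound A B C D"
    unfolding isoper_bound_def tetra_surface_area_def orient3_perm(1)[of B A]
      tri_area_swap(1)[of B A] by (simp add: add_ac)
  show "isoper_bound A C B D \<longleftrightarrow> isoper_bound A B C D"
    unfolding isoper_bound_def tetra_surface_area_def orient3_perm(2)[of A C B D]
      tri_area_swap(2)[of A C B] tri_area_swap(1)[of C B D] by (simp add: add_ac)
  show "isoper_bound A B D C \<longleftrightarrow> isoper_bound A B C D"
    unfolding isoper_bound_def tetra_surface_area_def orient3_perm(3)[of A B D C]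
      tri_area_swap(2)[of A D C] tri_area_swap(2)[of B D C] by (simp add: add_ac)
qed

lemma isoper_bound_relabel:
  assumes V: "{P, Q, X, Y} = {A, B, C, D}" and o: "orient3 P Q X Y \<noteq> 0"
    and b: "isoper_bound P Q X Y"
  shows "isoper_bound A B C D"
proof -
  have all: "isoper_bound P Q X Y" "isoper_bound P Q Y X" "isoper_bound P X Q Y" "isoper_bound P X Y Q"
    "isoper_bound P Y Q X" "isoper_bound P Y X Q" "isoper_bound Q P X Y" "isoper_bound Q P Y X"
    "isoper_bound Q X P Y" "isoper_bound Q X Y P" "isoper_bound Q Y P X" "isoper_bound Q Y X P"
    "isoper_bound X P Q Y" "isoper_bound X P Y Q" "isoper_bound X Q P Y" "isoper_bound X Q Y P"
    "isoper_bound X Y P Q" "isoper_bound X Y Q P" "isoper_bound Y P Q X" "isoper_bound Y P X Q"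
    "isoper_bound Y Q P X" "isoper_bound Y Q X P" "isoper_bound Y X P Q" "isoper_bound Y X Q P"
    using b isoper_bound_perm by metis+
  have "card {A, B, C, D} = 4" using orient3_neq0_independent(2)[OF o] V by simp
  then have d: "A \<noteq> B" "A \<noteq> C" "A \<noteq> D" "B \<noteq> C" "B \<noteq> D" "C \<noteq> D"
    by (auto simp: card_insert_if split: if_splits)
  have "A \<in> {P, Q, X, Y}" "B \<in> {P, Q, X, Y}" "C \<in> {P, Q, X, Y}" "D \<in> {P, Q, X, Y}" using V by auto
  then show ?thesis using d all unfolding insert_iff empty_iff
    by (elim disjE) simp_all
qed

section \<open>From angle conditions to the isoperimetric bound\<close>

context
  fixes P Q X Y :: "real^3"
  assumes o: "orient3 P Q X Y \<noteq> 0" and mir: "mirror_at P Q X Y"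
begin

lemma mirror_params:
  obtains c \<alpha> \<beta> \<gamma> W where "mirror_shape \<alpha> \<beta> \<gamma> W" "c > 0"
    "shape_bound \<alpha> \<beta> \<gamma> W \<Longrightarrow> isoper_bound P Q X Y"
    "(dist P X)\<^sup>2 = c\<^sup>2 * (1 + \<alpha>\<^sup>2)" "(dist Q X)\<^sup>2 = c\<^sup>2 * (1 + \<beta>\<^sup>2)"
    "(dist P Q)\<^sup>2 = c\<^sup>2 * (\<alpha>\<^sup>2 + \<beta>\<^sup>2 - 2 * \<alpha> * \<beta> * \<gamma>)" "dist X Y = 2 * c"
    "cos_dihedral X Y P Q = \<gamma>"
    "cos_dihedral P X Q Y = (\<alpha> - \<beta> * \<gamma>) / W" "cos_dihedral Q X P Y = (\<beta> - \<alpha> * \<gamma>) / W"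
    "cos_dihedral P Q X Y = ((\<alpha> * \<beta>)\<^sup>2 * (1 - \<gamma>\<^sup>2) - (\<alpha>\<^sup>2 + \<beta>\<^sup>2 - 2 * \<alpha> * \<beta> * \<gamma>)) / W\<^sup>2"
proof -
  obtain c \<alpha> \<beta> \<gamma> W where m: "mirror_shape \<alpha> \<beta> \<gamma> W" "c > 0"
    "tetra_surface_area P Q X Y = c\<^sup>2 * (\<alpha> + \<beta> + W)"
    "(orient3 P Q X Y)\<^sup>2 = 4 * c^6 * ((\<alpha> * \<beta>)\<^sup>2 * (1 - \<gamma>\<^sup>2))"
    "(dist P X)\<^sup>2 = c\<^sup>2 * (1 + \<alpha>\<^sup>2)" "(dist Q X)\<^sup>2 = c\<^sup>2 * (1 + \<beta>\<^sup>2)"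
    "(dist P Q)\<^sup>2 = c\<^sup>2 * (\<alpha>\<^sup>2 + \<beta>\<^sup>2 - 2 * \<alpha> * \<beta> * \<gamma>)" "dist X Y = 2 * c"
    "cos_dihedral X Y P Q = \<gamma>"
    "cos_dihedral P X Q Y = (\<alpha> - \<beta> * \<gamma>) / W" "cos_dihedral Q X P Y = (\<beta> - \<alpha> * \<gamma>) / W"
    "cos_dihedral P Q X Y = ((\<alpha> * \<beta>)\<^sup>2 * (1 - \<gamma>\<^sup>2) - (\<alpha>\<^sup>2 + \<beta>\<^sup>2 - 2 * \<alpha> * \<beta> * \<gamma>)) / W\<^sup>2"
    by (rule mirror_tetrahedron[OF o]) (use mir in \<open>auto simp: mirror_at_def\<close>)
  have "isoper_bound P Q X Y" if "shape_bound \<alpha> \<beta> \<gamma> W"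
  proof -
    have "c^6 * (32 * sqrt 2 * (\<alpha> * \<beta>)\<^sup>2 * (1 - \<gamma>\<^sup>2)) \<le> c^6 * (\<alpha> + \<beta> + W)^3"
      using that by (intro mult_left_mono) auto
    also have "c^6 * (\<alpha> + \<beta> + W)^3 = (c\<^sup>2 * (\<alpha> + \<beta> + W))^3" by (simp add: power_mult_distrib flip: power_mult)
    finally show ?thesis unfolding isoper_bound_def m(3,4) by (simp add: mult_ac)
  qed
  then show thesis by (rule that[OF m(1,2) _ m(5-12)])
qed

lemma bound_60_60:
  assumes "cos_dihedral P X Q Y \<ge> 1/2" "cos_dihedral Q X P Y \<ge> 1/2"
  shows "isoper_bound P Q X Y"
proof -
  obtain c \<alpha> \<beta> \<gamma> W where m: "mirror_shape \<alpha> \<beta> \<gamma> W"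
    "shape_bound \<alpha> \<beta> \<gamma> W \<Longrightarrow> isoper_bound P Q X Y"
    "cos_dihedral P X Q Y = (\<alpha> - \<beta> * \<gamma>) / W" "cos_dihedral Q X P Y = (\<beta> - \<alpha> * \<gamma>) / W"
    by (rule mirror_params) (rule that)
  interpret mirror_shape \<alpha> \<beta> \<gamma> W by fact
  show ?thesis by (rule m(2), rule area_bound_60_60) (use assms W in \<open>auto simp: m(3,4) field_simps\<close>)
qed

lemma bound_60_90:
  assumes "cos_dihedral P X Q Y \<ge> 1/2" "cos_dihedral Q X P Y = 0"
  shows "isoper_bound P Q X Y"
proof -
  obtain c \<alpha> \<beta> \<gamma> W where m: "mirror_shape \<alpha> \<beta> \<gamma> W"
    "shape_bound \<alpha> \<beta> \<gamma> W \<Longrightarrow> isoper_bound P Q X Y"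
    "cos_dihedral P X Q Y = (\<alpha> - \<beta> * \<gamma>) / W" "cos_dihedral Q X P Y = (\<beta> - \<alpha> * \<gamma>) / W"
    by (rule mirror_params) (rule that)
  interpret mirror_shape \<alpha> \<beta> \<gamma> W by fact
  show ?thesis by (rule m(2), rule area_bound_60_90) (use assms W in \<open>auto simp: m(3,4) field_simps\<close>)
qed

text \<open>Two right angles give \<alpha> = \<beta>\<gamma> and \<beta> = \<alpha>\<gamma>, hence
  \<gamma>^2 = 1, and the faces at XY would be coplanar.\<close>

lemma not_90_90:
  assumes "cos_dihedral P X Q Y = 0" "cos_dihedral Q X P Y = 0"
  shows False
proof -
  obtain c \<alpha> \<beta> \<gamma> W where m: "mirror_shape \<alpha> \<beta> \<gamma> W"
    "cos_dihedral P X Q Y = (\<alpha> - \<beta> * \<gamma>) / W" "cos_dihedral Q X P Y = (\<beta> - \<alpha> * \<gamma>) / W"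
    by (rule mirror_params) (rule that)
  interpret mirror_shape \<alpha> \<beta> \<gamma> W by fact
  have "\<alpha> = \<beta> * \<gamma>" "\<beta> = \<alpha> * \<gamma>" using assms W m by auto
  then have "\<alpha> * (1 - \<gamma>\<^sup>2) = 0" by (simp add: power2_eq_square algebra_simps)
  then show False using \<alpha> C2 by auto
qed

lemma bound_equilateral_face:
  assumes "dist P X = dist X Y" "cos_dihedral Q X P Y = 0 \<or> cos_dihedral Q X P Y \<ge> 1/2"
  shows "isoper_bound P Q X Y"
proof -
  obtain c \<alpha> \<beta> \<gamma> W where m: "mirror_shape \<alpha> \<beta> \<gamma> W" "c > 0"
    "shape_bound \<alpha> \<beta> \<gamma> W \<Longrightarrow> isoper_bound P Q X Y"
    "(dist P X)\<^sup>2 = c\<^sup>2 * (1 + \<alpha>\<^sup>2)" "dist X Y = 2 * c" "cos_dihedral Q X P Y = (\<beta> - \<alpha> * \<gamma>) / W"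
    by (rule mirror_params) (rule that)
  interpret mirror_shape \<alpha> \<beta> \<gamma> W by fact
  have "c\<^sup>2 * (1 + \<alpha>\<^sup>2) = c\<^sup>2 * 4" using m(4,5) assms(1) by (simp add: power_mult_distrib)
  then have "\<alpha>\<^sup>2 = 3" using m(2) by simp
  then have a3: "\<alpha> = sqrt 3" using \<alpha> by (metis less_eq_real_def real_sqrt_unique)
  from assms(2) show ?thesis
  proof
    assume "cos_dihedral Q X P Y = 0"
    then have "\<beta> = \<alpha> * \<gamma>" using W m(6) by auto
    then show ?thesis by (intro m(3) area_bound_equilateral_90 a3)
  next
    assume "cos_dihedral Q X P Y \<ge> 1/2"
    then have "2 * (\<beta> - \<alpha> * \<gamma>) \<ge> W" using W by (simp add: m(6) field_simps)
    then show ?thesis by (intro m(3) area_bound_equilateral_60 a3)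
  qed
qed

text \<open>P is equidistant from the other vertices, which reads 1 = \<beta>^2 -
  2\<alpha>\<beta>\<gamma> and excludes a right angle at QX. A right angle at XY then means \<beta>
  = 1, while a sharp one makes the lateral area over the base QXY small.\<close>

lemma bound_pyramid:
  assumes "dist P X = dist P Q" "cos_dihedral Q X P Y = 0 \<or> cos_dihedral Q X P Y \<ge> 1/2"
    "cos_dihedral X Y P Q = 0 \<or> cos_dihedral X Y P Q \<ge> 1/2"
  shows "isoper_bound P Q X Y"
proof -
  obtain c \<alpha> \<beta> \<gamma> W where m: "mirror_shape \<alpha> \<beta> \<gamma> W" "c > 0"
    "shape_bound \<alpha> \<beta> \<gamma> W \<Longrightarrow> isoper_bound P Q X Y"
    "(dist P X)\<^sup>2 = c\<^sup>2 * (1 + \<alpha>\<^sup>2)" "(dist P Q)\<^sup>2 = c\<^sup>2 * (\<alpha>\<^sup>2 + \<beta>\<^sup>2 - 2 * \<alpha> * \<beta> * \<gamma>)"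
    "cos_dihedral X Y P Q = \<gamma>" "cos_dihedral Q X P Y = (\<beta> - \<alpha> * \<gamma>) / W"
    by (rule mirror_params) (rule that)
  interpret mirror_shape \<alpha> \<beta> \<gamma> W by fact
  interpret sw: mirror_shape \<beta> \<alpha> \<gamma> W by (rule swap)
  have "c\<^sup>2 * (1 + \<alpha>\<^sup>2) = c\<^sup>2 * (\<alpha>\<^sup>2 + \<beta>\<^sup>2 - 2 * \<alpha> * \<beta> * \<gamma>)" using m(4,5) assms(1) by simp
  then have rp: "1 = \<beta>\<^sup>2 - 2 * \<alpha> * \<beta> * \<gamma>" using m(2) by simp
  have "cos_dihedral Q X P Y \<noteq> 0"
  proof
    assume "cos_dihedral Q X P Y = 0"
    then have "\<alpha> * \<gamma> = \<beta>" using W m(7) by auto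
    then have "2 * \<alpha> * \<beta> * \<gamma> = 2 * \<beta>\<^sup>2" by (simp add: power2_eq_square mult_ac)
    then show False using rp zero_le_power2[of \<beta>] by linarith
  qed
  then have "cos_dihedral Q X P Y \<ge> 1/2" using assms(2) by auto
  then have t: "2 * (\<beta> - \<alpha> * \<gamma>) \<ge> W" using W by (simp add: m(7) field_simps)
  from assms(3) show ?thesis
  proof
    assume "cos_dihedral X Y P Q = 0"
    then have "\<beta>\<^sup>2 = 1" using rp m(6) by simp
    then have "\<beta> = 1" using \<beta> by (simp add: power2_eq_1_iff)
    then show ?thesis using sw.area_bound_unit by (intro m(3)) (simp add: mult.commute add_ac)
  next
    assume "cos_dihedral X Y P Q \<ge> 1/2"
    then have "\<alpha> * (1/2) \<le> \<alpha> * \<gamma>" using \<alpha> m(6) by (intro mult_left_mono) auto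
    then have "\<alpha> + W \<le> 2 * \<beta>" using t by simp
    then show ?thesis using sw.area_bound_low by (intro m(3)) (simp add: mult.commute add_ac)
  qed
qed

end

lemma even_card_flips: "even (card {i. i < n \<and> K i \<noteq> K (Suc i)}) \<longleftrightarrow> (K n \<longleftrightarrow> K (0::nat))"
proof (induction n)
  case (Suc n)
  have "{i. i < Suc n \<and> K i \<noteq> K (Suc i)} = (if K n \<noteq> K (Suc n) then insert n {i. i < n \<and> K i \<noteq> K (Suc i)}
      else {i. i < n \<and> K i \<noteq> K (Suc i)})"
    by (auto simp: less_Suc_eq)
  then show ?case using Suc.IH by auto
qed simp

section \<open>Angles forced by the walks\<close>

context op_tetra_tiling
begin

text \<open>Around an edge of the longer length the types of the shared faces have period three, so a
  multiple of \<open>\<theta>\<^sub>1 + 2 \<theta>\<^sub>2\<close> is a full turn. But \<open>\<pi> < \<theta>\<^sub>1 + 2 \<theta>\<^sub>2\<close> and \<open>\<theta>\<^sub>1 + 2 \<theta>\<^sub>2 \<noteq> 2 \<pi>\<close>.\<close>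

lemma two_paths_impossible:
  assumes V: "{P, Q, X, Y} = {A, B, C, D}" and tp: "two_paths P Q X Y" and gt: "dist P Q > dist P Y"
  shows False
proof -
  define a b where "a = dist P Q" and "b = dist P Y"
  have ab: "a \<noteq> b" "b \<noteq> a" using gt by (auto simp: a_def b_def)
  have d: "dist P Q = a" "dist Q P = a" "dist P X = a" "dist X P = a" "dist Q Y = a" "dist Y Q = a"
    "dist P Y = b" "dist Y P = b" "dist Q X = b" "dist X Q = b" "dist X Y = b" "dist Y X = b"
    using tp unfolding two_paths_def a_def b_def by (simp_all add: dist_commute)
  obtain n u v \<theta> where w: "n \<ge> (1::nat)"
    "\<And>i. edge_step P Q X Y u v \<theta> i"
    "u 0 = dist P X" "v 0 = dist Q X"
    "u n = u 0" "v n = v 0" "(\<Sum>i<n. \<theta> i) = 2 * pi"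
    by (rule edge_walk[OF V]) (rule that)
  define t1 t2 where "t1 = dihF a a b b a b" and "t2 = dihF a a b b b a"
  have sw: "dihF a b a b b a = t2" "dihF a b b a b a = t2"
    unfolding t2_def using dihF_swap[of a a b b b a] by auto
  note D = dihedral_dihF d t1_def[symmetric] t2_def[symmetric] sw
  have step: "(u i = a \<and> v i = b \<and> u (Suc i) = b \<and> v (Suc i) = a \<and> \<theta> i = t1) \<or>
     (u i = b \<and> v i = a \<and> u (Suc i) = b \<and> v (Suc i) = b \<and> \<theta> i = t2) \<or>
     (u i = b \<and> v i = b \<and> u (Suc i) = a \<and> v (Suc i) = b \<and> \<theta> i = t2)" for i
  proof -
    obtain p q x y where p: "(p, q, x, y) \<in> even_perms P Q X Y" "dist p q = dist P Q"
      "u i = dist p x" "v i = dist q x" "u (Suc i) = dist p y" "v (Suc i) = dist q y" "\<theta> i = dihedral p q x y"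
      using w(2)[of i] by (auto simp: eq_commute)
    show ?thesis
      using p(1,2) unfolding p(3-7) even_perms_def insert_iff empty_iff prod.inject
      by (elim disjE conjE FalseE) (simp_all add: D ab)
  qed
  have per: "u (3 * k) = a \<and> v (3 * k) = b \<and> (\<Sum>i<3 * k. \<theta> i) = real k * (t1 + 2 * t2)" for k
  proof (induction k)
    case 0
    then show ?case using w(3,4) d by simp
  next
    case (Suc k)
    have 1: "u (3*k + 1) = b" "v (3*k + 1) = a" "\<theta> (3*k) = t1" using step[of "3*k"] Suc ab by auto
    have 2: "u (3*k + 2) = b" "v (3*k + 2) = b" "\<theta> (3*k + 1) = t2" using step[of "3*k + 1"] 1 ab by auto
    have 3: "u (3*k + 3) = a" "v (3*k + 3) = b" "\<theta> (3*k + 2) = t2" using step[of "3*k + 2"] 2 ab by (auto simp: numeral_3_eq_3)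
    have s3: "3 * Suc k = Suc (Suc (Suc (3 * k)))" by simp
    have "(\<Sum>i<3 * Suc k. \<theta> i) = real (Suc k) * (t1 + 2 * t2)"
      unfolding s3 sum.lessThan_Suc using Suc 1 2 3 by (simp add: algebra_simps)
    then show ?case using 3 by (simp add: add.commute)
  qed
  have un: "u n = a" "v n = b" using w d by auto
  obtain k where k: "n = 3 * k"
  proof -
    define k where "k = n div 3"
    have "n = 3 * k \<or> n = 3 * k + 1 \<or> n = 3 * k + 2" unfolding k_def by presburger
    moreover have 1: "u (3*k + 1) = b" "v (3*k + 1) = a" using step[of "3*k"] per[of k] ab by auto
    moreover have "u (3*k + 2) = b" using step[of "3*k + 1"] 1 ab by auto
    ultimately have "n = 3 * k" using un ab by auto
    then show thesis by (rule that)
  qed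
  have k1: "k \<ge> 1" using w(1) k by simp
  have sum: "real k * (t1 + 2 * t2) = 2 * pi" using per[of k] w(7) k by simp
  have o: "orient3 P Q X Y \<noteq> 0" by (rule vertices_orient3[OF V])
  have o2: "orient3 P X Q Y \<noteq> 0" using o orient3_perm(2)[of P X Q Y] by simp
  have t1: "t1 = dihedral P Q X Y" and t2: "t2 = dihedral P X Q Y" by (simp_all only: D)
  note b1 = dihedral_bounds[OF o, folded t1] and b2 = dihedral_bounds[OF o2, folded t2]
  have cos2: "cos (2 * t2) = 2 * (cos_dihedral P X Q Y)\<^sup>2 - 1" using b2(3) by (simp add: cos_double_cos)
  note c = cos_two_paths[OF tp o gt]
  show False
  proof (cases "k = 1")
    case True
    then have "t1 = 2 * pi - 2 * t2" using sum by simp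
    then have "cos t1 = cos (2 * t2)" by simp
    then show False using c(2) cos2 b1(3) by simp
  next
    case False
    then have "2 * (t1 + 2 * t2) \<le> real k * (t1 + 2 * t2)" using k1 b1(1) b2(1) by (intro mult_right_mono) auto
    then have le: "t1 + 2 * t2 \<le> pi" using sum by simp
    then have "t2 < pi / 2" using b1(1) by simp
    then have "cos_dihedral P X Q Y > 0" using b2 cos_gt_zero[of t2] by simp
    moreover have "cos (pi - 2 * t2) \<le> cos t1" using le b1(1,2) b2(1) by (intro cos_monotone_0_pi_le) auto
    then have "cos t1 + cos (2 * t2) \<ge> 0" by simp
    ultimately show False using c(1) cos2 b1(3) by auto
  qed
qed

text \<open>\<open>K\<close> has to tell the two faces at the edge apart by the distances of their
  free vertex, and to do so in every even placement of the tile that shows an edge of the same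
  length.\<close>

lemma alternating_edge:
  assumes V: "{P, Q, X, Y} = {A, B, C, D}"
    and H: "\<And>p q x y. (p, q, x, y) \<in> even_perms P Q X Y \<Longrightarrow> dist p q = dist P Q \<Longrightarrow>
      (K (dist p x) (dist q x) \<longleftrightarrow> \<not> K (dist p y) (dist q y)) \<and> dihedral p q x y = dihedral P Q X Y"
  shows "cos_dihedral P Q X Y = 0 \<or> cos_dihedral P Q X Y \<ge> 1/2"
proof -
  obtain n u v \<theta> where w: "n \<ge> (1::nat)"
    "\<And>i. edge_step P Q X Y u v \<theta> i"
    "u n = u 0" "v n = v 0" "(\<Sum>i<n. \<theta> i) = 2 * pi"
    by (rule edge_walk[OF V]) (rule that)
  define t where "t = dihedral P Q X Y"
  have step: "(K (u i) (v i) \<longleftrightarrow> \<not> K (u (Suc i)) (v (Suc i))) \<and> \<theta> i = t" for i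
  proof -
    obtain p q x y where p: "(p, q, x, y) \<in> even_perms P Q X Y" "dist p q = dist P Q"
      "u i = dist p x" "v i = dist q x" "u (Suc i) = dist p y" "v (Suc i) = dist q y" "\<theta> i = dihedral p q x y"
      using w(2)[of i] by (auto simp: eq_commute)
    show ?thesis unfolding p(3-7) t_def by (rule H[OF p(1,2)])
  qed
  have flip: "K (u i) (v i) \<noteq> K (u (Suc i)) (v (Suc i))" and th: "\<theta> i = t" for i
    using step[of i] by blast+
  have "even (card {i. i < n \<and> K (u i) (v i) \<noteq> K (u (Suc i)) (v (Suc i))})"
    using even_card_flips[of n "\<lambda>i. K (u i) (v i)"] w(3,4) by simp
  also have "{i. i < n \<and> K (u i) (v i) \<noteq> K (u (Suc i)) (v (Suc i))} = {..<n}" using flip by blast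
  finally obtain m where m: "n = 2 * m" by (auto elim: evenE)
  have mt: "real m * t = pi" using w(5) th by (simp add: m)
  note b = dihedral_bounds[OF vertices_orient3[OF V], folded t_def]
  have "m \<noteq> 0" using mt pi_neq_zero by (intro notI) simp
  moreover have "m \<noteq> 1" using mt b(2) by auto
  ultimately consider "m = 2" | "m \<ge> 3" by linarith
  then show ?thesis
  proof cases
    case 1
    then have "t = pi / 2" using mt by simp
    then have "cos t = 0" by (simp only: cos_pi_half)
    then show ?thesis using b(3) by simp
  next
    case 2
    then have "3 * t \<le> real m * t" using b(1) by (intro mult_right_mono) auto
    then have "t \<le> pi / 3" using mt by simp
    then have "cos (pi / 3) \<le> cos t" using b(1) pi_gt_zero by (intro cos_monotone_0_pi_le) auto
    then show ?thesis using b(3) by (simp add: cos_60)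
  qed
qed

lemma constant_edge:
  assumes V: "{P, Q, X, Y} = {A, B, C, D}"
    and H: "\<And>p q x y. (p, q, x, y) \<in> even_perms P Q X Y \<Longrightarrow> dist p q = dist P Q \<Longrightarrow>
      dihedral p q x y = dihedral P Q X Y"
  obtains n :: nat where "n \<ge> 1" "real n * dihedral P Q X Y = 2 * pi"
proof -
  obtain n u v \<theta> where w: "n \<ge> (1::nat)"
    "\<And>i. edge_step P Q X Y u v \<theta> i"
    "(\<Sum>i<n. \<theta> i) = 2 * pi"
    by (rule edge_walk[OF V]) (rule that)
  have "\<theta> i = dihedral P Q X Y" for i
  proof -
    obtain p q x y where p: "(p, q, x, y) \<in> even_perms P Q X Y" "dist p q = dist P Q" "\<theta> i = dihedral p q x y"
      using w(2)[of i] by auto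
    show ?thesis unfolding p(3) by (rule H[OF p(1,2)])
  qed
  then show thesis using that[of n] w by simp
qed

context
  fixes P Q X Y :: "real^3" and r t p q :: real
  assumes V: "{P, Q, X, Y} = {A, B, C, D}"
    and d: "dist P X = r" "dist P Y = r" "dist Q X = t" "dist Q Y = t" "dist P Q = p" "dist X Y = q"
begin

lemma distances:
  "dist P X = r" "dist P Y = r" "dist Q X = t" "dist Q Y = t" "dist P Q = p" "dist X Y = q"
  "dist X P = r" "dist Y P = r" "dist X Q = t" "dist Y Q = t" "dist Q P = p" "dist Y X = q"
  using d by (simp_all add: dist_commute)

lemma relabel: "{Q, P, X, Y} = {A, B, C, D}" "{Q, X, P, Y} = {A, B, C, D}" "{P, X, Q, Y} = {A, B, C, D}"
  "{X, Y, P, Q} = {A, B, C, D}"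
  unfolding V[symmetric] by blast+

text \<open>Only QX and QY have length \<open>t\<close>. Of the faces at QX, the face QXY has a
  second side of this length and PQX has none.\<close>

lemma right_or_sharp_side:
  assumes "t \<noteq> p" "t \<noteq> q" "t \<noteq> r"
  shows "cos_dihedral Q X P Y = 0 \<or> cos_dihedral Q X P Y \<ge> 1/2"
proof (rule alternating_edge[OF relabel(2), where K = "\<lambda>m n. m = t \<or> n = t"])
  have sw: "dihF t t p q r r = dihF t p t r q r" "dihF t r q p t r = dihF t p t r q r" "dihF t q r t p r = dihF t p t r q r"
    using dihF_swap[of t p t r q r] dihF_swap[of t t p q r r] by auto
  fix p' q' x' y'
  assume "(p', q', x', y') \<in> even_perms Q X P Y" "dist p' q' = dist Q X"
  then show "((dist p' x' = t \<or> dist q' x' = t) \<longleftrightarrow> \<not> (dist p' y' = t \<or> dist q' y' = t)) \<and>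
      dihedral p' q' x' y' = dihedral Q X P Y"
    unfolding even_perms_def insert_iff empty_iff prod.inject dihedral_dihF
    using assms by (elim disjE conjE FalseE) (simp_all add: distances sw)
qed

text \<open>Four edges have length \<open>t\<close>. If \<open>p\<close> and \<open>q\<close>
  differ, then \<open>p\<close> occurs in just one of the two faces. If they agree, the faces are
  congruent, and \<open>K\<close> asks at which end of the edge the exceptional side starts; even
  placements keep this answer alternating.\<close>

lemma right_or_sharp_sides:
  assumes "r = t" "t \<noteq> p" "t \<noteq> q"
  shows "cos_dihedral Q X P Y = 0 \<or> cos_dihedral Q X P Y \<ge> 1/2"
proof (rule alternating_edge[OF relabel(2), where K = "\<lambda>m n. if p = q then m = p else m = p \<or> n = p"])
  have sw: "dihF t t p q t t = dihF t p t t q t" "dihF t t q p t t = dihF t p t t q t" "dihF t q t t p t = dihF t p t t q t"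
    using dihF_swap[of t p t t q t] dihF_swap[of t t p q t t] by auto
  fix p' q' x' y'
  assume "(p', q', x', y') \<in> even_perms Q X P Y" "dist p' q' = dist Q X"
  then show "((if p = q then dist p' x' = p else dist p' x' = p \<or> dist q' x' = p) \<longleftrightarrow>
       \<not> (if p = q then dist p' y' = p else dist p' y' = p \<or> dist q' y' = p)) \<and>
      dihedral p' q' x' y' = dihedral Q X P Y"
    unfolding even_perms_def insert_iff empty_iff prod.inject dihedral_dihF
    using assms by (elim disjE conjE FalseE) (auto simp: distances sw)
qed

text \<open>The faces at XY have legs \<open>r\<close> and \<open>t\<close>. For q = t and p = r the
  tile is a pyramid over the equilateral triangle QXY, and the test by \<open>r\<close> works at all
  three base edges.\<close>

lemma right_or_sharp_base:
  assumes "r \<noteq> t" "q \<noteq> r" "q \<noteq> p" "q \<noteq> t \<or> p = r"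
  shows "cos_dihedral X Y P Q = 0 \<or> cos_dihedral X Y P Q \<ge> 1/2"
proof (rule alternating_edge[OF relabel(4), where K = "\<lambda>m n. m = r"])
  have sw: "dihF q t r t r p = dihF q r t r t p" "dihF t t r t r r = dihF t r t r t r"
    using dihF_swap[of q r t r t p] dihF_swap[of t r t r t r] by auto
  fix p' q' x' y'
  assume e: "(p', q', x', y') \<in> even_perms X Y P Q" "dist p' q' = dist X Y"
  show "(dist p' x' = r \<longleftrightarrow> \<not> dist p' y' = r) \<and> dihedral p' q' x' y' = dihedral X Y P Q"
  proof (cases "q = t")
    case False
    then show ?thesis
      using e assms(1-3) unfolding even_perms_def insert_iff empty_iff prod.inject dihedral_dihF
      by (elim disjE conjE FalseE) (simp_all add: distances sw(1))
  next
    case True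
    then have "p = r" using assms(4) by simp
    show ?thesis
      using e assms(1-3) unfolding even_perms_def insert_iff empty_iff prod.inject dihedral_dihF
      by (elim disjE conjE FalseE) (simp_all add: distances[unfolded True \<open>p = r\<close>] sw(2))
  qed
qed

text \<open>For five equal edges the angle at the exceptional edge must be \<open>2\<pi>/5\<close>, unless the tetrahedron is
  far from optimal. Its cosine \<open>\<gamma>\<close> then satisfies \<open>4\<gamma>\<^sup>2 + 2\<gamma> = 1\<close>, which determines the other
  angles, and these do not combine to a full turn.\<close>

lemma bound_five_equal_edges:
  assumes rt: "t = r" and pr: "p = r"
  shows "isoper_bound P Q X Y"
proof -
  note dr = distances[unfolded rt pr]
  have o: "orient3 P Q X Y \<noteq> 0" by (rule vertices_orient3[OF V])
  have mir: "mirror_at P Q X Y" by (simp add: mirror_at_def dr)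
  obtain c \<alpha> \<beta> \<gamma> W where m: "mirror_shape \<alpha> \<beta> \<gamma> W" "c > 0"
    "shape_bound \<alpha> \<beta> \<gamma> W \<Longrightarrow> isoper_bound P Q X Y"
    "(dist P X)\<^sup>2 = c\<^sup>2 * (1 + \<alpha>\<^sup>2)" "(dist Q X)\<^sup>2 = c\<^sup>2 * (1 + \<beta>\<^sup>2)"
    "(dist P Q)\<^sup>2 = c\<^sup>2 * (\<alpha>\<^sup>2 + \<beta>\<^sup>2 - 2 * \<alpha> * \<beta> * \<gamma>)" "dist X Y = 2 * c"
    "cos_dihedral X Y P Q = \<gamma>"
    "cos_dihedral P X Q Y = (\<alpha> - \<beta> * \<gamma>) / W"
    "cos_dihedral P Q X Y = ((\<alpha> * \<beta>)\<^sup>2 * (1 - \<gamma>\<^sup>2) - (\<alpha>\<^sup>2 + \<beta>\<^sup>2 - 2 * \<alpha> * \<beta> * \<gamma>)) / W\<^sup>2"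
    by (rule mirror_params[OF o mir]) (rule that)
  interpret mirror_shape \<alpha> \<beta> \<gamma> W by fact
  have "c\<^sup>2 * (1 + \<alpha>\<^sup>2) = c\<^sup>2 * (1 + \<beta>\<^sup>2)" using m(4,5) dr by simp
  then have "\<alpha>\<^sup>2 = \<beta>\<^sup>2" using m(2) by simp
  then have ab: "\<beta> = \<alpha>" using \<alpha> \<beta> by (simp add: power2_eq_iff_nonneg)
  have "c\<^sup>2 * (1 + \<alpha>\<^sup>2) = c\<^sup>2 * (2 * \<alpha>\<^sup>2 * (1 - \<gamma>))"
    using m(4,6) dr ab by (simp add: power2_eq_square algebra_simps)
  then have "1 + \<alpha>\<^sup>2 = 2 * \<alpha>\<^sup>2 * (1 - \<gamma>)" using m(2) by simp
  then have a\<gamma>: "\<alpha>\<^sup>2 * (1 - 2 * \<gamma>) = 1" by (simp add: algebra_simps)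
  then have "1 - 2 * \<gamma> > 0" using zero_le_power2[of \<alpha>] by (metis not_less mult_nonneg_nonpos zero_less_one)
  then have \<gamma>h: "\<gamma> < 1/2" by simp
  define th where "th = dihedral X Y P Q"
  have o': "orient3 X Y P Q \<noteq> 0" by (rule vertices_orient3[OF relabel(4)])
  note bth = dihedral_bounds[OF o', folded th_def]
  have cth: "cos th = \<gamma>" using bth(3) m(8) by simp
  \<comment> \<open>XY is the only edge of its length unless the tetrahedron is regular; either way
    the angle is the same in every tile of the walk.\<close>
  have "dihedral p' q' x' y' = dihedral X Y P Q"
    if "(p', q', x', y') \<in> even_perms X Y P Q" "dist p' q' = dist X Y" for p' q' x' y'
  proof (cases "q = r")
    case True
    then show ?thesis using that unfolding even_perms_def insert_iff empty_iff prod.inject dihedral_dihF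
      by (elim disjE conjE FalseE) (simp_all add: dr)
  next
    case False
    then show ?thesis using that unfolding even_perms_def insert_iff empty_iff prod.inject dihedral_dihF
      by (elim disjE conjE FalseE) (simp_all add: dr)
  qed
  then obtain n :: nat where n: "n \<ge> 1" "real n * th = 2 * pi"
    unfolding th_def by (rule constant_edge[OF relabel(4)])
  have sharp: "x > pi / 3" if "0 < x" "x < pi" "cos x < 1/2" for x
  proof (rule ccontr)
    assume "\<not> ?thesis"
    then have "cos (pi / 3) \<le> cos x" using that by (intro cos_monotone_0_pi_le) auto
    then show False using that(3) by (simp add: cos_60)
  qed
  have "real n < 6"
  proof (rule ccontr)
    assume "\<not> ?thesis"
    then have "6 * th \<le> real n * th" using bth(1) by (intro mult_right_mono) auto
    then show False using n(2) sharp[OF bth(1,2)] cth \<gamma>h by simp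
  qed
  \<comment> \<open>At most three tiles around XY force \<gamma> <= -1/2 and four force \<alpha> =
    1; area estimates settle both.\<close>
  then consider "n \<le> 3" | "n = 4" | "n = 5" by linarith
  then show ?thesis
  proof cases
    case 1
    then have "real n * th \<le> 3 * th" using bth(1) by (intro mult_right_mono) auto
    then have "th \<ge> 2 * pi / 3" using n(2) by simp
    then have "cos th \<le> cos (2 * pi / 3)" using bth by (intro cos_monotone_0_pi_le) auto
    then have "\<gamma> \<le> -1/4" using cth cos_120 by simp
    then show ?thesis by (intro m(3) area_bound_obtuse)
  next
    case 2
    then have "th = pi / 2" using n(2) by simp
    then have "\<gamma> = 0" using cth by (simp only: cos_pi_half)
    then have "\<alpha>\<^sup>2 = 1" using a\<gamma> by simp
    then have "\<alpha> = 1" using \<alpha> by (simp add: power2_eq_1_iff)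
    then show ?thesis by (intro m(3) area_bound_unit)
  next
    case 3
    then have th: "th = 2 * pi / 5" using n(2) by simp
    have g0: "\<gamma> > 0" using cos_gt_zero[of th] th pi_gt_zero unfolding cth[symmetric] by linarith
    \<comment> \<open>The angles 2 th and 3 th add up to 2\<pi>. Besides the excluded root 1, the
      resulting cubic has the positive root (sqrt 5 - 1) / 4, about 0.30902, which is then enclosed
      by rationals.\<close>
    have "cos (2 * th) = cos (3 * th)"
    proof -
      have e: "2 * th = 2 * pi - 3 * th" using th by simp
      show ?thesis unfolding e by (rule cos_2pi_minus)
    qed
    then have "2 * \<gamma>\<^sup>2 - 1 = 4 * \<gamma>^3 - 3 * \<gamma>" by (simp add: cos_double_cos cos_treble_cos cth)
    then have "(\<gamma> - 1) * (4 * \<gamma>\<^sup>2 + 2 * \<gamma> - 1) = 0" by (simp add: power2_eq_square power3_eq_cube algebra_simps)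
    then have gq: "4 * \<gamma>\<^sup>2 + 2 * \<gamma> - 1 = 0" using C by auto
    have gl: "\<gamma> > 309/1000"
    proof (rule ccontr)
      assume "\<not> ?thesis"
      then have "\<gamma>\<^sup>2 \<le> (309/1000)\<^sup>2" "\<gamma> \<le> 309/1000" using g0 by (auto intro!: power_mono)
      then show False using gq by (simp add: power2_eq_square)
    qed
    have gu: "\<gamma> < 3091/10000"
    proof (rule ccontr)
      assume "\<not> ?thesis"
      then have "\<gamma>\<^sup>2 \<ge> (3091/10000)\<^sup>2" "\<gamma> \<ge> 3091/10000" by (auto intro!: power_mono)
      then show False using gq by (simp add: power2_eq_square)
    qed
    have qr: "q \<noteq> r"
    proof
      assume "q = r"
      then have "c\<^sup>2 * (1 + \<alpha>\<^sup>2) = c\<^sup>2 * 4" using m(4,7) dr by (simp add: power_mult_distrib)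
      then have "\<alpha>\<^sup>2 = 3" using m(2) by simp
      then have "\<gamma> = 1/3" using a\<gamma> by simp
      then show False using gu by simp
    qed
    define tr where "tr = dihedral P X Q Y"
    define tp where "tp = dihedral P Q X Y"
    have o'': "orient3 P X Q Y \<noteq> 0" by (rule vertices_orient3[OF relabel(3)])
    note btr = dihedral_bounds[OF o'', folded tr_def] and btp = dihedral_bounds[OF o, folded tp_def]
    define s where "s = \<alpha>\<^sup>2"
    have s0: "s > 0" using \<alpha> by (simp add: s_def)
    have s: "s = 1 / (1 - 2 * \<gamma>)" using a\<gamma> \<open>1 - 2 * \<gamma> > 0\<close> by (simp add: s_def field_simps)
    have W2s: "W\<^sup>2 = s * (1 - \<gamma>) * (2 + s * (1 + \<gamma>))"
      unfolding W2 ab s_def by (simp add: power2_eq_square algebra_simps)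
    have e2: "2 + s * (1 + \<gamma>) = 3 * (1 - \<gamma>) / (1 - 2 * \<gamma>)" using \<open>1 - 2 * \<gamma> > 0\<close> by (simp add: s field_simps)
    have ctr: "cos tr = \<alpha> * (1 - \<gamma>) / W" using btr(3) m(9) ab by (simp add: algebra_simps)
    have ctr0: "cos tr > 0" unfolding ctr using \<alpha> C W by simp
    have ctr2: "(cos tr)\<^sup>2 = (1 - 2 * \<gamma>) / 3"
    proof -
      have "(cos tr)\<^sup>2 = s * (1 - \<gamma>)\<^sup>2 / W\<^sup>2" unfolding ctr s_def by (simp add: power_divide power_mult_distrib)
      also have "\<dots> = (1 - \<gamma>) / (2 + s * (1 + \<gamma>))" unfolding W2s using s0 C by (simp add: power2_eq_square)
      also have "\<dots> = (1 - 2 * \<gamma>) / 3"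
      proof -
        define k where "k = 1 - \<gamma>"
        have "k \<noteq> 0" using C by (simp add: k_def)
        then show ?thesis unfolding e2 k_def[symmetric] by simp
      qed
      finally show ?thesis .
    qed
    have ctp: "cos tp = (5 * \<gamma> - 1) / (3 * (1 - \<gamma>))"
    proof -
      have "cos tp = (s\<^sup>2 * (1 - \<gamma>\<^sup>2) - 2 * s * (1 - \<gamma>)) / W\<^sup>2"
        unfolding btp(3) m(10) ab s_def by (simp add: power2_eq_square algebra_simps)
      also have "s\<^sup>2 * (1 - \<gamma>\<^sup>2) - 2 * s * (1 - \<gamma>) = s * (1 - \<gamma>) * (s * (1 + \<gamma>) - 2)"
        by (simp add: power2_eq_square algebra_simps)
      also have "\<dots> / W\<^sup>2 = (s * (1 + \<gamma>) - 2) / (2 + s * (1 + \<gamma>))" unfolding W2s using s0 C by simp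
      also have "s * (1 + \<gamma>) - 2 = (5 * \<gamma> - 1) / (1 - 2 * \<gamma>)" using \<open>1 - 2 * \<gamma> > 0\<close> by (simp add: s field_simps)
      finally show ?thesis unfolding e2 using \<open>1 - 2 * \<gamma> > 0\<close> by simp
    qed
    have cp: "cos tp > 2629/10000" "cos tp < 2632/10000"
      unfolding ctp using gl gu by (simp_all add: field_simps)
    have cr: "(cos tr)\<^sup>2 > 1272/10000" "(cos tr)\<^sup>2 < 1274/10000"
      unfolding ctr2 using gl gu by simp_all
    have "cos tr < 1/2"
      by (rule power2_less_imp_less) (use cr in \<open>auto simp: power2_eq_square\<close>)
    then have ltr: "tr > pi / 3" by (intro sharp btr)
    have ltp: "tp > pi / 3" using cp by (intro sharp btp) auto
    have acute: "x < pi / 2" if "0 < x" "x < pi" "cos x > 0" for x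
    proof (rule ccontr)
      assume "\<not> ?thesis"
      then have "cos x \<le> cos (pi / 2)" using that by (intro cos_monotone_0_pi_le) auto
      then show False using that(3) by simp
    qed
    have utr: "tr < pi / 2" using ctr0 by (intro acute btr)
    have utp: "tp < pi / 2" using cp by (intro acute btp) auto
    obtain n' u v \<theta> where w: "n' \<ge> (1::nat)"
      "\<And>i. edge_step P X Q Y u v \<theta> i"
      "u 0 = dist P Q" "v 0 = dist X Q" "u 1 = dist P Y" "v 1 = dist X Y"
      "u n' = u 0" "v n' = v 0" "(\<Sum>i<n'. \<theta> i) = 2 * pi"
      by (rule edge_walk[OF relabel(3)]) (rule that)
    \<comment> \<open>Faces around PX are equilateral or contain an edge of length \<open>q\<close>.
      The angle \<open>tr\<close> separates faces of different kinds, while \<open>tp\<close>, the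
      angle opposite to XY, separates two equilateral ones.\<close>
    define K where "K i \<longleftrightarrow> u i = q \<or> v i = q" for i
    have sw: "dihF r r r q r r = dihF r r r r q r" "dihF r q r r r r = dihF r r r r q r" "dihF r r q r r r = dihF r r r r q r"
      using dihF_swap[of r r r r q r] dihF_swap[of r r r q r r] by auto
    have D: "tr = dihF r r r r q r" "tp = dihF r r r r r q" by (simp_all add: tr_def tp_def dihedral_dihF dr)
    have step: "\<theta> i = (if K i \<noteq> K (Suc i) then tr else tp)" for i
    proof -
      obtain p' q' x' y' where p: "(p', q', x', y') \<in> even_perms P X Q Y" "dist p' q' = dist P X"
        "u i = dist p' x'" "v i = dist q' x'" "u (Suc i) = dist p' y'" "v (Suc i) = dist q' y'" "\<theta> i = dihedral p' q' x' y'"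
        using w(2)[of i] by (auto simp: eq_commute)
      show ?thesis
        using p(1,2) qr unfolding p(3-7) K_def even_perms_def insert_iff empty_iff prod.inject dihedral_dihF
        by (elim disjE conjE FalseE) (simp_all add: dr sw D)
    qed
    \<comment> \<open>\<open>b\<close> counts the angles \<open>tr\<close>: an even number because
      the walk closes, and positive because of the first tile. Since both angles lie strictly
      between \<pi>/3 and \<pi>/2, there are five tiles in all.\<close>
    define b where "b = card {i. i < n' \<and> K i \<noteq> K (Suc i)}"
    have "even b" unfolding b_def even_card_flips using w(7,8) by (simp add: K_def)
    have "0 \<in> {i. i < n' \<and> K i \<noteq> K (Suc i)}" using w(1,3-6) qr by (auto simp: K_def dr)
    then have "b > 0" unfolding b_def by (subst card_gt_0_iff) auto
    have bn: "b \<le> n'" unfolding b_def using card_mono[of "{..<n'}" "{i. i < n' \<and> K i \<noteq> K (Suc i)}"] by auto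
    have sum: "real b * tr + real (n' - b) * tp = 2 * pi"
    proof -
      have 1: "{..<n'} \<inter> {i. K i \<noteq> K (Suc i)} = {i. i < n' \<and> K i \<noteq> K (Suc i)}" by auto
      have 2: "card ({..<n'} \<inter> - {i. K i \<noteq> K (Suc i)}) = n' - b"
      proof -
        have "{..<n'} \<inter> - {i. K i \<noteq> K (Suc i)} = {..<n'} - {i. i < n' \<and> K i \<noteq> K (Suc i)}" by auto
        then show ?thesis by (simp add: card_Diff_subset b_def) (subst card_Diff_subset; auto)
      qed
      have "(\<Sum>i<n'. \<theta> i) = (\<Sum>i<n'. if K i \<noteq> K (Suc i) then tr else tp)" by (intro sum.cong) (auto simp: step)
      also have "\<dots> = real b * tr + real (n' - b) * tp"
        unfolding sum.If_cases[OF finite_lessThan] sum_constant 1 2 b_def[symmetric] ..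
      finally show ?thesis using w(9) by simp
    qed
    have nb: "real n' = real b + real (n' - b)" using bn by simp
    have "real n' * (pi / 3) < 2 * pi"
    proof -
      have "real b * (pi / 3) < real b * tr" using \<open>b > 0\<close> ltr by simp
      moreover have "real (n' - b) * (pi / 3) \<le> real (n' - b) * tp" using ltp by (intro mult_left_mono) auto
      ultimately show ?thesis using sum unfolding nb by (simp add: algebra_simps)
    qed
    then have "n' < 6" using pi_gt_zero by simp
    have "real n' * (pi / 2) > 2 * pi"
    proof -
      have "real b * (pi / 2) > real b * tr" using \<open>b > 0\<close> utr by simp
      moreover have "real (n' - b) * (pi / 2) \<ge> real (n' - b) * tp" using utp by (intro mult_left_mono) auto
      ultimately show ?thesis using sum unfolding nb by (simp add: algebra_simps)
    qed
    then have "n' > 4" using pi_gt_zero by simp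
    then have n5: "n' = 5" using \<open>n' < 6\<close> by simp
    then have "b = 2 \<or> b = 4" using \<open>even b\<close> \<open>b > 0\<close> bn by (auto elim!: evenE)
    then have False
    proof
      assume "b = 4"
      then have e: "tp = 2 * pi - 2 * (2 * tr)" using sum n5 by simp
      have "cos tp = cos (2 * (2 * tr))" by (subst e) (rule cos_2pi_minus)
      also have "\<dots> = 2 * (2 * (cos tr)\<^sup>2 - 1)\<^sup>2 - 1" by (simp only: cos_double_cos)
      also have "\<dots> \<le> 2 * (7456/10000)\<^sup>2 - 1"
      proof -
        have "\<bar>2 * (cos tr)\<^sup>2 - 1\<bar> \<le> \<bar>7456/10000\<bar>" using cr by simp
        then show ?thesis unfolding abs_le_square_iff by simp
      qed
      finally show False using cp by (simp add: power2_eq_square)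
    next
      assume "b = 2"
      then have e: "3 * tp = 2 * pi - 2 * tr" using sum n5 by simp
      have "cos (3 * tp) = cos (2 * tr)" unfolding e by (rule cos_2pi_minus)
      then have "4 * (cos tp)^3 - 3 * cos tp = 2 * (cos tr)\<^sup>2 - 1" by (simp add: cos_double_cos cos_treble_cos)
      moreover have "(cos tp)^3 \<ge> (2629/10000)^3" using cp by (intro power_mono) auto
      ultimately show False using cp cr by (simp add: power3_eq_cube)
    qed
    then show ?thesis ..
  qed
qed

end

end

section \<open>Assembling the lower bound\<close>

context op_tetra_tiling
begin

text \<open>If r and t differ from each other and from p and q, both side angles are right or sharp.
  Each coincidence of lengths makes some faces indistinguishable for the walk and needs another edge
  or another estimate.\<close>

lemma mirror_bound:
  assumes V: "{P, Q, X, Y} = {A, B, C, D}" and mir: "mirror_at P Q X Y"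
  shows "isoper_bound P Q X Y"
proof -
  \<comment> \<open>For r = q the face PXY is equilateral; for r = p the vertex P is equidistant
    from the others.\<close>
  have main: "isoper_bound P Q X Y"
    if V: "{P, Q, X, Y} = {A, B, C, D}" and mir: "mirror_at P Q X Y"
      and ne: "dist P X \<noteq> dist Q X" and r: "dist P X = dist P Q \<or> dist P X = dist X Y" for P Q X Y
  proof -
    define r t p q where "r = dist P X" and "t = dist Q X" and "p = dist P Q" and "q = dist X Y"
    have d: "dist P X = r" "dist P Y = r" "dist Q X = t" "dist Q Y = t" "dist P Q = p" "dist X Y = q"
      using mir by (simp_all add: mirror_at_def r_def t_def p_def q_def)
    have dsw: "dist Q X = t" "dist Q Y = t" "dist P X = r" "dist P Y = r" "dist Q P = p" "dist X Y = q"
      using d by (simp_all add: dist_commute)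
    have o: "orient3 P Q X Y \<noteq> 0" by (rule vertices_orient3[OF V])
    have rt: "r \<noteq> t" "t \<noteq> r" using ne by (auto simp: d)
    \<comment> \<open>A pyramid over an equilateral base, whose threefold symmetry carries the angle
      at XY to the one at the other base edges.\<close>
    have pyramid: "isoper_bound P' Q' X Y"
      if V': "{P', Q', X, Y} = {A, B, C, D}" and m': "mirror_at P' Q' X Y"
        and d': "dist P' X = r'" "dist P' Y = r'" "dist Q' X = t'" "dist Q' Y = t'" "dist P' Q' = r'" "dist X Y = t'"
        and ne': "r' \<noteq> t'" for P' Q' r' t'
    proof -
      have o': "orient3 P' Q' X Y \<noteq> 0" by (rule vertices_orient3[OF V'])
      have o1: "orient3 X Y P' Q' \<noteq> 0" by (rule vertices_orient3) (use V' in auto)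
      have o2: "orient3 Q' X P' Y \<noteq> 0" by (rule vertices_orient3) (use V' in auto)
      have 1: "cos_dihedral X Y P' Q' = 0 \<or> cos_dihedral X Y P' Q' \<ge> 1/2"
        by (rule right_or_sharp_base[OF V' d']) (use ne' in auto)
      have "dihedral Q' X P' Y = dihedral X Y P' Q'"
        unfolding dihedral_dihF using d' by (simp add: dist_commute)
      then have "cos_dihedral Q' X P' Y = cos_dihedral X Y P' Q'"
        using dihedral_bounds(3)[OF o1] dihedral_bounds(3)[OF o2] by simp
      then show ?thesis using 1 d' by (intro bound_pyramid[OF o' m']) auto
    qed
    show ?thesis
    proof (cases "t = p \<or> t = q")
      case False
      have t: "cos_dihedral Q X P Y = 0 \<or> cos_dihedral Q X P Y \<ge> 1/2"
        by (rule right_or_sharp_side[OF V d]) (use False rt in auto)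
      show ?thesis
      proof (cases "r = q")
        case True
        then show ?thesis using t by (intro bound_equilateral_face[OF o mir]) (auto simp: d)
      next
        case rq: False
        then have rp: "r = p" using r by (auto simp: d)
        have "cos_dihedral X Y P Q = 0 \<or> cos_dihedral X Y P Q \<ge> 1/2"
          by (rule right_or_sharp_base[OF V d]) (use False rt rq rp in auto)
        then show ?thesis using t rp by (intro bound_pyramid[OF o mir]) (auto simp: d)
      qed
    next
      case True
      then consider "r = p" "t = q" | "r = q" "t = p" using r rt by (auto simp: d)
      then show ?thesis
      proof cases
        case 1
        then show ?thesis using rt by (intro pyramid[OF V mir, of r t]) (auto simp: d)
      next
        case 2
        have V': "{Q, P, X, Y} = {A, B, C, D}" using V by auto
        have m': "mirror_at Q P X Y" using mir by (auto simp: mirror_at_def)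
        have "isoper_bound Q P X Y"
          using 2 rt by (intro pyramid[OF V' m', of t r]) (auto simp: dsw)
        then show ?thesis using isoper_bound_perm(1) by blast
      qed
    qed
  qed
  define r t p q where "r = dist P X" and "t = dist Q X" and "p = dist P Q" and "q = dist X Y"
  have d: "dist P X = r" "dist P Y = r" "dist Q X = t" "dist Q Y = t" "dist P Q = p" "dist X Y = q"
    using mir by (simp_all add: mirror_at_def r_def t_def p_def q_def)
  have dsw: "dist Q X = t" "dist Q Y = t" "dist P X = r" "dist P Y = r" "dist Q P = p" "dist X Y = q"
    using d by (simp_all add: dist_commute)
  have o: "orient3 P Q X Y \<noteq> 0" by (rule vertices_orient3[OF V])
  have V': "{Q, P, X, Y} = {A, B, C, D}" using V by auto
  have m': "mirror_at Q P X Y" using mir by (auto simp: mirror_at_def)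
  have o': "orient3 Q P X Y \<noteq> 0" by (rule vertices_orient3[OF V'])
  show ?thesis
  proof (cases "r = t")
    case rt: True
    consider "p = r" | "q = r" | "r \<noteq> p" "r \<noteq> q" by blast
    then show ?thesis
    proof cases
      case 1
      then show ?thesis by (intro bound_five_equal_edges[OF V d]) (auto simp: rt)
    next
      case 2
      have V2: "{X, Y, P, Q} = {A, B, C, D}" using V by auto
      have "isoper_bound X Y P Q"
        by (rule bound_five_equal_edges[OF V2, of r r q p]) (use d rt 2 in \<open>auto simp: dist_commute\<close>)
      then show ?thesis
        by (rule isoper_bound_relabel[rotated 2]) (use V V2 vertices_orient3[OF V2] in auto)
    next
      case 3
      have t: "cos_dihedral Q X P Y = 0 \<or> cos_dihedral Q X P Y \<ge> 1/2"
        by (rule right_or_sharp_sides[OF V d]) (use 3 rt in auto)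
      have o1: "orient3 P X Q Y \<noteq> 0" by (rule vertices_orient3) (use V in auto)
      have o2: "orient3 Q X P Y \<noteq> 0" by (rule vertices_orient3) (use V in auto)
      have "dihedral P X Q Y = dihedral Q X P Y"
        unfolding dihedral_dihF using d rt by (simp add: dist_commute)
      then have "cos_dihedral P X Q Y = cos_dihedral Q X P Y"
        using dihedral_bounds(3)[OF o1] dihedral_bounds(3)[OF o2] by simp
      then show ?thesis using t bound_60_60[OF o mir] not_90_90[OF o mir] by auto
    qed
  next
    case rt: False
    consider "r = p \<or> r = q" | "t = p \<or> t = q" | "r \<noteq> p" "r \<noteq> q" "t \<noteq> p" "t \<noteq> q" by blast
    then show ?thesis
    proof cases
      case 1
      then show ?thesis using rt by (intro main[OF V mir]) (auto simp: d)
    next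
      case 2
      then have "isoper_bound Q P X Y" using rt by (intro main[OF V' m']) (auto simp: dsw)
      then show ?thesis using isoper_bound_perm(1) by blast
    next
      case 3
      have t: "cos_dihedral Q X P Y = 0 \<or> cos_dihedral Q X P Y \<ge> 1/2"
        by (rule right_or_sharp_side[OF V d]) (use 3 rt in auto)
      have r: "cos_dihedral P X Q Y = 0 \<or> cos_dihedral P X Q Y \<ge> 1/2"
        by (rule right_or_sharp_side[OF V' dsw]) (use 3 rt in auto)
      have "isoper_bound P Q X Y \<longleftrightarrow> isoper_bound Q P X Y"
        using isoper_bound_perm(1) by blast
      then show ?thesis using r t bound_60_60[OF o mir] bound_60_90[OF o mir] bound_60_90[OF o' m'] not_90_90[OF o mir]
        by blast
    qed
  qed
qed

theorem tile_bound: "isoper_bound A B C D"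
proof (rule mirror_or_two_paths)
  fix P Q X Y
  assume V: "{P, Q, X, Y} = {A, B, C, D}" and mir: "mirror_at P Q X Y"
  show ?thesis
    by (rule isoper_bound_relabel[OF V vertices_orient3[OF V] mirror_bound[OF V mir]])
next
  fix P Q X Y
  assume "{P, Q, X, Y} = {A, B, C, D}" "two_paths P Q X Y" "dist P Q > dist P Y"
  then show ?thesis using two_paths_impossible by blast
qed

end

lemma isometry3_orthogonal:
  assumes "isometry3 f"
  obtains h b where "orthogonal_transformation h" "\<And>x. f x = h x + b"
proof
  show "orthogonal_transformation (\<lambda>x. f x - f 0)"
    using assms unfolding orthogonal_transformation_isometry isometry3_def by (auto simp: dist_norm)
  show "f x = (f x - f 0) + f 0" for x by simp
qed

lemma isometry3_invariants:
  assumes "isometry3 f"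
  shows "\<bar>orient3 (f p) (f q) (f x) (f y)\<bar> = \<bar>orient3 p q x y\<bar>"
    "tetra_surface_area (f p) (f q) (f x) (f y) = tetra_surface_area p q x y"
    "f ` (convex hull S) = convex hull (f ` S)"
proof -
  obtain h b where h: "orthogonal_transformation h" and f: "\<And>x. f x = h x + b"
    by (rule isometry3_orthogonal[OF assms]) (rule that)
  have lin: "linear h" using h by (rule orthogonal_transformation_linear)
  have det: "\<bar>det (matrix h)\<bar> = 1" using h by (simp add: orthogonal_transformation_det)
  have diff: "f u - f v = h (u - v)" for u v by (simp add: f linear_diff[OF lin])
  have cr: "cross3 (h u) (h v) = det (matrix h) *\<^sub>R h (cross3 u v)" for u v
    using h by (rule cross_orthogonal_transformation)
  show "\<bar>orient3 (f p) (f q) (f x) (f y)\<bar> = \<bar>orient3 p q x y\<bar>"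
    unfolding orient3_def diff cr using h det by (simp add: orthogonal_transformation_def abs_mult)
  have "tri_area (f u) (f v) (f w) = tri_area u v w" for u v w
    unfolding tri_area_def diff cr using h det by (simp add: orthogonal_transformation_norm)
  then show "tetra_surface_area (f p) (f q) (f x) (f y) = tetra_surface_area p q x y"
    by (simp add: tetra_surface_area_def)
  have f': "f = (\<lambda>x. b + x) \<circ> h" by (auto simp: f add.commute)
  show "f ` (convex hull S) = convex hull (f ` S)"
    unfolding f' image_comp[symmetric] convex_hull_linear_image[OF lin] convex_hull_translation ..
qed

theorem surface_area_lower_bound:
  assumes vol: "measure lebesgue (convex hull {a, b, c, d}) = 1"
    and adm: "admits_op_ftf_tiling (convex hull {a, b, c, d})"
  shows "(tetra_surface_area a b c d)^3 \<ge> 288 * sqrt 2"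
proof -
  let ?P = "convex hull {a, b, c, d}"
  obtain \<T> where ftf: "face_to_face_tiling ?P \<T>" and op: "orientation_preserving_tiling \<T>"
    using adm by (auto simp: admits_op_ftf_tiling_def)
  have cov: "\<Union>\<T> = UNIV" using ftf by (simp add: face_to_face_tiling_def)
  \<comment> \<open>The given tetrahedron need not be a tile and may be oriented oppositely to all
    tiles, so an actual tile takes its place.\<close>
  then obtain Q0 where Q0: "Q0 \<in> \<T>" by blast
  then obtain f where f: "isometry3 f" "Q0 = f ` ?P" using ftf by (auto simp: face_to_face_tiling_def)
  note inv = isometry3_invariants[OF f(1)]
  have o6: "\<bar>orient3 a b c d\<bar> = 6" using vol measure_tetrahedron[of a b c d] by simp
  have Q0h: "Q0 = convex hull {f a, f b, f c, f d}" unfolding f(2) inv(3) by simp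
  interpret op_tetra_tiling "f a" "f b" "f c" "f d" \<T>
  proof
    show "orient3 (f a) (f b) (f c) (f d) \<noteq> 0" using inv(1)[of a b c d] o6 by auto
    show "convex hull {f a, f b, f c, f d} \<in> \<T>" using Q0 Q0h by simp
    show "\<exists>g. rigid_motion3 g \<and> Q = g ` (convex hull {f a, f b, f c, f d})" if "Q \<in> \<T>" for Q
      using op Q0 that unfolding orientation_preserving_tiling_def Q0h[symmetric] by metis
    show "\<Union>\<T> = UNIV" by fact
  qed (use ftf in \<open>auto simp: face_to_face_tiling_def\<close>)
  have "(orient3 (f a) (f b) (f c) (f d))\<^sup>2 = \<bar>orient3 (f a) (f b) (f c) (f d)\<bar>\<^sup>2" by simp
  also have "\<dots> = 36" unfolding inv(1) o6 by simp
  finally have "(orient3 (f a) (f b) (f c) (f d))\<^sup>2 = 36" .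
  then show ?thesis using tile_bound unfolding isoper_bound_def inv(2) by simp
qed

section \<open>The tiling by alcoves\<close>

text \<open>For z on none of the planes where some normal in \<open>N\<close> takes an integer value
  relative to \<open>a\<close>, this is the closed cell of z in that arrangement.\<close>

definition alcove :: "(real^3) set \<Rightarrow> real^3 \<Rightarrow> real^3 \<Rightarrow> (real^3) set" where
  "alcove N a z = {p. \<forall>n\<in>N. of_int \<lfloor>n \<bullet> (z - a)\<rfloor> \<le> n \<bullet> (p - a) \<and> n \<bullet> (p - a) \<le> of_int \<lfloor>n \<bullet> (z - a)\<rfloor> + 1}"

lemma slab_eq: "{p. l \<le> n \<bullet> (p - a) \<and> n \<bullet> (p - a) \<le> u} = {p. n \<bullet> p \<ge> l + n \<bullet> a} \<inter> {p. n \<bullet> p \<le> u + n \<bullet> a}"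
  for n a :: "real^3"
  by (auto simp: inner_diff_right)

lemma alcove_Inter: "alcove N a z =
  (\<Inter>n\<in>N. {p. of_int \<lfloor>n \<bullet> (z - a)\<rfloor> \<le> n \<bullet> (p - a) \<and> n \<bullet> (p - a) \<le> of_int \<lfloor>n \<bullet> (z - a)\<rfloor> + 1})"
  by (auto simp: alcove_def)

lemma convex_alcove: "convex (alcove N a z)"
  unfolding alcove_Inter slab_eq
  by (intro convex_INT convex_Int convex_halfspace_le convex_halfspace_ge)

text \<open>Two alcoves lie in equal, adjacent or disjoint slabs of each family of parallel planes, so they
  meet in an intersection of supporting planes.\<close>

lemma alcove_Int_face_of:
  assumes ne: "alcove N a z \<inter> alcove N a z' \<noteq> {}" and N: "N \<noteq> {}"
  shows "alcove N a z \<inter> alcove N a z' face_of alcove N a z"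
proof -
  let ?Q = "alcove N a z"
  define slab where "slab n = {p. of_int \<lfloor>n \<bullet> (z' - a)\<rfloor> \<le> n \<bullet> (p - a) \<and> n \<bullet> (p - a) \<le> of_int \<lfloor>n \<bullet> (z' - a)\<rfloor> + 1}" for n
  have eq: "?Q \<inter> alcove N a z' = \<Inter> ((\<lambda>n. ?Q \<inter> slab n) ` N)"
    using N unfolding alcove_Inter[of N a z'] slab_def by auto
  have "?Q \<inter> slab n face_of ?Q" if n: "n \<in> N" for n
  proof -
    obtain p where p: "p \<in> ?Q" "p \<in> alcove N a z'" using ne by blast
    let ?k = "\<lfloor>n \<bullet> (z - a)\<rfloor>" and ?l = "\<lfloor>n \<bullet> (z' - a)\<rfloor>"
    have Qn: "of_int ?k \<le> n \<bullet> (v - a)" "n \<bullet> (v - a) \<le> of_int ?k + 1" if "v \<in> ?Q" for v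
      using that n by (auto simp: alcove_def)
    have pl: "of_int ?l \<le> n \<bullet> (p - a)" "n \<bullet> (p - a) \<le> of_int ?l + 1"
      using p(2) n by (auto simp: alcove_def)
    have "?l \<le> ?k + 1" "?k \<le> ?l + 1" using pl Qn[OF p(1)] by linarith+
    then consider "?l = ?k" | "?l = ?k + 1" | "?l = ?k - 1" by linarith
    then show ?thesis
    proof cases
      case 1
      then have "?Q \<inter> slab n = ?Q" using Qn by (auto simp: slab_def)
      then show ?thesis using face_of_refl[OF convex_alcove] by simp
    next
      case 2
      then have "?Q \<inter> slab n = ?Q \<inter> {v. n \<bullet> v = of_int ?k + 1 + n \<bullet> a}"
        using Qn by (fastforce simp: slab_def inner_diff_right)
      also have "\<dots> face_of ?Q"
        by (rule face_of_Int_supporting_hyperplane_le[OF convex_alcove])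
          (use Qn in \<open>auto simp: inner_diff_right algebra_simps\<close>)
      finally show ?thesis .
    next
      case 3
      then have "?Q \<inter> slab n = ?Q \<inter> {v. n \<bullet> v = of_int ?k + n \<bullet> a}"
        using Qn by (fastforce simp: slab_def inner_diff_right)
      also have "\<dots> face_of ?Q"
        by (rule face_of_Int_supporting_hyperplane_ge[OF convex_alcove])
          (use Qn in \<open>auto simp: inner_diff_right algebra_simps\<close>)
      finally show ?thesis .
    qed
  qed
  then show ?thesis unfolding eq using N by (intro face_of_Inter) auto
qed

text \<open>Different alcoves use different slabs of some normal, and interiors lie in the open
  slabs, which are disjoint.\<close>

lemma alcove_interior_disjoint:
  assumes ne: "alcove N a z \<noteq> alcove N a z'" and N: "0 \<notin> N"
  shows "interior (alcove N a z) \<inter> interior (alcove N a z') = {}"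
proof -
  obtain n where n: "n \<in> N" "\<lfloor>n \<bullet> (z - a)\<rfloor> \<noteq> \<lfloor>n \<bullet> (z' - a)\<rfloor>" using ne unfolding alcove_def by fastforce
  then have n0: "n \<noteq> 0" using N by auto
  have int: "of_int \<lfloor>n \<bullet> (y - a)\<rfloor> < n \<bullet> (v - a) \<and> n \<bullet> (v - a) < of_int \<lfloor>n \<bullet> (y - a)\<rfloor> + 1"
    if "v \<in> interior (alcove N a y)" for v y
  proof -
    let ?k = "of_int \<lfloor>n \<bullet> (y - a)\<rfloor> :: real"
    have "alcove N a y \<subseteq> {p. n \<bullet> p \<ge> ?k + n \<bullet> a} \<inter> {p. n \<bullet> p \<le> ?k + 1 + n \<bullet> a}"
      using n(1) by (auto simp: alcove_def inner_diff_right algebra_simps)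
    then have "interior (alcove N a y) \<subseteq> interior ({p. n \<bullet> p \<ge> ?k + n \<bullet> a} \<inter> {p. n \<bullet> p \<le> ?k + 1 + n \<bullet> a})"
      by (rule interior_mono)
    also have "\<dots> = {p. n \<bullet> p > ?k + n \<bullet> a} \<inter> {p. n \<bullet> p < ?k + 1 + n \<bullet> a}"
      using n0 by (simp add: interior_halfspace_le interior_halfspace_ge)
    finally show ?thesis using that by (auto simp: inner_diff_right algebra_simps)
  qed
  show ?thesis
  proof (rule ccontr)
    assume "\<not> ?thesis"
    then obtain v where "v \<in> interior (alcove N a z)" "v \<in> interior (alcove N a z')" by blast
    then show False using int[of v z] int[of v z'] n(2) by linarith
  qed
qed

text \<open>Dual bases: the \<open>w\<close> are the coordinate functionals of the
  \<open>f\<close>.\<close>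

definition frame3 :: "real^3 \<Rightarrow> real^3 \<Rightarrow> real^3 \<Rightarrow> real^3 \<Rightarrow> real^3 \<Rightarrow> real^3 \<Rightarrow> bool" where
  "frame3 f1 f2 f3 w1 w2 w3 \<longleftrightarrow>
     w1 \<bullet> f1 = 1 \<and> w1 \<bullet> f2 = 0 \<and> w1 \<bullet> f3 = 0 \<and> w2 \<bullet> f1 = 0 \<and> w2 \<bullet> f2 = 1 \<and> w2 \<bullet> f3 = 0 \<and>
     w3 \<bullet> f1 = 0 \<and> w3 \<bullet> f2 = 0 \<and> w3 \<bullet> f3 = 1 \<and>
     (\<forall>v. v = (w1 \<bullet> v) *\<^sub>R f1 + (w2 \<bullet> v) *\<^sub>R f2 + (w3 \<bullet> v) *\<^sub>R f3)"

lemma frame3_exists: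
  assumes "f1 \<bullet> cross3 f2 f3 \<noteq> 0"
  obtains w1 w2 w3 where "frame3 f1 f2 f3 w1 w2 w3"
proof -
  define k where "k = f1 \<bullet> cross3 f2 f3"
  define w1 w2 w3 where "w1 = (1/k) *\<^sub>R cross3 f2 f3" and "w2 = (1/k) *\<^sub>R cross3 f3 f1" and "w3 = (1/k) *\<^sub>R cross3 f1 f2"
  have k: "k \<noteq> 0" using assms by (simp add: k_def)
  have kk: "cross3 f2 f3 \<bullet> f1 = k" "cross3 f3 f1 \<bullet> f2 = k" "cross3 f1 f2 \<bullet> f3 = k"
    unfolding k_def by (metis cross_triple inner_commute)+
  have sp: "v = (w1 \<bullet> v) *\<^sub>R f1 + (w2 \<bullet> v) *\<^sub>R f2 + (w3 \<bullet> v) *\<^sub>R f3" for v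
  proof -
    have e: "v \<bullet> cross3 f2 f3 = cross3 f2 f3 \<bullet> v" "f1 \<bullet> cross3 v f3 = cross3 f3 f1 \<bullet> v" "f1 \<bullet> cross3 f2 v = cross3 f1 f2 \<bullet> v"
      by (metis cross_triple inner_commute)+
    have "(1/k) *\<^sub>R (k *\<^sub>R v) = (1/k) *\<^sub>R ((v \<bullet> cross3 f2 f3) *\<^sub>R f1 + (f1 \<bullet> cross3 v f3) *\<^sub>R f2 + (f1 \<bullet> cross3 f2 v) *\<^sub>R f3)"
      unfolding k_def by (subst triple_cramer) simp
    then show ?thesis using k by (simp add: e w1_def w2_def w3_def scaleR_add_right)
  qed
  show thesis
    by (rule that[of w1 w2 w3], unfold frame3_def, intro conjI allI)
      (use k in \<open>simp_all add: w1_def w2_def w3_def kk dot_cross_self, (use sp in \<open>simp add: w1_def w2_def w3_def\<close>)?\<close>)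
qed

text \<open>The root system A3: with w1, w2, w3 as e1 - e4, e2 - e4, e3 - e4 these are all
  differences of two of e1, ..., e4. Listing both signs makes the set symmetric in its
  arguments.\<close>

definition roots :: "real^3 \<Rightarrow> real^3 \<Rightarrow> real^3 \<Rightarrow> (real^3) set" where
  "roots w1 w2 w3 = {w1, w2, w3, - w1, - w2, - w3, w1 - w2, w1 - w3, w2 - w3, w2 - w1, w3 - w1, w3 - w2}"

lemma in_convex_hull_4:
  fixes p q x y :: "'a::real_vector"
  assumes "i \<ge> 0" "j \<ge> 0" "k \<ge> 0" "l \<ge> 0" "i + j + k + l = 1"
  shows "i *\<^sub>R p + j *\<^sub>R q + k *\<^sub>R x + l *\<^sub>R y \<in> convex hull {p, q, x, y}"
proof -
  define u where "u = (\<lambda>n::nat. if n = 0 then i else if n = 1 then j else if n = 2 then k else l)"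
  define v where "v = (\<lambda>n::nat. if n = 0 then p else if n = 1 then q else if n = 2 then x else y)"
  have "(\<Sum>n\<in>{0,1,2,3}. u n *\<^sub>R v n) \<in> convex hull {p, q, x, y}"
    by (rule convex_sum) (use assms in \<open>auto simp: u_def v_def hull_inc\<close>)
  then show ?thesis by (simp add: u_def v_def add.assoc)
qed

text \<open>One of the six Kuhn simplices of the parallelepiped at \<open>v\<close>; the order of
  the arguments is the order in which its edges are walked.\<close>

definition kuhn_tile :: "real^3 \<Rightarrow> real^3 \<Rightarrow> real^3 \<Rightarrow> real^3 \<Rightarrow> (real^3) set" where
  "kuhn_tile v g1 g2 g3 = convex hull {v, v + g1, v + g1 + g2, v + g1 + g2 + g3}"

lemma in_kuhn_tile:
  assumes "y1 \<le> 1" "y2 \<le> y1" "y3 \<le> y2" "0 \<le> y3"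
  shows "v + y1 *\<^sub>R g1 + y2 *\<^sub>R g2 + y3 *\<^sub>R g3 \<in> kuhn_tile v g1 g2 g3"
proof -
  have "v + y1 *\<^sub>R g1 + y2 *\<^sub>R g2 + y3 *\<^sub>R g3 = (1 - y1) *\<^sub>R v + (y1 - y2) *\<^sub>R (v + g1)
      + (y2 - y3) *\<^sub>R (v + g1 + g2) + y3 *\<^sub>R (v + g1 + g2 + g3)"
    by (simp add: algebra_simps)
  also have "\<dots> \<in> kuhn_tile v g1 g2 g3" unfolding kuhn_tile_def using assms by (intro in_convex_hull_4) auto
  finally show ?thesis .
qed

text \<open>In coordinates relative to \<open>v\<close> the simplex is given by 1 >= y1 >= y2 >= y3
  >= 0, and the slabs of all roots around its centroid impose exactly these inequalities.\<close>

lemma kuhn_tile_alcove: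
  fixes z1 z2 z3 :: int
  assumes fr: "frame3 g1 g2 g3 w1 w2 w3"
    and v: "v = a + of_int z1 *\<^sub>R g1 + of_int z2 *\<^sub>R g2 + of_int z3 *\<^sub>R g3"
  shows "\<exists>z. kuhn_tile v g1 g2 g3 = alcove (roots w1 w2 w3) a z"
proof
  \<comment> \<open>The centroid: the coordinates 3/4, 1/2, 1/4 and their differences are not
    integers, so no wall passes through it.\<close>
  define z where "z = v + (3/4) *\<^sub>R g1 + (1/2) *\<^sub>R g2 + (1/4) *\<^sub>R g3"
  have w: "w1 \<bullet> g1 = 1" "w1 \<bullet> g2 = 0" "w1 \<bullet> g3 = 0" "w2 \<bullet> g1 = 0" "w2 \<bullet> g2 = 1" "w2 \<bullet> g3 = 0"
     "w3 \<bullet> g1 = 0" "w3 \<bullet> g2 = 0" "w3 \<bullet> g3 = 1"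
    and sp: "\<And>v. v = (w1 \<bullet> v) *\<^sub>R g1 + (w2 \<bullet> v) *\<^sub>R g2 + (w3 \<bullet> v) *\<^sub>R g3"
    using fr unfolding frame3_def by blast+
  have za: "w1 \<bullet> (z - a) = of_int z1 + 3/4" "w2 \<bullet> (z - a) = of_int z2 + 1/2" "w3 \<bullet> (z - a) = of_int z3 + 1/4"
    by (simp_all add: z_def v inner_add_right inner_diff_right w)
  have fl: "\<lfloor>w1 \<bullet> (z - a)\<rfloor> = z1" "\<lfloor>w2 \<bullet> (z - a)\<rfloor> = z2" "\<lfloor>w3 \<bullet> (z - a)\<rfloor> = z3"
    "\<lfloor>- w1 \<bullet> (z - a)\<rfloor> = - z1 - 1" "\<lfloor>- w2 \<bullet> (z - a)\<rfloor> = - z2 - 1" "\<lfloor>- w3 \<bullet> (z - a)\<rfloor> = - z3 - 1"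
    "\<lfloor>(w1 - w2) \<bullet> (z - a)\<rfloor> = z1 - z2" "\<lfloor>(w1 - w3) \<bullet> (z - a)\<rfloor> = z1 - z3" "\<lfloor>(w2 - w3) \<bullet> (z - a)\<rfloor> = z2 - z3"
    "\<lfloor>(w2 - w1) \<bullet> (z - a)\<rfloor> = z2 - z1 - 1" "\<lfloor>(w3 - w1) \<bullet> (z - a)\<rfloor> = z3 - z1 - 1" "\<lfloor>(w3 - w2) \<bullet> (z - a)\<rfloor> = z3 - z2 - 1"
    unfolding inner_diff_left inner_minus_left za by (rule floor_unique; simp)+
  have mem: "p \<in> alcove (roots w1 w2 w3) a z \<longleftrightarrow>
      of_int z3 \<le> w3 \<bullet> (p - a) \<and> w3 \<bullet> (p - a) - of_int z3 \<le> w2 \<bullet> (p - a) - of_int z2 \<and>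
      w2 \<bullet> (p - a) - of_int z2 \<le> w1 \<bullet> (p - a) - of_int z1 \<and> w1 \<bullet> (p - a) - of_int z1 \<le> 1" for p
    unfolding alcove_def roots_def mem_Collect_eq ball_simps fl
    by (simp add: inner_diff_left) linarith
  show "kuhn_tile v g1 g2 g3 = alcove (roots w1 w2 w3) a z"
  proof
    show "kuhn_tile v g1 g2 g3 \<subseteq> alcove (roots w1 w2 w3) a z"
      unfolding kuhn_tile_def
    proof (rule hull_minimal)
      show "{v, v + g1, v + g1 + g2, v + g1 + g2 + g3} \<subseteq> alcove (roots w1 w2 w3) a z"
        unfolding insert_subset mem by (simp add: v inner_add_right inner_diff_right w)
    qed (rule convex_alcove)
    show "alcove (roots w1 w2 w3) a z \<subseteq> kuhn_tile v g1 g2 g3"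
    proof
      fix p assume "p \<in> alcove (roots w1 w2 w3) a z"
      note p = this[unfolded mem]
      have "p = a + ((w1 \<bullet> (p - a)) *\<^sub>R g1 + (w2 \<bullet> (p - a)) *\<^sub>R g2 + (w3 \<bullet> (p - a)) *\<^sub>R g3)"
        using sp[of "p - a"] by (metis add.commute diff_add_cancel)
      also have "\<dots> = v + (w1 \<bullet> (p - a) - of_int z1) *\<^sub>R g1 + (w2 \<bullet> (p - a) - of_int z2) *\<^sub>R g2
          + (w3 \<bullet> (p - a) - of_int z3) *\<^sub>R g3"
        unfolding v by (simp add: scaleR_diff_left)
      also have "\<dots> \<in> kuhn_tile v g1 g2 g3" using p by (intro in_kuhn_tile) auto
      finally show "p \<in> kuhn_tile v g1 g2 g3" .
    qed
  qed
qed

text \<open>Equal distances give equal Gram matrices of the edge vectors, so the linear map that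
  matches these vectors is orthogonal.\<close>

lemma congruent_isometry:
  assumes o: "orient3 p q x y \<noteq> 0"
    and d: "dist p' q' = dist p q" "dist p' x' = dist p x" "dist p' y' = dist p y"
      "dist q' x' = dist q x" "dist q' y' = dist q y" "dist x' y' = dist x y"
  obtains h b where "orthogonal_transformation h" "h p + b = p'" "h q + b = q'" "h x + b = x'" "h y + b = y'"
    "orient3 p' q' x' y' = det (matrix h) * orient3 p q x y"
proof -
  define f1 f2 f3 where "f1 = q - p" and "f2 = x - p" and "f3 = y - p"
  define g1 g2 g3 where "g1 = q' - p'" and "g2 = x' - p'" and "g3 = y' - p'"
  have "f1 \<bullet> cross3 f2 f3 \<noteq> 0" using o by (simp add: orient3_def f1_def f2_def f3_def)
  then obtain w1 w2 w3 where fr: "frame3 f1 f2 f3 w1 w2 w3" by (rule frame3_exists)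
  have w: "w1 \<bullet> f1 = 1" "w1 \<bullet> f2 = 0" "w1 \<bullet> f3 = 0" "w2 \<bullet> f1 = 0" "w2 \<bullet> f2 = 1" "w2 \<bullet> f3 = 0"
     "w3 \<bullet> f1 = 0" "w3 \<bullet> f2 = 0" "w3 \<bullet> f3 = 1"
    and sp: "\<And>v. v = (w1 \<bullet> v) *\<^sub>R f1 + (w2 \<bullet> v) *\<^sub>R f2 + (w3 \<bullet> v) *\<^sub>R f3"
    using fr unfolding frame3_def by blast+
  have gram: "g1 \<bullet> g1 = f1 \<bullet> f1" "g1 \<bullet> g2 = f1 \<bullet> f2" "g1 \<bullet> g3 = f1 \<bullet> f3" "g2 \<bullet> g2 = f2 \<bullet> f2"
    "g2 \<bullet> g3 = f2 \<bullet> f3" "g3 \<bullet> g3 = f3 \<bullet> f3" "g2 \<bullet> g1 = f2 \<bullet> f1" "g3 \<bullet> g1 = f3 \<bullet> f1" "g3 \<bullet> g2 = f3 \<bullet> f2"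
    unfolding f1_def f2_def f3_def g1_def g2_def g3_def inner_dist using d by (simp_all add: dist_commute)
  define h where "h v = (w1 \<bullet> v) *\<^sub>R g1 + (w2 \<bullet> v) *\<^sub>R g2 + (w3 \<bullet> v) *\<^sub>R g3" for v
  have lin: "linear h" by (rule linearI) (simp_all add: h_def inner_add_right algebra_simps)
  have "h v \<bullet> h v' = v \<bullet> v'" for v v'
  proof -
    have "h v \<bullet> h v' = ((w1 \<bullet> v) *\<^sub>R f1 + (w2 \<bullet> v) *\<^sub>R f2 + (w3 \<bullet> v) *\<^sub>R f3) \<bullet>
       ((w1 \<bullet> v') *\<^sub>R f1 + (w2 \<bullet> v') *\<^sub>R f2 + (w3 \<bullet> v') *\<^sub>R f3)"
      unfolding h_def by (simp only: inner_add_left inner_add_right inner_scaleR_left inner_scaleR_right gram)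
    then show ?thesis by (simp only: sp[symmetric])
  qed
  then have orth: "orthogonal_transformation h" using lin by (simp add: orthogonal_transformation_def)
  define b where "b = p' - h p"
  have hf: "h f1 = g1" "h f2 = g2" "h f3 = g3" by (simp_all add: h_def w)
  have m: "h p + b = p'" "h q + b = q'" "h x + b = x'" "h y + b = y'"
    using hf unfolding b_def f1_def f2_def f3_def g1_def g2_def g3_def linear_diff[OF lin]
    by (simp_all add: algebra_simps)
  have "orient3 p' q' x' y' = g1 \<bullet> cross3 g2 g3" by (simp add: orient3_def g1_def g2_def g3_def)
  also have "\<dots> = det (matrix h) * (f1 \<bullet> cross3 f2 f3)"
    unfolding hf[symmetric] cross_orthogonal_transformation[OF orth]
    using orth by (simp add: orthogonal_transformation_def)
  finally have "orient3 p' q' x' y' = det (matrix h) * orient3 p q x y"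
    by (simp add: orient3_def f1_def f2_def f3_def)
  then show thesis by (rule that[OF orth m])
qed

section \<open>The optimal tetrahedron and its tiling\<close>

definition sommerville :: "real \<Rightarrow> real^3 \<Rightarrow> real^3 \<Rightarrow> real^3 \<Rightarrow> real^3 \<Rightarrow> bool" where
  "sommerville s a b c d \<longleftrightarrow> dist a b = 2 * s \<and> dist c d = 2 * s \<and> dist a c = sqrt 3 * s \<and>
     dist b d = sqrt 3 * s \<and> dist a d = sqrt 3 * s \<and> dist b c = sqrt 3 * s"

lemma sommerville_orient3:
  assumes "sommerville s a b c d"
  shows "(orient3 a b c d)\<^sup>2 = 16 * s^6"
proof -
  have d: "(dist a b)\<^sup>2 = 4 * s\<^sup>2" "(dist c d)\<^sup>2 = 4 * s\<^sup>2" "(dist a c)\<^sup>2 = 3 * s\<^sup>2" "(dist b d)\<^sup>2 = 3 * s\<^sup>2"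
    "(dist a d)\<^sup>2 = 3 * s\<^sup>2" "(dist b c)\<^sup>2 = 3 * s\<^sup>2"
    using assms by (simp_all add: sommerville_def power_mult_distrib)
  show ?thesis unfolding orient3_def triple_square inner_dist d
    by (simp add: d field_simps power2_eq_square power_def numeral_eq_Suc)
qed

text \<open>Exchanging \<open>a\<close> and \<open>b\<close> preserves all lengths and reverses
  orientation, so a congruence can be corrected to a proper one. This makes the tiling
  orientation-preserving.\<close>

lemma sommerville_isometry:
  assumes S: "sommerville s a b c d" "sommerville s a' b' c' d'" and s: "s > 0"
  obtains f where "isometry3 f" "f ` (convex hull {a, b, c, d}) = convex hull {a', b', c', d'}"
    "rigid_motion3 f"
proof -
  have o: "orient3 a b c d \<noteq> 0" "orient3 a' b' c' d' \<noteq> 0"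
    using sommerville_orient3[OF S(1)] sommerville_orient3[OF S(2)] s by auto
  have ex: thesis if oo: "orient3 a' b' c' d' * orient3 a b c d > 0" and S': "sommerville s a' b' c' d'"
    and that: "\<And>f. isometry3 f \<Longrightarrow> f ` (convex hull {a, b, c, d}) = convex hull {a', b', c', d'} \<Longrightarrow> rigid_motion3 f \<Longrightarrow> thesis"
    for a' b' c' d' thesis
  proof -
    obtain h t where h: "orthogonal_transformation h" "h a + t = a'" "h b + t = b'" "h c + t = c'" "h d + t = d'"
      "orient3 a' b' c' d' = det (matrix h) * orient3 a b c d"
      by (rule congruent_isometry[OF o(1), of a' b' c' d']) (use S(1) S' in \<open>auto simp: sommerville_def\<close>)
    have "\<bar>det (matrix h)\<bar> = 1" using h(1) by (simp add: orthogonal_transformation_det)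
    then have "det (matrix h) = 1 \<or> det (matrix h) = -1" by linarith
    then have det: "det (matrix h) = 1"
    proof
      assume "det (matrix h) = -1"
      then have "- (orient3 a b c d * orient3 a b c d) > 0" using oo h(6) by simp
      then show ?thesis using zero_le_square[of "orient3 a b c d"] by linarith
    qed
    define f where "f x = h x + t" for x
    have rig: "rigid_motion3 f" unfolding rigid_motion3_def f_def[abs_def] using h(1) det by blast
    have iso: "isometry3 f" using rigid_motion3_dist[OF rig] by (simp add: isometry3_def)
    have "f ` (convex hull {a, b, c, d}) = convex hull {a', b', c', d'}"
      unfolding rigid_motion3_convex_hull[OF rig] by (simp add: f_def h(2-5))
    then show thesis using that[of f] iso rig by blast
  qed
  show thesis
  proof (cases "orient3 a' b' c' d' * orient3 a b c d > 0")
    case True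
    then show thesis using ex[OF True S(2)] that by blast
  next
    case False
    then have "orient3 b' a' c' d' * orient3 a b c d > 0"
      using o orient3_perm(1)[of b' a' c' d'] by (simp add: not_less order.order_iff_strict)
    moreover have "sommerville s b' a' c' d'" using S(2) by (simp add: sommerville_def dist_commute)
    moreover have "convex hull {b', a', c', d'} = convex hull {a', b', c', d'}" by (simp add: insert_commute)
    ultimately show thesis using ex[of b' a' c' d' thesis] that by metis
  qed
qed

lemma frame3_swap:
  assumes "frame3 f1 f2 f3 w1 w2 w3"
  shows "frame3 f2 f1 f3 w2 w1 w3" "frame3 f1 f3 f2 w1 w3 w2"
proof -
  have sp: "\<And>v. v = (w1 \<bullet> v) *\<^sub>R f1 + (w2 \<bullet> v) *\<^sub>R f2 + (w3 \<bullet> v) *\<^sub>R f3"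
    using assms unfolding frame3_def by blast
  have "v = (w2 \<bullet> v) *\<^sub>R f2 + (w1 \<bullet> v) *\<^sub>R f1 + (w3 \<bullet> v) *\<^sub>R f3" for v
    by (rule trans[OF sp]) (simp only: add_ac)
  then show "frame3 f2 f1 f3 w2 w1 w3" using assms unfolding frame3_def by blast
  have "v = (w1 \<bullet> v) *\<^sub>R f1 + (w3 \<bullet> v) *\<^sub>R f3 + (w2 \<bullet> v) *\<^sub>R f2" for v
    by (rule trans[OF sp]) (simp only: add_ac)
  then show "frame3 f1 f3 f2 w1 w3 w2" using assms unfolding frame3_def by blast
qed

lemma roots_swap: "roots w2 w1 w3 = roots w1 w2 w3" "roots w1 w3 w2 = roots w1 w2 w3"
  unfolding roots_def by blast+

text \<open>With minus their sum, the \<open>g\<close> point from the centre of a regular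
  tetrahedron to its vertices. Their inner products are symmetric, so all six orders give congruent
  Kuhn simplices.\<close>

lemma sommerville_kuhn:
  fixes g1 g2 g3 :: "real^3"
  assumes s: "s > 0" and g: "g1 \<bullet> g1 = 3 * s\<^sup>2" "g2 \<bullet> g2 = 3 * s\<^sup>2" "g3 \<bullet> g3 = 3 * s\<^sup>2"
    "g1 \<bullet> g2 = - s\<^sup>2" "g1 \<bullet> g3 = - s\<^sup>2" "g2 \<bullet> g3 = - s\<^sup>2"
  shows "sommerville s v (v + g1 + g2) (v + g1) (v + g1 + g2 + g3)"
    "kuhn_tile v g1 g2 g3 = convex hull {v, v + g1 + g2, v + g1, v + g1 + g2 + g3}"
proof -
  have g': "g2 \<bullet> g1 = - s\<^sup>2" "g3 \<bullet> g1 = - s\<^sup>2" "g3 \<bullet> g2 = - s\<^sup>2" using g by (simp_all add: inner_commute)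
  have n: "norm u = k * s" if "u \<bullet> u = k\<^sup>2 * s\<^sup>2" "k \<ge> 0" for u :: "real^3" and k
    using that s by (simp add: norm_eq_sqrt_inner real_sqrt_mult)
  have "norm (g1 + g2) = 2 * s" "norm (g2 + g3) = 2 * s"
    by (rule n; simp add: inner_add_left inner_add_right g g')+
  moreover have "norm g1 = sqrt 3 * s" "norm g2 = sqrt 3 * s" "norm g3 = sqrt 3 * s" "norm (g1 + g2 + g3) = sqrt 3 * s"
    by (rule n; simp add: inner_add_left inner_add_right g g')+
  moreover have "v - (v + g1 + g2) = - (g1 + g2)" "(v + g1) - (v + g1 + g2 + g3) = - (g2 + g3)" "v - (v + g1) = - g1"
    "(v + g1 + g2) - (v + g1 + g2 + g3) = - g3" "v - (v + g1 + g2 + g3) = - (g1 + g2 + g3)" "(v + g1 + g2) - (v + g1) = g2"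
    by simp_all
  ultimately show "sommerville s v (v + g1 + g2) (v + g1) (v + g1 + g2 + g3)"
    unfolding sommerville_def dist_norm by (simp only: norm_minus_cancel simp_thms)
  show "kuhn_tile v g1 g2 g3 = convex hull {v, v + g1 + g2, v + g1, v + g1 + g2 + g3}"
    unfolding kuhn_tile_def by (simp add: insert_commute)
qed

theorem sommerville_tiles:
  assumes S: "sommerville s a b c d" and s: "s > 0"
  shows "admits_op_ftf_tiling (convex hull {a, b, c, d})"
proof -
  \<comment> \<open>The path a, c, b, d follows edges of length \<open>sqrt 3 * s\<close>, so the
    given tetrahedron is the Kuhn simplex with these steps.\<close>
  define f1 f2 f3 where "f1 = c - a" and "f2 = b - c" and "f3 = d - b"
  have d: "(dist a b)\<^sup>2 = 4 * s\<^sup>2" "(dist c d)\<^sup>2 = 4 * s\<^sup>2" "(dist a c)\<^sup>2 = 3 * s\<^sup>2" "(dist b d)\<^sup>2 = 3 * s\<^sup>2"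
    "(dist a d)\<^sup>2 = 3 * s\<^sup>2" "(dist b c)\<^sup>2 = 3 * s\<^sup>2"
    using S by (simp_all add: sommerville_def power_mult_distrib)
  have d': "(dist c b)\<^sup>2 = 3 * s\<^sup>2" "(dist d c)\<^sup>2 = 4 * s\<^sup>2" "(dist d b)\<^sup>2 = 3 * s\<^sup>2" using d by (simp_all add: dist_commute)
  have ip: "(b - a) \<bullet> (b - a) = 4 * s\<^sup>2" "(c - a) \<bullet> (c - a) = 3 * s\<^sup>2" "(d - a) \<bullet> (d - a) = 3 * s\<^sup>2"
    "(b - a) \<bullet> (c - a) = 2 * s\<^sup>2" "(b - a) \<bullet> (d - a) = 2 * s\<^sup>2" "(c - a) \<bullet> (d - a) = s\<^sup>2"
    "(c - a) \<bullet> (b - a) = 2 * s\<^sup>2" "(d - a) \<bullet> (b - a) = 2 * s\<^sup>2" "(d - a) \<bullet> (c - a) = s\<^sup>2"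
    unfolding inner_dist d d' by simp_all
  have f2: "f2 = (b - a) - (c - a)" and f3: "f3 = (d - a) - (b - a)" by (simp_all add: f2_def f3_def)
  have g: "f1 \<bullet> f1 = 3 * s\<^sup>2" "f2 \<bullet> f2 = 3 * s\<^sup>2" "f3 \<bullet> f3 = 3 * s\<^sup>2"
    "f1 \<bullet> f2 = - s\<^sup>2" "f1 \<bullet> f3 = - s\<^sup>2" "f2 \<bullet> f3 = - s\<^sup>2"
    unfolding f1_def f2 f3 inner_diff_left[of "b - a" "c - a"] inner_diff_right[of _ "b - a" "c - a"]
      inner_diff_left[of "d - a" "b - a"] inner_diff_right[of _ "d - a" "b - a"] ip by simp_all
  have g': "f2 \<bullet> f1 = - s\<^sup>2" "f3 \<bullet> f1 = - s\<^sup>2" "f3 \<bullet> f2 = - s\<^sup>2" using g by (simp_all add: inner_commute)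
  have "(f1 \<bullet> cross3 f2 f3)\<^sup>2 = 16 * s^6"
    unfolding triple_square g by (simp add: power2_eq_square power_def numeral_eq_Suc)
  then have "f1 \<bullet> cross3 f2 f3 \<noteq> 0" using s by auto
  then obtain w1 w2 w3 where fr: "frame3 f1 f2 f3 w1 w2 w3" by (rule frame3_exists)
  have w: "w1 \<bullet> f1 = 1" "w1 \<bullet> f2 = 0" "w1 \<bullet> f3 = 0" "w2 \<bullet> f1 = 0" "w2 \<bullet> f2 = 1" "w2 \<bullet> f3 = 0"
     "w3 \<bullet> f1 = 0" "w3 \<bullet> f2 = 0" "w3 \<bullet> f3 = 1"
    and sp: "\<And>v. v = (w1 \<bullet> v) *\<^sub>R f1 + (w2 \<bullet> v) *\<^sub>R f2 + (w3 \<bullet> v) *\<^sub>R f3"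
    using fr unfolding frame3_def by blast+
  define N where "N = roots w1 w2 w3"
  have N: "N \<noteq> {}" "0 \<notin> N"
  proof -
    show "N \<noteq> {}" by (simp add: N_def roots_def)
    have ne: "u \<noteq> 0" if "u \<bullet> f1 \<noteq> 0 \<or> u \<bullet> f2 \<noteq> 0 \<or> u \<bullet> f3 \<noteq> 0" for u using that by auto
    have "u \<noteq> 0" if "u \<in> N" for u
      using that unfolding N_def roots_def insert_iff empty_iff
      by (elim disjE FalseE) (rule ne; simp add: inner_diff_left w)+
    then show "0 \<notin> N" by blast
  qed
  define perms where "perms = {(f1, f2, f3), (f1, f3, f2), (f2, f1, f3), (f2, f3, f1), (f3, f1, f2), (f3, f2, f1)}"
  define v where "v z1 z2 z3 = a + of_int z1 *\<^sub>R f1 + of_int z2 *\<^sub>R f2 + of_int z3 *\<^sub>R f3" for z1 z2 z3 :: int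
  define \<T> where "\<T> = {kuhn_tile (v z1 z2 z3) g1 g2 g3 | z1 z2 z3 g1 g2 g3. (g1, g2, g3) \<in> perms}"
  have \<T>_shape: "\<exists>a' b' c' d'. sommerville s a' b' c' d' \<and> Q = convex hull {a', b', c', d'}" if Q: "Q \<in> \<T>" for Q
  proof -
    obtain z1 z2 z3 g1 g2 g3 where Qe: "Q = kuhn_tile (v z1 z2 z3) g1 g2 g3" and gp: "(g1, g2, g3) \<in> perms"
      using Q unfolding \<T>_def by blast
    have "g1 \<bullet> g1 = 3 * s\<^sup>2" "g2 \<bullet> g2 = 3 * s\<^sup>2" "g3 \<bullet> g3 = 3 * s\<^sup>2"
      "g1 \<bullet> g2 = - s\<^sup>2" "g1 \<bullet> g3 = - s\<^sup>2" "g2 \<bullet> g3 = - s\<^sup>2"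
      using gp g g' unfolding perms_def by auto
    from sommerville_kuhn[OF s this] show ?thesis unfolding Qe by blast
  qed
  have \<T>_alcove: "\<exists>z. Q = alcove N a z" if Q: "Q \<in> \<T>" for Q
  proof -
    obtain z1 z2 z3 g1 g2 g3 where Qe: "Q = kuhn_tile (v z1 z2 z3) g1 g2 g3" and gp: "(g1, g2, g3) \<in> perms"
      using Q unfolding \<T>_def by blast
    note s1 = frame3_swap(1) and s2 = frame3_swap(2)
    from gp consider "(g1, g2, g3) = (f1, f2, f3)" | "(g1, g2, g3) = (f1, f3, f2)" | "(g1, g2, g3) = (f2, f1, f3)"
      | "(g1, g2, g3) = (f2, f3, f1)" | "(g1, g2, g3) = (f3, f1, f2)" | "(g1, g2, g3) = (f3, f2, f1)"
      unfolding perms_def by blast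
    then show ?thesis
    proof cases
      case 1
      have "\<exists>z. kuhn_tile (v z1 z2 z3) f1 f2 f3 = alcove (roots w1 w2 w3) a z"
        by (rule kuhn_tile_alcove[OF fr, of _ _ z1 z2 z3]) (simp add: v_def)
      then show ?thesis using 1 unfolding Qe N_def by simp
    next
      case 2
      have "\<exists>z. kuhn_tile (v z1 z2 z3) f1 f3 f2 = alcove (roots w1 w3 w2) a z"
        by (rule kuhn_tile_alcove[OF s2[OF fr], of _ _ z1 z3 z2]) (simp add: v_def add_ac)
      then show ?thesis using 2 unfolding Qe N_def roots_swap(2)[of w1 w3 w2] by simp
    next
      case 3
      have "\<exists>z. kuhn_tile (v z1 z2 z3) f2 f1 f3 = alcove (roots w2 w1 w3) a z"
        by (rule kuhn_tile_alcove[OF s1[OF fr], of _ _ z2 z1 z3]) (simp add: v_def add_ac)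
      then show ?thesis using 3 unfolding Qe N_def roots_swap(1)[of w2 w1 w3] by simp
    next
      case 4
      have "\<exists>z. kuhn_tile (v z1 z2 z3) f2 f3 f1 = alcove (roots w2 w3 w1) a z"
        by (rule kuhn_tile_alcove[OF s2[OF s1[OF fr]], of _ _ z2 z3 z1]) (simp add: v_def add_ac)
      moreover have "roots w2 w3 w1 = N" unfolding N_def using roots_swap by metis
      ultimately show ?thesis using 4 unfolding Qe by simp
    next
      case 5
      have "\<exists>z. kuhn_tile (v z1 z2 z3) f3 f1 f2 = alcove (roots w3 w1 w2) a z"
        by (rule kuhn_tile_alcove[OF s1[OF s2[OF fr]], of _ _ z3 z1 z2]) (simp add: v_def add_ac)
      moreover have "roots w3 w1 w2 = N" unfolding N_def using roots_swap by metis
      ultimately show ?thesis using 5 unfolding Qe by simp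
    next
      case 6
      have "\<exists>z. kuhn_tile (v z1 z2 z3) f3 f2 f1 = alcove (roots w3 w2 w1) a z"
        by (rule kuhn_tile_alcove[OF s1[OF s2[OF s1[OF fr]]], of _ _ z3 z2 z1]) (simp add: v_def add_ac)
      moreover have "roots w3 w2 w1 = N" unfolding N_def using roots_swap by metis
      ultimately show ?thesis using 6 unfolding Qe by simp
    qed
  qed
  have cover: "p \<in> \<Union>\<T>" for p
  proof -
    define x1 x2 x3 where "x1 = w1 \<bullet> (p - a)" and "x2 = w2 \<bullet> (p - a)" and "x3 = w3 \<bullet> (p - a)"
    \<comment> \<open>The order of the fractional parts decides which of the six simplices of the
      cell contains \<open>p\<close>.\<close>
    define y1 y2 y3 where "y1 = x1 - of_int \<lfloor>x1\<rfloor>" and "y2 = x2 - of_int \<lfloor>x2\<rfloor>" and "y3 = x3 - of_int \<lfloor>x3\<rfloor>"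
    define u where "u = v \<lfloor>x1\<rfloor> \<lfloor>x2\<rfloor> \<lfloor>x3\<rfloor>"
    have y: "0 \<le> y1" "y1 \<le> 1" "0 \<le> y2" "y2 \<le> 1" "0 \<le> y3" "y3 \<le> 1"
      unfolding y1_def y2_def y3_def by linarith+
    have "p = a + (x1 *\<^sub>R f1 + x2 *\<^sub>R f2 + x3 *\<^sub>R f3)"
      using sp[of "p - a"] unfolding x1_def x2_def x3_def by (metis add.commute diff_add_cancel)
    then have p: "p = u + y1 *\<^sub>R f1 + y2 *\<^sub>R f2 + y3 *\<^sub>R f3"
      by (simp add: u_def v_def y1_def y2_def y3_def scaleR_diff_left)
    have mem: "kuhn_tile u g1 g2 g3 \<in> \<T>" if "(g1, g2, g3) \<in> perms" for g1 g2 g3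
      using that unfolding \<T>_def u_def by blast
    have pp: "p = u + y1 *\<^sub>R f1 + y3 *\<^sub>R f3 + y2 *\<^sub>R f2" "p = u + y2 *\<^sub>R f2 + y1 *\<^sub>R f1 + y3 *\<^sub>R f3"
      "p = u + y2 *\<^sub>R f2 + y3 *\<^sub>R f3 + y1 *\<^sub>R f1" "p = u + y3 *\<^sub>R f3 + y1 *\<^sub>R f1 + y2 *\<^sub>R f2"
      "p = u + y3 *\<^sub>R f3 + y2 *\<^sub>R f2 + y1 *\<^sub>R f1" using p by (simp_all only: add_ac)
    consider "y2 \<le> y1" "y3 \<le> y2" | "y3 \<le> y1" "y2 \<le> y3" | "y1 \<le> y2" "y3 \<le> y1" | "y3 \<le> y2" "y1 \<le> y3"
      | "y1 \<le> y3" "y2 \<le> y1" | "y2 \<le> y3" "y1 \<le> y2" by linarith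
    then show ?thesis
    proof cases
      case 1
      then have "p \<in> kuhn_tile u f1 f2 f3" unfolding p using y by (intro in_kuhn_tile)
      then show ?thesis using mem[of f1 f2 f3] unfolding perms_def by blast
    next
      case 2
      then have "p \<in> kuhn_tile u f1 f3 f2" unfolding pp(1) using y by (intro in_kuhn_tile)
      then show ?thesis using mem[of f1 f3 f2] unfolding perms_def by blast
    next
      case 3
      then have "p \<in> kuhn_tile u f2 f1 f3" unfolding pp(2) using y by (intro in_kuhn_tile)
      then show ?thesis using mem[of f2 f1 f3] unfolding perms_def by blast
    next
      case 4
      then have "p \<in> kuhn_tile u f2 f3 f1" unfolding pp(3) using y by (intro in_kuhn_tile)
      then show ?thesis using mem[of f2 f3 f1] unfolding perms_def by blast
    next
      case 5
      then have "p \<in> kuhn_tile u f3 f1 f2" unfolding pp(4) using y by (intro in_kuhn_tile)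
      then show ?thesis using mem[of f3 f1 f2] unfolding perms_def by blast
    next
      case 6
      then have "p \<in> kuhn_tile u f3 f2 f1" unfolding pp(5) using y by (intro in_kuhn_tile)
      then show ?thesis using mem[of f3 f2 f1] unfolding perms_def by blast
    qed
  qed
  have "face_to_face_tiling (convex hull {a, b, c, d}) \<T>"
    unfolding face_to_face_tiling_def
  proof (intro conjI ballI impI)
    show "\<exists>f. isometry3 f \<and> Q = f ` (convex hull {a, b, c, d})" if Q\<T>: "Q \<in> \<T>" for Q
    proof -
      obtain a' b' c' d' where Q: "sommerville s a' b' c' d'" "Q = convex hull {a', b', c', d'}"
        using \<T>_shape[OF Q\<T>] by blast
      show ?thesis using sommerville_isometry[OF S Q(1) s] Q(2) by metis
    qed
    show "\<Union>\<T> = UNIV" using cover by blast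
    show "interior Q \<inter> interior R = {}" if QR: "Q \<in> \<T>" "R \<in> \<T>" "Q \<noteq> R" for Q R
    proof -
      obtain z z' where "Q = alcove N a z" "R = alcove N a z'" using \<T>_alcove[OF QR(1)] \<T>_alcove[OF QR(2)] by blast
      then show ?thesis using alcove_interior_disjoint[OF _ N(2)] QR(3) by blast
    qed
    show "Q \<inter> R = {} \<or> Q \<inter> R face_of Q \<and> Q \<inter> R face_of R" if QR: "Q \<in> \<T>" "R \<in> \<T>" "Q \<noteq> R" for Q R
    proof -
      obtain z z' where "Q = alcove N a z" "R = alcove N a z'" using \<T>_alcove[OF QR(1)] \<T>_alcove[OF QR(2)] by blast
      then show ?thesis using alcove_Int_face_of[of N a z z'] alcove_Int_face_of[of N a z' z] N(1)
        by (metis Int_commute)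
    qed
  qed
  moreover have "orientation_preserving_tiling \<T>"
    unfolding orientation_preserving_tiling_def
  proof (intro ballI)
    fix Q R assume QR: "Q \<in> \<T>" "R \<in> \<T>"
    obtain a1 b1 c1 d1 where Q: "sommerville s a1 b1 c1 d1" "Q = convex hull {a1, b1, c1, d1}"
      using \<T>_shape[OF QR(1)] by blast
    obtain a2 b2 c2 d2 where R: "sommerville s a2 b2 c2 d2" "R = convex hull {a2, b2, c2, d2}"
      using \<T>_shape[OF QR(2)] by blast
    show "\<exists>g. rigid_motion3 g \<and> g ` Q = R" using sommerville_isometry[OF Q(1) R(1) s] Q(2) R(2) by metis
  qed
  ultimately show ?thesis unfolding admits_op_ftf_tiling_def by blast
qed

lemma sommerville_surface_area:
  assumes S: "sommerville s a b c d"
  shows "tetra_surface_area a b c d = 4 * sqrt 2 * s\<^sup>2"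
proof -
  have d: "(dist a b)\<^sup>2 = 4 * s\<^sup>2" "(dist c d)\<^sup>2 = 4 * s\<^sup>2" "(dist a c)\<^sup>2 = 3 * s\<^sup>2" "(dist b d)\<^sup>2 = 3 * s\<^sup>2"
    "(dist a d)\<^sup>2 = 3 * s\<^sup>2" "(dist b c)\<^sup>2 = 3 * s\<^sup>2"
    using S by (simp_all add: sommerville_def power_mult_distrib)
  have area: "tri_area u v w = sqrt 2 * s\<^sup>2"
    if "((v - u) \<bullet> (v - u)) * ((w - u) \<bullet> (w - u)) - ((v - u) \<bullet> (w - u))\<^sup>2 = 8 * (s\<^sup>2)\<^sup>2" for u v w
  proof -
    have "(norm (cross3 (v - u) (w - u)))\<^sup>2 = (2 * sqrt 2 * s\<^sup>2)\<^sup>2"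
      unfolding norm_cross_square that by (simp add: power_mult_distrib)
    then have "norm (cross3 (v - u) (w - u)) = 2 * sqrt 2 * s\<^sup>2" by (subst (asm) power2_eq_iff_nonneg) auto
    then show ?thesis by (simp add: tri_area_def)
  qed
  have "tri_area a b c = sqrt 2 * s\<^sup>2" "tri_area a b d = sqrt 2 * s\<^sup>2"
    "tri_area a c d = sqrt 2 * s\<^sup>2" "tri_area b c d = sqrt 2 * s\<^sup>2"
    by (rule area; unfold inner_dist d; simp add: d power2_eq_square)+
  then show ?thesis by (simp add: tetra_surface_area_def)
qed

theorem theorem5p2:
  fixes a b c d :: "real^3" and s :: real
  assumes "s > 0"
    and "dist a b = 2 * s" and "dist c d = 2 * s"
    and "dist a c = sqrt 3 * s" and "dist b d = sqrt 3 * s"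
    and "dist a d = sqrt 3 * s" and "dist b c = sqrt 3 * s"
    and "measure lebesgue (convex hull {a, b, c, d}) = 1"
  shows "admits_op_ftf_tiling (convex hull {a, b, c, d}) \<and>
         (\<forall>a' b' c' d' :: real^3.
            aff_dim {a', b', c', d'} = 3 \<and>
            measure lebesgue (convex hull {a', b', c', d'}) = 1 \<and>
            admits_op_ftf_tiling (convex hull {a', b', c', d'})
            \<longrightarrow> tetra_surface_area a b c d \<le> tetra_surface_area a' b' c' d')"
proof -
  have S: "sommerville s a b c d" using assms by (simp add: sommerville_def)
  have "\<bar>orient3 a b c d\<bar> = 6" using assms(8) measure_tetrahedron[of a b c d] by simp
  then have "(orient3 a b c d)\<^sup>2 = 6\<^sup>2" by (metis power2_abs)
  \<comment> \<open>Unit volume fixes the scale: 16 s^6 = 36, and then 128 * 9/4 = 288.\<close>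
  then have s6: "s^6 = 9/4" using sommerville_orient3[OF S] by simp
  have "(tetra_surface_area a b c d)^3 = (4 * sqrt 2)^3 * s^6"
    unfolding sommerville_surface_area[OF S] power_mult_distrib by (simp flip: power_mult)
  also have "(4 * sqrt 2)^3 = 128 * sqrt (2::real)" by (simp add: power_mult_distrib power3_eq_cube)
  finally have T: "(tetra_surface_area a b c d)^3 = 288 * sqrt 2" by (simp add: s6)
  have nonneg: "tetra_surface_area w x y z \<ge> 0" for w x y z by (simp add: tetra_surface_area_def tri_area_def)
  have "tetra_surface_area a b c d \<le> tetra_surface_area a' b' c' d'"
    if "measure lebesgue (convex hull {a', b', c', d'}) = 1" "admits_op_ftf_tiling (convex hull {a', b', c', d'})"
    for a' b' c' d'
  proof -
    have "(tetra_surface_area a b c d)^3 \<le> (tetra_surface_area a' b' c' d')^3"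
      unfolding T by (rule surface_area_lower_bound[OF that])
    then show ?thesis using nonneg by (simp add: power_mono_iff)
  qed
  then show ?thesis using sommerville_tiles[OF S assms(1)] by blast
qed

end
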